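(* Let $(M,\Pi)\stackrel{\phi}{\to}(B,\pi)$ be an NCI system of rank $r$. Then the quotient sheaf of $C^\infty_B$-modules on $B$ $$\mathcal E_B:=\operatorname{Ker}\pi^\sharp/\operatorname{Ker}(\Pi^\sharp\circ\phi^* )$$ is the sheaf of sections of a (smooth, real) vector bundle $E\to B$ of rank $r$.
   Context: All manifolds and objects are smooth and real. For a Poisson manifold $(M,\Pi)$ write $\{f,g\}=\Pi(df,dg)$; the Hamiltonian vector field $X_h$ is given by $X_h(g)=\{g,h\}$, and $\Pi^\sharp:T^*M\to TM$ is the induced bundle map, with $\Pi^\sharp(dh)=-X_h$. A (local) first integral of a foliation is a (locally defined) function constant on its leaves. An abstract NCI system (non-commutative integrable system) of rank $r$ on $(M,\Pi)$ is an $r$-dimensional foliation $\mathfrak F$ of $M$ whose tangent bundle $T\mathfrak F$ is spanned by Hamiltonian vector fields of local first integrals: each $m\in M$ has a neighborhood on which there are first integrals $f_1,\dots,f_r$ of $\mathfrak F$ such that $X_{f_1},\dots,X_{f_r}$ span $T\mathfrak F$ at every point. An NCI system $(M,\Pi)\stackrel{\phi}{\to}(B,\pi)$ of rank $r$ is such an abstract NCI system whose leaf space $B$ is a smooth Hausdorff manifold; $\phi:M\to B$ is the quotient map, a surjective submersion whose fibers are the (connected) leaves of $\mathfrak F$, and $\pi$ is the unique Poisson structure on $B$ making $\phi$ a Poisson map. For $V\subset B$ open, $\Omega^1_B(V)$ is the space of 1-forms on $V$, $(\operatorname{Ker}\pi^\sharp)(V):=\{\omega\in\Omega^1_B(V)\mid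 \pi^\sharp(\omega)=0\}$ and $\operatorname{Ker}(\Pi^\sharp\circ\phi^* )(V):=\{\omega\in\Omega^1_B(V)\mid \Pi^\sharp(\phi^*\omega)=0 \text{ on }\phi^{-1}(V)\}$. Since $\phi$ is a surjective Poisson submersion, the second sheaf is a subsheaf of the first; the quotient is taken in sheaves of $C^\infty_B$-modules. *)

theory Defs
  imports "HOL-Analysis.Analysis"
begin

section \<open>Smooth manifolds\<close>

text \<open>\<open>Ck_on k f S\<close> is only meant for open sets \<open>S\<close>, in finite dimension: all iterated
  directional derivatives up to order \<open>k\<close> exist as Frechet derivatives and are continuous.\<close>

primrec Ck_on :: "nat \<Rightarrow> ('v::real_normed_vector \<Rightarrow> 'w::real_normed_vector) \<Rightarrow> 'v set \<Rightarrow> bool" where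
  "Ck_on 0 f S \<longleftrightarrow> continuous_on S f"
| "Ck_on (Suc k) f S \<longleftrightarrow> (\<forall>x\<in>S. f differentiable (at x)) \<and>
     (\<forall>v. Ck_on k (\<lambda>x. frechet_derivative f (at x) v) S)"

definition smooth_on :: "('v::real_normed_vector \<Rightarrow> 'w::real_normed_vector) \<Rightarrow> 'v set \<Rightarrow> bool" where
  "smooth_on f S \<longleftrightarrow> (\<forall>k. Ck_on k f S)"

type_synonym ('p, 'v) chart = "'p set \<times> ('p \<Rightarrow> 'v)"

definition chart_inv :: "('p, 'v) chart \<Rightarrow> 'v \<Rightarrow> 'p" where
  "chart_inv c = inv_into (fst c) (snd c)"

definition transition :: "('p, 'v) chart \<Rightarrow> ('p, 'v) chart \<Rightarrow> 'v \<Rightarrow> 'v" where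
  "transition c d = snd d \<circ> chart_inv c"

record ('p, 'v) manifold =
  Top :: "'p topology"
  Atlas :: "('p, 'v) chart set"

definition topological_chart :: "'p topology \<Rightarrow> ('p, 'v::euclidean_space) chart \<Rightarrow> bool" where
  "topological_chart X c \<longleftrightarrow> openin X (fst c) \<and> open (snd c ` fst c) \<and>
     homeomorphic_map (subtopology X (fst c)) (top_of_set (snd c ` fst c)) (snd c)"

definition compatible_charts :: "('p, 'v::euclidean_space) chart \<Rightarrow> ('p, 'v) chart \<Rightarrow> bool" where
  "compatible_charts c d \<longleftrightarrow>
     smooth_on (transition c d) (snd c ` (fst c \<inter> fst d)) \<and>
     smooth_on (transition d c) (snd d ` (fst c \<inter> fst d))"

text \<open>A smooth manifold of dimension \<open>DIM('v)\<close>; the smooth structure is a maximal atlas.\<close>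

definition smooth_manifold :: "('p, 'v::euclidean_space) manifold \<Rightarrow> bool" where
  "smooth_manifold M \<longleftrightarrow>
     Hausdorff_space (Top M) \<and> second_countable (Top M) \<and>
     (\<forall>c\<in>Atlas M. topological_chart (Top M) c) \<and>
     \<Union> (fst ` Atlas M) = topspace (Top M) \<and>
     (\<forall>c\<in>Atlas M. \<forall>d\<in>Atlas M. compatible_charts c d) \<and>
     (\<forall>c. topological_chart (Top M) c \<and> (\<forall>d\<in>Atlas M. compatible_charts c d) \<longrightarrow> c \<in> Atlas M)"

definition charts_at :: "('p, 'v) manifold \<Rightarrow> 'p \<Rightarrow> ('p, 'v) chart set" where
  "charts_at M p = {c \<in> Atlas M. p \<in> fst c}"

definition smooth_fun :: "('p, 'v::euclidean_space) manifold \<Rightarrow> 'p set \<Rightarrow> ('p \<Rightarrow> real) \<Rightarrow> bool" where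
  "smooth_fun M U f \<longleftrightarrow> openin (Top M) U \<and>
     (\<forall>c\<in>Atlas M. smooth_on (f \<circ> chart_inv c) (snd c ` (fst c \<inter> U)))"

definition smooth_map :: "('p, 'v::euclidean_space) manifold \<Rightarrow> ('q, 'w::euclidean_space) manifold \<Rightarrow>
    ('p \<Rightarrow> 'q) \<Rightarrow> bool" where
  "smooth_map M N \<phi> \<longleftrightarrow> continuous_map (Top M) (Top N) \<phi> \<and>
     (\<forall>c\<in>Atlas M. \<forall>d\<in>Atlas N.
        smooth_on (snd d \<circ> \<phi> \<circ> chart_inv c) (snd c ` {p \<in> fst c. \<phi> p \<in> fst d}))"


section \<open>Tangent and cotangent spaces, 1-forms\<close>

text \<open>A tangent vector at \<open>p\<close> is the family of its coordinate vectors in all charts around \<open>p\<close>,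
  subject to the usual transformation rule (and 0 at the charts that do not contain \<open>p\<close>, so that
  equality of families is equality of tangent vectors).\<close>

type_synonym ('p, 'v) tangent = "('p, 'v) chart \<Rightarrow> 'v"
type_synonym ('p, 'v) cotangent = "('p, 'v) tangent \<Rightarrow> real"

definition tangent_space ::
    "('p, 'v::euclidean_space) manifold \<Rightarrow> 'p \<Rightarrow> ('p, 'v) tangent set" where
  "tangent_space M p = {X.
     (\<forall>c\<in>charts_at M p. \<forall>d\<in>charts_at M p.
        X d = frechet_derivative (transition c d) (at (snd c p)) (X c)) \<and>
     (\<forall>c. c \<notin> charts_at M p \<longrightarrow> X c = 0)}"

definition coordinate_vector ::
    "('p, 'v::euclidean_space) manifold \<Rightarrow> ('p, 'v) chart \<Rightarrow> 'v \<Rightarrow> 'p \<Rightarrow> ('p, 'v) tangent" where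
  "coordinate_vector M c v p = (\<lambda>d. if d \<in> charts_at M p
     then frechet_derivative (transition c d) (at (snd c p)) v else 0)"

definition cotangent_space ::
    "('p, 'v::euclidean_space) manifold \<Rightarrow> 'p \<Rightarrow> ('p, 'v) cotangent set" where
  "cotangent_space M p = {\<alpha> \<in> extensional (tangent_space M p).
     (\<forall>X\<in>tangent_space M p. \<forall>Y\<in>tangent_space M p. \<alpha> (\<lambda>c. X c + Y c) = \<alpha> X + \<alpha> Y) \<and>
     (\<forall>a. \<forall>X\<in>tangent_space M p. \<alpha> (\<lambda>c. a *\<^sub>R X c) = a * \<alpha> X)}"

text \<open>In the next two definitions the chosen chart is irrelevant, by the chain rule.\<close>

definition diff_fun ::
    "('p, 'v::euclidean_space) manifold \<Rightarrow> ('p \<Rightarrow> real) \<Rightarrow> 'p \<Rightarrow> ('p, 'v) cotangent" where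
  "diff_fun M f p = (\<lambda>X\<in>tangent_space M p.
     let c = (SOME c. c \<in> charts_at M p)
     in frechet_derivative (f \<circ> chart_inv c) (at (snd c p)) (X c))"

definition diff_map :: "('p, 'v::euclidean_space) manifold \<Rightarrow> ('q, 'w::euclidean_space) manifold \<Rightarrow>
    ('p \<Rightarrow> 'q) \<Rightarrow> 'p \<Rightarrow> ('p, 'v) tangent \<Rightarrow> ('q, 'w) tangent" where
  "diff_map M N \<phi> p X = (\<lambda>d. if d \<in> charts_at N (\<phi> p) then
     let c = (SOME c. c \<in> charts_at M p)
     in frechet_derivative (snd d \<circ> \<phi> \<circ> chart_inv c) (at (snd c p)) (X c) else 0)"

definition pullback :: "('p, 'v::euclidean_space) manifold \<Rightarrow> ('q, 'w::euclidean_space) manifold \<Rightarrow>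
    ('p \<Rightarrow> 'q) \<Rightarrow> 'p \<Rightarrow> ('q, 'w) cotangent \<Rightarrow> ('p, 'v) cotangent" where
  "pullback M N \<phi> p \<alpha> = (\<lambda>X\<in>tangent_space M p. \<alpha> (diff_map M N \<phi> p X))"

definition submersion :: "('p, 'v::euclidean_space) manifold \<Rightarrow> ('q, 'w::euclidean_space) manifold \<Rightarrow>
    ('p \<Rightarrow> 'q) \<Rightarrow> bool" where
  "submersion M N \<phi> \<longleftrightarrow> smooth_map M N \<phi> \<and>
     (\<forall>p\<in>topspace (Top M). diff_map M N \<phi> p ` tangent_space M p = tangent_space N (\<phi> p))"

definition one_forms :: "('p, 'v::euclidean_space) manifold \<Rightarrow> 'p set \<Rightarrow>
    ('p \<Rightarrow> ('p, 'v) cotangent) set" where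
  "one_forms M V = {\<omega> \<in> extensional V.
     (\<forall>p\<in>V. \<omega> p \<in> cotangent_space M p) \<and>
     (\<forall>c\<in>Atlas M. \<forall>v. smooth_fun M (fst c \<inter> V) (\<lambda>p. \<omega> p (coordinate_vector M c v p)))}"


section \<open>Poisson manifolds\<close>

type_synonym ('p, 'v) bivector = "'p \<Rightarrow> ('p, 'v) cotangent \<Rightarrow> ('p, 'v) cotangent \<Rightarrow> real"

definition bivector_field :: "('p, 'v::euclidean_space) manifold \<Rightarrow> ('p, 'v) bivector \<Rightarrow> bool" where
  "bivector_field M P \<longleftrightarrow>
     (\<forall>p\<in>topspace (Top M). \<forall>\<alpha>\<in>cotangent_space M p. \<forall>\<beta>\<in>cotangent_space M p.
        P p \<alpha> \<beta> = - P p \<beta> \<alpha> \<and>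
        (\<forall>\<gamma>\<in>cotangent_space M p. \<forall>a b.
           P p (\<lambda>X\<in>tangent_space M p. a * \<alpha> X + b * \<beta> X) \<gamma> = a * P p \<alpha> \<gamma> + b * P p \<beta> \<gamma>)) \<and>
     (\<forall>U. openin (Top M) U \<longrightarrow> (\<forall>\<omega>\<in>one_forms M U. \<forall>\<eta>\<in>one_forms M U.
        smooth_fun M U (\<lambda>p. P p (\<omega> p) (\<eta> p))))"

definition poisson_bracket :: "('p, 'v::euclidean_space) manifold \<Rightarrow> ('p, 'v) bivector \<Rightarrow>
    ('p \<Rightarrow> real) \<Rightarrow> ('p \<Rightarrow> real) \<Rightarrow> 'p \<Rightarrow> real" where
  "poisson_bracket M P f g p = P p (diff_fun M f p) (diff_fun M g p)"

definition poisson_manifold :: "('p, 'v::euclidean_space) manifold \<Rightarrow> ('p, 'v) bivector \<Rightarrow> bool" where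
  "poisson_manifold M P \<longleftrightarrow> smooth_manifold M \<and> bivector_field M P \<and>
     (\<forall>U f g h. smooth_fun M U f \<and> smooth_fun M U g \<and> smooth_fun M U h \<longrightarrow>
        (\<forall>p\<in>U. poisson_bracket M P f (poisson_bracket M P g h) p
             + poisson_bracket M P g (poisson_bracket M P h f) p
             + poisson_bracket M P h (poisson_bracket M P f g) p = 0))"

definition poisson_map :: "('p, 'v::euclidean_space) manifold \<Rightarrow> ('p, 'v) bivector \<Rightarrow>
    ('q, 'w::euclidean_space) manifold \<Rightarrow> ('q, 'w) bivector \<Rightarrow> ('p \<Rightarrow> 'q) \<Rightarrow> bool" where
  "poisson_map M P N Q \<phi> \<longleftrightarrow> smooth_map M N \<phi> \<and>
     (\<forall>V f g. smooth_fun N V f \<and> smooth_fun N V g \<longrightarrow>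
        (\<forall>p\<in>topspace (Top M). \<phi> p \<in> V \<longrightarrow>
           poisson_bracket M P (f \<circ> \<phi>) (g \<circ> \<phi>) p = poisson_bracket N Q f g (\<phi> p)))"

text \<open>The identification of a finite-dimensional space with its bidual.\<close>

definition vector_of_functional :: "('p, 'v::euclidean_space) manifold \<Rightarrow> 'p \<Rightarrow>
    (('p, 'v) cotangent \<Rightarrow> real) \<Rightarrow> ('p, 'v) tangent" where
  "vector_of_functional M p l =
     (THE X. X \<in> tangent_space M p \<and> (\<forall>\<beta>\<in>cotangent_space M p. \<beta> X = l \<beta>))"

definition sharp :: "('p, 'v::euclidean_space) manifold \<Rightarrow> ('p, 'v) bivector \<Rightarrow> 'p \<Rightarrow>
    ('p, 'v) cotangent \<Rightarrow> ('p, 'v) tangent" where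
  "sharp M P p \<alpha> = vector_of_functional M p (\<lambda>\<beta>. P p \<alpha> \<beta>)"

text \<open>With this sign, \<open>X\<^sub>h(g) = dg(X\<^sub>h) = \<Pi>(dg, dh) = {g, h}\<close> and \<open>\<Pi>\<^sup>\<sharp>(dh) = - X\<^sub>h\<close>.\<close>

definition hamiltonian_vector :: "('p, 'v::euclidean_space) manifold \<Rightarrow> ('p, 'v) bivector \<Rightarrow>
    ('p \<Rightarrow> real) \<Rightarrow> 'p \<Rightarrow> ('p, 'v) tangent" where
  "hamiltonian_vector M P h p = vector_of_functional M p (\<lambda>\<beta>. P p \<beta> (diff_fun M h p))"


section \<open>Foliations and non-commutative integrable systems\<close>

text \<open>A foliation of dimension \<open>r\<close>, given by a foliated atlas \<open>D\<close>: up to a linear change of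
  coordinates the \<open>r\<close>-dimensional subspace \<open>S\<close> is the first factor of \<open>\<real>\<^sup>r \<times> \<real>\<^sup>n\<^sup>-\<^sup>r\<close>. The plaques of a
  chart are the intersections of its (convex) image with the translates of \<open>S\<close>; they are
  connected. The last condition says that locally the transition maps have the form
  \<open>(x, y) \<mapsto> (g(x, y), h(y))\<close> with \<open>h\<close> injective.\<close>

definition foliated_atlas :: "('p, 'v::euclidean_space) manifold \<Rightarrow> nat \<Rightarrow> 'v set \<Rightarrow>
    ('p, 'v) chart set \<Rightarrow> bool" where
  "foliated_atlas M r S D \<longleftrightarrow> subspace S \<and> dim S = r \<and>
     D \<subseteq> Atlas M \<and> \<Union> (fst ` D) = topspace (Top M) \<and>
     (\<forall>c\<in>D. convex (snd c ` fst c)) \<and>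
     (\<forall>c\<in>D. \<forall>d\<in>D. \<forall>p\<in>fst c \<inter> fst d. \<exists>W. openin (Top M) W \<and> p \<in> W \<and> W \<subseteq> fst c \<inter> fst d \<and>
        (\<forall>x\<in>W. \<forall>y\<in>W. snd c x - snd c y \<in> S \<longleftrightarrow> snd d x - snd d y \<in> S))"

definition same_plaque :: "'v::euclidean_space set \<Rightarrow> ('p, 'v) chart set \<Rightarrow> 'p \<Rightarrow> 'p \<Rightarrow> bool" where
  "same_plaque S D p q \<longleftrightarrow> (\<exists>c\<in>D. p \<in> fst c \<and> q \<in> fst c \<and> snd c p - snd c q \<in> S)"

text \<open>Leaves are the classes of this equivalence relation: two points lie on the same leaf iff
  they are joined by a finite chain of plaques.\<close>

definition same_leaf :: "'v::euclidean_space set \<Rightarrow> ('p, 'v) chart set \<Rightarrow> 'p \<Rightarrow> 'p \<Rightarrow> bool" where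
  "same_leaf S D = (same_plaque S D)\<^sup>*\<^sup>*"

definition leaf_tangent_space :: "('p, 'v::euclidean_space) manifold \<Rightarrow> 'v set \<Rightarrow>
    ('p, 'v) chart set \<Rightarrow> 'p \<Rightarrow> ('p, 'v) tangent set" where
  "leaf_tangent_space M S D p = {X \<in> tangent_space M p. \<forall>c\<in>D. p \<in> fst c \<longrightarrow> X c \<in> S}"

definition first_integral :: "('p, 'v::euclidean_space) manifold \<Rightarrow> 'v set \<Rightarrow> ('p, 'v) chart set \<Rightarrow>
    'p set \<Rightarrow> ('p \<Rightarrow> real) \<Rightarrow> bool" where
  "first_integral M S D U f \<longleftrightarrow> smooth_fun M U f \<and>
     (\<forall>p\<in>U. \<forall>q\<in>U. same_leaf S D p q \<longrightarrow> f p = f q)"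

definition abstract_nci :: "('p, 'v::euclidean_space) manifold \<Rightarrow> ('p, 'v) bivector \<Rightarrow> nat \<Rightarrow>
    'v set \<Rightarrow> ('p, 'v) chart set \<Rightarrow> bool" where
  "abstract_nci M P r S D \<longleftrightarrow> poisson_manifold M P \<and> foliated_atlas M r S D \<and>
     (\<forall>m\<in>topspace (Top M). \<exists>U f. openin (Top M) U \<and> m \<in> U \<and>
        (\<forall>i<r. first_integral M S D U (f i)) \<and>
        (\<forall>p\<in>U. leaf_tangent_space M S D p =
           {X. \<exists>a::nat \<Rightarrow> real. X = (\<lambda>c. \<Sum>i<r. a i *\<^sub>R hamiltonian_vector M P (f i) p c)}))"

text \<open>\<open>B\<close> is the leaf space: its points are the leaves (fibres of \<open>\<phi>\<close>), and its dimension is that of \<open>M\<close>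
  minus that of the leaves. A surjective submersion is a quotient map, so \<open>\<phi>\<close> determines the
  topology and smooth structure of \<open>B\<close>, and the Poisson condition determines \<open>Q\<close>.\<close>

definition nci_system :: "('m, 'x::euclidean_space) manifold \<Rightarrow> ('m, 'x) bivector \<Rightarrow>
    ('b, 'y::euclidean_space) manifold \<Rightarrow> ('b, 'y) bivector \<Rightarrow> ('m \<Rightarrow> 'b) \<Rightarrow> nat \<Rightarrow> bool" where
  "nci_system M P B Q \<phi> r \<longleftrightarrow> (\<exists>S D. abstract_nci M P r S D \<and>
     poisson_manifold B Q \<and> DIM('x) = DIM('y) + r \<and>
     submersion M B \<phi> \<and> \<phi> ` topspace (Top M) = topspace (Top B) \<and>
     (\<forall>p\<in>topspace (Top M). \<forall>q\<in>topspace (Top M). \<phi> p = \<phi> q \<longleftrightarrow> same_leaf S D p q) \<and>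
     poisson_map M P B Q \<phi>)"


section \<open>Sheaves of modules over the smooth functions\<close>

text \<open>\<open>Sec F V\<close> is the set of sections over the open set \<open>V\<close>, \<open>Res F V W\<close> the restriction from \<open>V\<close> to
  \<open>W \<subseteq> V\<close>, and \<open>Smul F V f s\<close> is the product with a function \<open>f\<close> that is smooth on \<open>V\<close>.\<close>

record ('p, 's) module_sheaf =
  Sec :: "'p set \<Rightarrow> 's set"
  Add :: "'p set \<Rightarrow> 's \<Rightarrow> 's \<Rightarrow> 's"
  Smul :: "'p set \<Rightarrow> ('p \<Rightarrow> real) \<Rightarrow> 's \<Rightarrow> 's"
  Res :: "'p set \<Rightarrow> 'p set \<Rightarrow> 's \<Rightarrow> 's"

text \<open>The germ at \<open>b\<close>, in the quotient of \<open>F\<close> by the subsheaf \<open>G\<close>, of a section \<open>s\<close> of \<open>F\<close> over \<open>V\<close>, as an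
  equivalence class of pairs (neighbourhood, section): \<open>s\<close> and \<open>t\<close> have the same class iff near \<open>b\<close>
  they differ by a section of \<open>G\<close>.\<close>

definition quotient_germ :: "'p topology \<Rightarrow> ('p, 's) module_sheaf \<Rightarrow> ('p, 's) module_sheaf \<Rightarrow>
    'p set \<Rightarrow> 's \<Rightarrow> 'p \<Rightarrow> ('p set \<times> 's) set" where
  "quotient_germ T F G V s b = {(W, t). openin T W \<and> b \<in> W \<and> t \<in> Sec F W \<and>
     (\<exists>N u. openin T N \<and> b \<in> N \<and> N \<subseteq> V \<inter> W \<and> u \<in> Sec G N \<and>
        Res F V N s = Add F N (Res F W N t) u)}"

text \<open>The quotient in the category of sheaves, i.e. the sheaf associated with the presheaf
  \<open>V \<mapsto> F(V)/G(V)\<close>: a section over \<open>V\<close> is a family of germs which is locally induced by sections of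
  \<open>F\<close>. The sets united in \<open>Add\<close> and \<open>Smul\<close> all coincide, as the germ of a sum or a
  multiple does not depend on the representatives.\<close>

definition quotient_sheaf :: "'p topology \<Rightarrow> ('p, 's) module_sheaf \<Rightarrow> ('p, 's) module_sheaf \<Rightarrow>
    ('p, 'p \<Rightarrow> ('p set \<times> 's) set) module_sheaf" where
  "quotient_sheaf T F G = \<lparr>
     Sec = (\<lambda>V. {\<sigma> \<in> extensional V. \<forall>b\<in>V. \<exists>N s. openin T N \<and> b \<in> N \<and> N \<subseteq> V \<and> s \<in> Sec F N \<and>
       (\<forall>x\<in>N. \<sigma> x = quotient_germ T F G N s x)}),
     Add = (\<lambda>V \<sigma> \<tau>. \<lambda>b\<in>V. \<Union> {quotient_germ T F G N (Add F N s t) b | N s t.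
       (N, s) \<in> \<sigma> b \<and> (N, t) \<in> \<tau> b}),
     Smul = (\<lambda>V f \<sigma>. \<lambda>b\<in>V. \<Union> {quotient_germ T F G N (Smul F N f s) b | N s.
       N \<subseteq> V \<and> (N, s) \<in> \<sigma> b}),
     Res = (\<lambda>V W \<sigma>. restrict \<sigma> W)\<rparr>"

definition sheaf_isomorphic :: "('p, 'v::euclidean_space) manifold \<Rightarrow> ('p, 's) module_sheaf \<Rightarrow>
    ('p, 't) module_sheaf \<Rightarrow> bool" where
  "sheaf_isomorphic M F G \<longleftrightarrow> (\<exists>\<Phi>. \<forall>V. openin (Top M) V \<longrightarrow>
     bij_betw (\<Phi> V) (Sec F V) (Sec G V) \<and>
     (\<forall>s\<in>Sec F V. \<forall>t\<in>Sec F V. \<Phi> V (Add F V s t) = Add G V (\<Phi> V s) (\<Phi> V t)) \<and>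
     (\<forall>f. smooth_fun M V f \<longrightarrow> (\<forall>s\<in>Sec F V. \<Phi> V (Smul F V f s) = Smul G V f (\<Phi> V s))) \<and>
     (\<forall>W. openin (Top M) W \<and> W \<subseteq> V \<longrightarrow>
        (\<forall>s\<in>Sec F V. \<Phi> W (Res F V W s) = Res G V W (\<Phi> V s))))"

definition one_form_sheaf :: "('p, 'v::euclidean_space) manifold \<Rightarrow>
    ('p, 'p \<Rightarrow> ('p, 'v) cotangent) module_sheaf" where
  "one_form_sheaf M = \<lparr>
     Sec = one_forms M,
     Add = (\<lambda>V \<omega> \<eta>. \<lambda>p\<in>V. \<lambda>X\<in>tangent_space M p. \<omega> p X + \<eta> p X),
     Smul = (\<lambda>V f \<omega>. \<lambda>p\<in>V. \<lambda>X\<in>tangent_space M p. f p * \<omega> p X),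
     Res = (\<lambda>V W \<omega>. restrict \<omega> W)\<rparr>"

definition ker_sharp_sheaf :: "('b, 'y::euclidean_space) manifold \<Rightarrow> ('b, 'y) bivector \<Rightarrow>
    ('b, 'b \<Rightarrow> ('b, 'y) cotangent) module_sheaf" where
  "ker_sharp_sheaf B Q = one_form_sheaf B
     \<lparr>Sec := \<lambda>V. {\<omega> \<in> one_forms B V. \<forall>b\<in>V. sharp B Q b (\<omega> b) = (\<lambda>_. 0)}\<rparr>"

definition ker_sharp_pullback_sheaf :: "('m, 'x::euclidean_space) manifold \<Rightarrow> ('m, 'x) bivector \<Rightarrow>
    ('b, 'y::euclidean_space) manifold \<Rightarrow> ('m \<Rightarrow> 'b) \<Rightarrow>
    ('b, 'b \<Rightarrow> ('b, 'y) cotangent) module_sheaf" where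
  "ker_sharp_pullback_sheaf M P B \<phi> = one_form_sheaf B
     \<lparr>Sec := \<lambda>V. {\<omega> \<in> one_forms B V. \<forall>p\<in>topspace (Top M). \<phi> p \<in> V \<longrightarrow>
        sharp M P p (pullback M B \<phi> p (\<omega> (\<phi> p))) = (\<lambda>_. 0)}\<rparr>"

definition E_sheaf :: "('m, 'x::euclidean_space) manifold \<Rightarrow> ('m, 'x) bivector \<Rightarrow>
    ('b, 'y::euclidean_space) manifold \<Rightarrow> ('b, 'y) bivector \<Rightarrow> ('m \<Rightarrow> 'b) \<Rightarrow>
    ('b, 'b \<Rightarrow> ('b set \<times> ('b \<Rightarrow> ('b, 'y) cotangent)) set) module_sheaf" where
  "E_sheaf M P B Q \<phi> =
     quotient_sheaf (Top B) (ker_sharp_sheaf B Q) (ker_sharp_pullback_sheaf M P B \<phi>)"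


section \<open>Vector bundles\<close>

text \<open>A real vector bundle is given by its total space, projection, fibrewise linear structure and a
  bundle atlas. In a trivialization \<open>(V, t)\<close>, \<open>t\<close> maps a point over \<open>V\<close> to its fibre
  coordinates, an element of \<open>\<real>\<^sup>r\<close>, here the functions on \<open>nat\<close> vanishing from \<open>r\<close> on.\<close>

record ('b, 'e) vbundle =
  Total :: "'e set"
  Proj :: "'e \<Rightarrow> 'b"
  VAdd :: "'e \<Rightarrow> 'e \<Rightarrow> 'e"
  VScale :: "real \<Rightarrow> 'e \<Rightarrow> 'e"
  Triv :: "('b set \<times> ('e \<Rightarrow> nat \<Rightarrow> real)) set"

definition fibre :: "('b, 'e) vbundle \<Rightarrow> 'b \<Rightarrow> 'e set" where
  "fibre E b = {e \<in> Total E. Proj E e = b}"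

definition std_space :: "nat \<Rightarrow> (nat \<Rightarrow> real) set" where
  "std_space r = {x. \<forall>i\<ge>r. x i = 0}"

text \<open>The vector space axioms of the fibres are implied by the existence of bijections to \<open>\<real>\<^sup>r\<close> that
  respect the operations. Since the transition maps \<open>V \<inter> W \<rightarrow> GL(r, \<real>)\<close> are smooth (their entries are the
  functions in the last condition), the trivializations endow the total space with the structure of
  a smooth manifold of dimension \<open>DIM('y) + r\<close> for which they are fibrewise linear diffeomorphisms
  onto \<open>V \<times> \<real>\<^sup>r\<close>. Fibrewise choices of bases identify every rank \<open>r\<close> bundle over \<open>B\<close>
  with one whose total space is a set of pairs in \<open>'b \<times> (nat \<Rightarrow> real)\<close>, so this type is enough for
  existence statements.\<close>

definition vector_bundle :: "('b, 'y::euclidean_space) manifold \<Rightarrow> nat \<Rightarrow> ('b, 'e) vbundle \<Rightarrow> bool" where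
  "vector_bundle B r E \<longleftrightarrow>
     Proj E ` Total E \<subseteq> topspace (Top B) \<and>
     (\<forall>b\<in>topspace (Top B).
        (\<forall>e\<in>fibre E b. \<forall>e'\<in>fibre E b. VAdd E e e' \<in> fibre E b) \<and>
        (\<forall>a. \<forall>e\<in>fibre E b. VScale E a e \<in> fibre E b)) \<and>
     \<Union> (fst ` Triv E) = topspace (Top B) \<and>
     (\<forall>(V, t)\<in>Triv E. openin (Top B) V \<and>
        (\<forall>b\<in>V. bij_betw t (fibre E b) (std_space r) \<and>
           (\<forall>e\<in>fibre E b. \<forall>e'\<in>fibre E b. t (VAdd E e e') = (\<lambda>i. t e i + t e' i)) \<and>
           (\<forall>a. \<forall>e\<in>fibre E b. t (VScale E a e) = (\<lambda>i. a * t e i)))) \<and>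
     (\<forall>(V, t)\<in>Triv E. \<forall>(W, u)\<in>Triv E. \<forall>i<r. \<forall>j<r.
        smooth_fun B (V \<inter> W)
          (\<lambda>b. u (inv_into (fibre E b) t (\<lambda>k. if k = j then 1 else 0)) i))"

definition section_sheaf :: "('b, 'y::euclidean_space) manifold \<Rightarrow> nat \<Rightarrow> ('b, 'e) vbundle \<Rightarrow>
    ('b, 'b \<Rightarrow> 'e) module_sheaf" where
  "section_sheaf B r E = \<lparr>
     Sec = (\<lambda>V. {s \<in> extensional V. (\<forall>b\<in>V. s b \<in> fibre E b) \<and>
       (\<forall>(W, t)\<in>Triv E. \<forall>i<r. smooth_fun B (V \<inter> W) (\<lambda>b. t (s b) i))}),
     Add = (\<lambda>V s s'. \<lambda>b\<in>V. VAdd E (s b) (s' b)),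
     Smul = (\<lambda>V f s. \<lambda>b\<in>V. VScale E (f b) (s b)),
     Res = (\<lambda>V W s. restrict s W)\<rparr>"

end

theory Submission
  imports Defs
begin

text \<open>Let \<open>f\<^sub>1, \<dots>, f\<^sub>r\<close> be first integrals near a point of \<open>M\<close> whose Hamiltonian vector fields span the leaves.
  They descend to functions \<open>g\<^sub>i\<close> on an open subset of \<open>B\<close>, and the \<open>dg\<^sub>i\<close> are sections of \<open>Ker \<pi>\<^sup>\<sharp>\<close>, since \<open>d\<phi>\<close>
  kills the Hamiltonian vector fields of the \<open>f\<^sub>i\<close>. For \<open>\<xi>\<close> in the kernel of \<open>\<pi>\<^sup>\<sharp>\<close> at \<open>\<phi>(p)\<close>, the vector
  \<open>\<Pi>\<^sup>\<sharp>(\<phi>\<^sup>*\<xi>)\<close> at \<open>p\<close> is tangent to the leaf, so subtracting a unique combination of the \<open>dg\<^sub>i\<close> from \<open>\<xi>\<close> makes it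
  vanish at \<open>p\<close>. It then vanishes on the whole fibre: if \<open>\<xi> = dh\<close>, the Hamiltonian vector field of \<open>h \<circ> \<phi>\<close>
  commutes with those of the \<open>f\<^sub>i\<close> by the Jacobi identity, hence satisfies a linear differential equation
  along each leaf. Thus the \<open>dg\<^sub>i\<close> form local frames of the quotient sheaf.\<close>

section \<open>Smooth functions between Euclidean spaces\<close>

text \<open>The rank of \<pi> may drop from point to point, so the two kernels need not be
  subbundles and the quotient cannot be formed as a quotient of bundles. What never jumps is the
  dimension of the leaves: \<open>r\<close> Hamiltonian vectors spanning an
  \<open>r\<close>-dimensional space are independent, and this makes the coefficients unique.
  Smoothness of the coefficients, for which no splitting of a bundle is available, comes from
  pairing the relation \<xi> = \<Sum> x_i dg_i modulo the smaller kernel with the vectors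
  d\<phi>(\<Pi>^sharp \<beta>). Since dg_i then becomes \<beta>(X_(f_i)), letting \<beta> run
  through coordinate differentials along a local section of \<phi> yields a linear system with
  smooth entries and independent columns. The same way of solving such a system gives the
  coefficients of the differential equation along the leaves and the higher smoothness in the
  inverse function theorem. The frame lives over an open part of each fibre, whereas the smaller
  kernel refers to entire fibres; the transport of vanishing along leaves closes this gap.\<close>

lemma has_derivative_frechet:
  "f differentiable (at x) \<Longrightarrow> (f has_derivative frechet_derivative f (at x)) (at x)"
  using frechet_derivative_works by blast

lemma frechet_derivative_eqI: "(f has_derivative f') (at x) \<Longrightarrow> frechet_derivative f (at x) = f'"
  using frechet_derivative_at by metis

text \<open>The factorization is only demanded near \<open>x\<close> because chart representations
  of one object compose only over overlaps of chart domains.\<close>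

lemma frechet_derivative_chain_local:
  assumes "f differentiable (at x)" "g differentiable (at (f x))" "open W" "x \<in> W"
    and "\<And>y. y \<in> W \<Longrightarrow> h y = g (f y)"
  shows "frechet_derivative h (at x) v = frechet_derivative g (at (f x)) (frechet_derivative f (at x) v)"
proof -
  have "((\<lambda>y. g (f y)) has_derivative (\<lambda>v. frechet_derivative g (at (f x)) (frechet_derivative f (at x) v))) (at x)"
    by (rule has_derivative_compose[OF has_derivative_frechet[OF assms(1)] has_derivative_frechet[OF assms(2)]])
  then have "(h has_derivative (\<lambda>v. frechet_derivative g (at (f x)) (frechet_derivative f (at x) v))) (at x)"
    by (rule has_derivative_transform_within_open[OF _ assms(3,4)]) (simp add: assms(5))
  then show ?thesis using frechet_derivative_eqI by metis
qed

section \<open>Calculus of C^k maps\<close>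

lemma Ck_on_subset: "Ck_on k f S \<Longrightarrow> T \<subseteq> S \<Longrightarrow> Ck_on k f T"
  by (induction k arbitrary: f) (auto intro: continuous_on_subset)

lemma Ck_on_cong:
  assumes "Ck_on k f S" "open S" "\<And>x. x \<in> S \<Longrightarrow> f x = g x"
  shows "Ck_on k g S"
  using assms(1,3)
proof (induction k arbitrary: f g)
  case 0
  then show ?case using continuous_on_eq by auto
next
  case (Suc k)
  have d: "(g has_derivative frechet_derivative f (at x)) (at x)" if "x \<in> S" for x
    using Suc.prems that assms(2)
    by (auto intro!: has_derivative_transform_within_open[OF has_derivative_frechet])
  show ?case
  proof (simp, intro conjI ballI allI)
    show "g differentiable (at x)" if "x \<in> S" for x using d[OF that] unfolding differentiable_def by blast
    show "Ck_on k (\<lambda>x. frechet_derivative g (at x) v) S" for v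
    proof (rule Suc.IH[of "\<lambda>x. frechet_derivative f (at x) v"])
      show "Ck_on k (\<lambda>x. frechet_derivative f (at x) v) S" using Suc.prems(1) by simp
    qed (simp add: frechet_derivative_eqI[OF d])
  qed
qed

lemma Ck_on_Suc_imp: "Ck_on (Suc k) f S \<Longrightarrow> Ck_on k f S"
proof (induction k arbitrary: f)
  case 0
  then show ?case
    by (auto intro!: continuous_at_imp_continuous_on differentiable_imp_continuous_within)
next
  case (Suc k)
  then show ?case by auto
qed

lemma Ck_on_local:
  assumes "\<And>x. x \<in> S \<Longrightarrow> \<exists>W. open W \<and> x \<in> W \<and> Ck_on k f W"
  shows "Ck_on k f S"
  using assms
proof (induction k arbitrary: f)
  case 0
  then show ?case
    by (simp add: continuous_on_eq_continuous_within)
      (metis at_within_open continuous_at_imp_continuous_at_within)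
next
  case (Suc k)
  show ?case
  proof (simp, intro conjI ballI allI)
    show "f differentiable (at x)" if "x \<in> S" for x using Suc.prems[OF that] by auto
    show "Ck_on k (\<lambda>x. frechet_derivative f (at x) v) S" for v
      by (rule Suc.IH) (use Suc.prems in fastforce)
  qed
qed

text \<open>Lets the derivative be supplied by a formula, so that the inductive steps below can use
  the product, quotient and chain rules directly.\<close>

lemma Ck_on_SucI:
  assumes "\<And>x. x \<in> S \<Longrightarrow> (f has_derivative f' x) (at x)" "open S"
    "\<And>v. Ck_on k (\<lambda>x. f' x v) S"
  shows "Ck_on (Suc k) f S"
  using assms frechet_derivative_eqI[OF assms(1)]
  by (auto simp: differentiable_def intro!: Ck_on_cong[OF assms(3,2)])

lemma Ck_on_SucD:
  assumes "Ck_on (Suc k) f S" "x \<in> S"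
  shows "(f has_derivative frechet_derivative f (at x)) (at x)"
  using assms has_derivative_frechet by auto

lemma Ck_on_const: "Ck_on k (\<lambda>_. c) S"
  by (induction k arbitrary: c) auto

lemma Ck_on_linear:
  assumes "bounded_linear L" "open S"
  shows "Ck_on k L S"
proof (cases k)
  case 0
  then show ?thesis using assms by (simp add: linear_continuous_on)
next
  case (Suc j)
  then show ?thesis using assms
    by (auto intro!: Ck_on_SucI[of _ _ "\<lambda>_. L"] Ck_on_const simp: bounded_linear_imp_has_derivative
        simp del: Ck_on.simps)
qed

lemma Ck_on_add:
  assumes "Ck_on k f S" "Ck_on k g S" "open S"
  shows "Ck_on k (\<lambda>x. f x + g x) S"
  using assms(1,2)
proof (induction k arbitrary: f g)
  case 0
  then show ?case by (simp add: continuous_on_add)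
next
  case (Suc k)
  show ?case
  proof (rule Ck_on_SucI[OF _ assms(3)])
    show "((\<lambda>x. f x + g x) has_derivative
        (\<lambda>v. frechet_derivative f (at x) v + frechet_derivative g (at x) v)) (at x)" if "x \<in> S" for x
      using Suc.prems[THEN Ck_on_SucD, OF that] by (intro has_derivative_add)
  qed (use Suc in auto)
qed

lemma Ck_on_sum:
  assumes "\<And>i. i \<in> I \<Longrightarrow> Ck_on k (f i) S" "open S"
  shows "Ck_on k (\<lambda>x. \<Sum>i\<in>I. f i x) S"
  using assms(1)
  by (induction I rule: infinite_finite_induct) (auto simp: Ck_on_const Ck_on_add[OF _ _ assms(2)])

text \<open>The product rule gives a sum of two terms of the same shape, so the induction has to
  vary \<open>f\<close> and \<open>g\<close>. Products, scalar multiples and inner products are all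
  instances.\<close>

lemma Ck_on_bilinear:
  assumes B: "bounded_bilinear B" and "Ck_on k f S" "Ck_on k g S" "open S"
  shows "Ck_on k (\<lambda>x. B (f x) (g x)) S"
  using assms(2,3)
proof (induction k arbitrary: f g)
  case 0
  then show ?case using bounded_bilinear.continuous_on[OF B] by simp
next
  case (Suc k)
  show ?case
  proof (rule Ck_on_SucI[OF _ assms(4)])
    show "((\<lambda>x. B (f x) (g x)) has_derivative
        (\<lambda>v. B (f x) (frechet_derivative g (at x) v) + B (frechet_derivative f (at x) v) (g x))) (at x)"
      if "x \<in> S" for x
      using Suc.prems[THEN Ck_on_SucD, OF that] by (intro bounded_bilinear.FDERIV[OF B])
    show "Ck_on k (\<lambda>x. B (f x) (frechet_derivative g (at x) v) + B (frechet_derivative f (at x) v) (g x)) S" for v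
      using Suc.prems Suc.prems[THEN Ck_on_Suc_imp]
      by (intro Ck_on_add[OF _ _ assms(4)] Suc.IH) auto
  qed
qed

lemmas Ck_on_mult = Ck_on_bilinear[OF bounded_bilinear_mult]
lemmas Ck_on_scaleR = Ck_on_bilinear[OF bounded_bilinear_scaleR]
lemmas Ck_on_inner = Ck_on_bilinear[OF bounded_bilinear_inner]

lemma Ck_on_diff:
  assumes "Ck_on k f S" "Ck_on k g S" "open S"
  shows "Ck_on k (\<lambda>x. f x - g x) S"
  using Ck_on_add[OF assms(1) Ck_on_scaleR[OF Ck_on_const[of k "-1"] assms(2,3)] assms(3)] by simp

lemma Ck_on_inverse:
  fixes f :: "'a::real_normed_vector \<Rightarrow> real"
  assumes "Ck_on k f S" "open S" "\<And>x. x \<in> S \<Longrightarrow> f x \<noteq> 0"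
  shows "Ck_on k (\<lambda>x. inverse (f x)) S"
  using assms(1)
proof (induction k)
  case 0
  then show ?case using assms(3) by (simp add: continuous_on_inverse)
next
  case (Suc k)
  have inv: "Ck_on k (\<lambda>x. inverse (f x)) S" using Suc Ck_on_Suc_imp by blast
  show ?case
  proof (rule Ck_on_SucI[OF _ assms(2)])
    show "((\<lambda>x. inverse (f x)) has_derivative
        (\<lambda>v. - (inverse (f x) * frechet_derivative f (at x) v * inverse (f x)))) (at x)"
      if "x \<in> S" for x
      using Suc.prems[THEN Ck_on_SucD, OF that] that assms(3) by (intro Deriv.has_derivative_inverse) auto
    show "Ck_on k (\<lambda>x. - (inverse (f x) * frechet_derivative f (at x) v * inverse (f x))) S" for v
      using Suc.prems Ck_on_diff[OF Ck_on_const[of k 0] Ck_on_mult[OF Ck_on_mult[OF inv _ assms(2)] inv assms(2)] assms(2)]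
      by auto
  qed
qed

lemma Ck_on_componentwise:
  fixes f :: "'a::real_normed_vector \<Rightarrow> 'b::euclidean_space"
  assumes "\<And>b. b \<in> Basis \<Longrightarrow> Ck_on k (\<lambda>x. f x \<bullet> b) S" "open S"
  shows "Ck_on k f S"
proof -
  have "Ck_on k (\<lambda>x. \<Sum>b\<in>Basis. (f x \<bullet> b) *\<^sub>R b) S"
    by (intro Ck_on_sum Ck_on_scaleR Ck_on_const assms)
  then show ?thesis by (simp add: euclidean_representation)
qed

lemma linear_eq_sum_Basis:
  fixes f :: "'a::euclidean_space \<Rightarrow> 'b::real_vector"
  assumes "linear f" shows "f x = (\<Sum>b\<in>Basis. (x \<bullet> b) *\<^sub>R f b)"
proof -
  have "f x = f (\<Sum>b\<in>Basis. (x \<bullet> b) *\<^sub>R b)" by (simp add: euclidean_representation)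
  also have "\<dots> = (\<Sum>b\<in>Basis. (x \<bullet> b) *\<^sub>R f b)"
    by (simp add: linear_sum[OF assms] linear_scale[OF assms])
  finally show ?thesis .
qed

text \<open>In the chain rule the direction fed to the derivative of \<open>g\<close> depends on the
  point, whereas \<open>Ck_on\<close> controls derivatives in fixed directions. Expanding that
  direction in \<open>Basis\<close> leaves sums of products of functions covered by the
  induction.\<close>

lemma Ck_on_compose:
  fixes f :: "'a::real_normed_vector \<Rightarrow> 'b::euclidean_space"
  assumes "Ck_on k f S" "Ck_on k g T" "open S" "f ` S \<subseteq> T"
  shows "Ck_on k (\<lambda>x. g (f x)) S"
  using assms(1,2)
proof (induction k arbitrary: g)
  case 0
  then show ?case using assms continuous_on_compose2 by auto
next
  case (Suc k)
  let ?f' = "\<lambda>x. frechet_derivative f (at x)" and ?g' = "\<lambda>x. frechet_derivative g (at x)"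
  show ?case
  proof (rule Ck_on_SucI[OF _ assms(3)])
    fix x assume x: "x \<in> S"
    then have fx: "f x \<in> T" using assms by blast
    have lin: "linear (?g' (f x))"
      using Suc.prems(2)[THEN Ck_on_SucD, OF fx] has_derivative_linear by blast
    have "((\<lambda>x. g (f x)) has_derivative (\<lambda>v. ?g' (f x) (?f' x v))) (at x)"
      using Suc.prems(1)[THEN Ck_on_SucD, OF x] Suc.prems(2)[THEN Ck_on_SucD, OF fx]
      by (rule has_derivative_compose)
    moreover have "(\<lambda>v. ?g' (f x) (?f' x v)) = (\<lambda>v. \<Sum>b\<in>Basis. (?f' x v \<bullet> b) *\<^sub>R ?g' (f x) b)"
      using linear_eq_sum_Basis[OF lin] by metis
    ultimately show "((\<lambda>x. g (f x)) has_derivative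
      (\<lambda>v. \<Sum>b\<in>Basis. (?f' x v \<bullet> b) *\<^sub>R ?g' (f x) b)) (at x)" by metis
  next
    show "Ck_on k (\<lambda>x. \<Sum>b\<in>Basis. (?f' x v \<bullet> b) *\<^sub>R ?g' (f x) b) S" for v
    proof (intro Ck_on_sum[OF Ck_on_scaleR[OF Ck_on_inner[OF _ Ck_on_const assms(3)] _ assms(3)] assms(3)])
      show "Ck_on k (\<lambda>x. ?f' x v) S" using Suc.prems(1) by simp
      show "Ck_on k (\<lambda>x. ?g' (f x) b) S" for b
        by (rule Suc.IH) (use Suc.prems(1)[THEN Ck_on_Suc_imp] Suc.prems(2) in auto)
    qed
  qed
qed

text \<open>One step of Gram--Schmidt eliminates a frame vector and keeps the remaining coefficients.\<close>

lemma Ck_on_frame_coefficients: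
  fixes v :: "nat \<Rightarrow> 'a::real_normed_vector \<Rightarrow> 'b::real_inner"
  assumes "open S" "\<And>j. j < r \<Longrightarrow> Ck_on k (v j) S" "Ck_on k y S"
    and "\<And>x c. x \<in> S \<Longrightarrow> (\<Sum>j<r. c j *\<^sub>R v j x) = 0 \<Longrightarrow> \<forall>j<r. c j = (0::real)"
    and "\<And>x. x \<in> S \<Longrightarrow> y x = (\<Sum>j<r. a j x *\<^sub>R v j x)"
    and "j < r"
  shows "Ck_on k (a j) S"
  using assms(2-6)
proof (induction r arbitrary: v y j)
  case 0
  then show ?case by simp
next
  case (Suc r)
  let ?w = "v r"
  have w0: "?w x \<noteq> 0" if "x \<in> S" for x
  proof
    assume "?w x = 0"
    then have "(\<Sum>j<Suc r. (if j = r then 1 else 0) *\<^sub>R v j x) = 0" by simp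
    from Suc.prems(3)[OF that this] show False by auto
  qed
  define q where "q x = inverse (?w x \<bullet> ?w x)" for x
  have qw: "q x * (?w x \<bullet> ?w x) = 1" if "x \<in> S" for x
    using w0[OF that] by (simp add: q_def)
  have Cw: "Ck_on k ?w S" using Suc.prems by simp
  have Cq: "Ck_on k q S"
    unfolding q_def by (intro Ck_on_inverse Ck_on_inner Cw assms(1)) (use w0 in auto)
  define proj where "proj u x = u x - ((u x \<bullet> ?w x) * q x) *\<^sub>R ?w x" for u x
  have Cproj: "Ck_on k (proj u) S" if "Ck_on k u S" for u
    unfolding proj_def by (intro Ck_on_diff Ck_on_scaleR Ck_on_mult Ck_on_inner Cw Cq that assms(1))
  have proj_sum: "proj y x = (\<Sum>j<r. a j x *\<^sub>R proj (v j) x)" if x: "x \<in> S" for x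
  proof -
    have "y x = (\<Sum>j<r. a j x *\<^sub>R v j x) + a r x *\<^sub>R ?w x"
      using Suc.prems(4)[OF x] by simp
    \<comment> \<open>The last summand is zero, since \<open>q x\<close> is the reciprocal of the
      squared length of \<open>?w x\<close>: the unknown \<open>a r x\<close> drops out.\<close>
    then have "proj y x = (\<Sum>j<r. a j x *\<^sub>R v j x)
       - ((\<Sum>j<r. a j x * (v j x \<bullet> ?w x)) * q x) *\<^sub>R ?w x
       + (a r x - a r x * (q x * (?w x \<bullet> ?w x))) *\<^sub>R ?w x"
      by (simp add: proj_def inner_sum_left inner_add_left algebra_simps)
    also have "\<dots> = (\<Sum>j<r. a j x *\<^sub>R proj (v j) x)"
      using qw[OF x] by (simp add: proj_def scaleR_right_diff_distrib sum_subtractf sum_distrib_right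
          scaleR_sum_left mult.assoc)
    finally show ?thesis .
  qed
  have IH: "Ck_on k (a i) S" if "i < r" for i
  proof (rule Suc.IH[of "\<lambda>j. proj (v j)" "proj y"])
    show "Ck_on k (proj (v j)) S" if "j < r" for j using Cproj Suc.prems(1) that by simp
    show "Ck_on k (proj y) S" using Cproj Suc.prems(2) by simp
    show "\<forall>j<r. c j = 0" if "x \<in> S" "(\<Sum>j<r. c j *\<^sub>R proj (v j) x) = 0" for x c
    proof -
      \<comment> \<open>The multiple of \<open>?w x\<close> that the projections subtract: with it a
        relation between projected vectors becomes one between the original vectors.\<close>
      define d where "d = - (\<Sum>j<r. c j * ((v j x \<bullet> ?w x) * q x))"
      have "0 = (\<Sum>j<r. c j *\<^sub>R v j x) + d *\<^sub>R ?w x"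
        using that(2) by (simp add: proj_def d_def scaleR_right_diff_distrib sum_subtractf scaleR_sum_left)
      then have "(\<Sum>j<Suc r. (if j = r then d else c j) *\<^sub>R v j x) = 0" by simp
      from Suc.prems(3)[OF that(1) this] show ?thesis
        by (metis less_Suc_eq less_irrefl)
    qed
  qed (use proj_sum that in auto)
  show ?case
  proof (cases "j < r")
    case False
    then have j: "j = r" using Suc.prems by simp
    \<comment> \<open>The eliminated coefficient is recovered by pairing with \<open>?w x\<close>,
      once the others are known to be C^k.\<close>
    have "a r x = (y x \<bullet> ?w x - (\<Sum>j<r. a j x * (v j x \<bullet> ?w x))) * q x" if x: "x \<in> S" for x
      using qw[OF x] Suc.prems(4)[OF x] by (simp add: inner_sum_left inner_add_left mult.assoc mult.commute)
    moreover have "Ck_on k (\<lambda>x. (y x \<bullet> ?w x - (\<Sum>j<r. a j x * (v j x \<bullet> ?w x))) * q x) S"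
      using Suc.prems by (intro Ck_on_mult Ck_on_diff Ck_on_inner Ck_on_sum Cw Cq IH assms(1)) auto
    ultimately show ?thesis unfolding j using Ck_on_cong[OF _ assms(1)] by fastforce
  qed (use IH in auto)
qed

section \<open>Calculus of smooth maps\<close>

lemma smooth_on_subset: "smooth_on f S \<Longrightarrow> T \<subseteq> S \<Longrightarrow> smooth_on f T"
  unfolding smooth_on_def by (blast intro: Ck_on_subset)

lemma smooth_on_cong:
  "smooth_on f S \<Longrightarrow> open S \<Longrightarrow> (\<And>x. x \<in> S \<Longrightarrow> f x = g x) \<Longrightarrow> smooth_on g S"
  unfolding smooth_on_def by (blast intro: Ck_on_cong)

lemma smooth_on_local:
  "(\<And>x. x \<in> S \<Longrightarrow> \<exists>W. open W \<and> x \<in> W \<and> smooth_on f W) \<Longrightarrow> smooth_on f S"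
  unfolding smooth_on_def by (meson Ck_on_local)

lemma smooth_on_const: "smooth_on (\<lambda>_. c) S"
  by (simp add: smooth_on_def Ck_on_const)

lemma smooth_on_linear: "bounded_linear L \<Longrightarrow> open S \<Longrightarrow> smooth_on L S"
  by (simp add: smooth_on_def Ck_on_linear)

lemma smooth_on_add:
  "smooth_on f S \<Longrightarrow> smooth_on g S \<Longrightarrow> open S \<Longrightarrow> smooth_on (\<lambda>x. f x + g x) S"
  by (simp add: smooth_on_def Ck_on_add)

lemma smooth_on_sum:
  "(\<And>i. i \<in> I \<Longrightarrow> smooth_on (f i) S) \<Longrightarrow> open S \<Longrightarrow> smooth_on (\<lambda>x. \<Sum>i\<in>I. f i x) S"
  by (simp add: smooth_on_def Ck_on_sum)

lemma smooth_on_bilinear: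
  "bounded_bilinear h \<Longrightarrow> smooth_on f S \<Longrightarrow> smooth_on g S \<Longrightarrow> open S \<Longrightarrow> smooth_on (\<lambda>x. h (f x) (g x)) S"
  by (simp add: smooth_on_def Ck_on_bilinear)

lemmas smooth_on_mult = smooth_on_bilinear[OF bounded_bilinear_mult]
lemmas smooth_on_scaleR = smooth_on_bilinear[OF bounded_bilinear_scaleR]

lemma smooth_on_componentwise:
  fixes f :: "'a::real_normed_vector \<Rightarrow> 'b::euclidean_space"
  shows "(\<And>b. b \<in> Basis \<Longrightarrow> smooth_on (\<lambda>x. f x \<bullet> b) S) \<Longrightarrow> open S \<Longrightarrow> smooth_on f S"
  by (simp add: smooth_on_def Ck_on_componentwise)

lemma smooth_on_compose:
  fixes f :: "'a::real_normed_vector \<Rightarrow> 'b::euclidean_space"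
  shows "smooth_on f S \<Longrightarrow> smooth_on g T \<Longrightarrow> open S \<Longrightarrow> f ` S \<subseteq> T \<Longrightarrow> smooth_on (\<lambda>x. g (f x)) S"
  unfolding smooth_on_def by (blast intro: Ck_on_compose)

lemma smooth_on_has_derivative:
  "smooth_on f S \<Longrightarrow> x \<in> S \<Longrightarrow> (f has_derivative frechet_derivative f (at x)) (at x)"
  unfolding smooth_on_def by (blast intro: Ck_on_SucD)

lemma smooth_on_differentiable: "smooth_on f S \<Longrightarrow> x \<in> S \<Longrightarrow> f differentiable (at x)"
  using smooth_on_has_derivative differentiable_def by blast

lemma smooth_on_derivative:
  "smooth_on f S \<Longrightarrow> smooth_on (\<lambda>x. frechet_derivative f (at x) v) S"
  unfolding smooth_on_def by (metis Ck_on.simps(2))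

lemma smooth_on_imp_continuous_on: "smooth_on f S \<Longrightarrow> continuous_on S f"
  unfolding smooth_on_def by (metis Ck_on.simps(1))

lemma smooth_on_frame_coefficients:
  fixes v :: "nat \<Rightarrow> 'a::real_normed_vector \<Rightarrow> 'b::real_inner"
  assumes "open S" "\<And>j. j < r \<Longrightarrow> smooth_on (v j) S" "smooth_on y S"
    and "\<And>x c. x \<in> S \<Longrightarrow> (\<Sum>j<r. c j *\<^sub>R v j x) = 0 \<Longrightarrow> \<forall>j<r. c j = (0::real)"
    and "\<And>x. x \<in> S \<Longrightarrow> y x = (\<Sum>j<r. a j x *\<^sub>R v j x)"
    and "j < r"
  shows "smooth_on (a j) S"
  using assms Ck_on_frame_coefficients[of S r _ v y a j] unfolding smooth_on_def by blast

text \<open>The C^1 theorem provides an inverse \<open>g\<close> with derivative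
  \<open>inv (D (g y))\<close>. If \<open>g\<close> is C^k, then the vectors
  \<open>D (g y) (e j)\<close> form a C^k frame, and the components of
  \<open>inv (D (g y)) w\<close> are the coefficients of the constant vector \<open>w\<close> in
  that frame. They are C^k by elimination, hence \<open>g\<close> is C^(k+1).\<close>

lemma smooth_inverse_function:
  fixes f :: "'a::euclidean_space \<Rightarrow> 'a"
  assumes "open U" "smooth_on f U" "x0 \<in> U" "bij (frechet_derivative f (at x0))"
  obtains U' V g where "open U'" "U' \<subseteq> U" "x0 \<in> U'" "open V" "f x0 \<in> V" "homeomorphism U' V f g"
    "smooth_on g V"
proof -
  define D where "D x = frechet_derivative f (at x)" for x
  have der: "(f has_derivative D x) (at x)" if "x \<in> U" for x
    unfolding D_def using smooth_on_has_derivative assms that by blast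
  then have bl: "bounded_linear (D x)" if "x \<in> U" for x using that has_derivative_bounded_linear by blast
  define f' where "f' x = Blinfun (D x)" for x
  have f': "blinfun_apply (f' x) = D x" if "x \<in> U" for x
    using bl[OF that] by (simp add: f'_def bounded_linear_Blinfun_apply)
  have cont: "continuous_on U f'"
  proof (rule continuous_on_blinfun_componentwise)
    fix i :: 'a
    have "continuous_on U (\<lambda>x. D x i)" unfolding D_def
      using smooth_on_imp_continuous_on[OF smooth_on_derivative[OF assms(2)]] .
    then show "continuous_on U (\<lambda>x. blinfun_apply (f' x) i)" using f' by (simp cong: continuous_on_cong)
  qed
  have bijD: "bij (D x0)" using assms(4) by (simp add: D_def)
  have blinv: "bounded_linear (inv (D x0))"
    using bl[OF assms(3)] bijD inj_linear_imp_inv_linear[of "D x0"] by (simp add: bounded_linear.linear bij_is_inj linear_conv_bounded_linear)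
  have inv: "Blinfun (inv (D x0)) o\<^sub>L f' x0 = id_blinfun"
    using bijD by (intro blinfun_eqI) (simp add: f' assms(3) bounded_linear_Blinfun_apply[OF blinv] bij_is_inj)
  obtain U' V g g' where g: "open U'" "U' \<subseteq> U" "x0 \<in> U'" "open V" "f x0 \<in> V" "homeomorphism U' V f g"
    "\<And>y. y \<in> V \<Longrightarrow> (g has_derivative (g' y)) (at y)"
    "\<And>y. y \<in> V \<Longrightarrow> g' y = inv (blinfun_apply (f'(g y)))"
    "\<And>y. y \<in> V \<Longrightarrow> bij (blinfun_apply (f'(g y)))"
    using inverse_function_theorem[OF assms(1) _ cont assms(3) inv] der f' by metis
  have gV: "g ` V \<subseteq> U" using g(2,6) by (auto simp: homeomorphism_def)
  then have gU: "g y \<in> U" if "y \<in> V" for y using that by blast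
  have contg: "continuous_on V g" using g(6) by (simp add: homeomorphism_def)
  have bijDg: "bij (D (g y))" if "y \<in> V" for y using g(9)[OF that] f'[OF gU[OF that]] by simp
  have derg: "(g has_derivative inv (D (g y))) (at y)" if "y \<in> V" for y
    using g(7,8)[OF that] f'[OF gU[OF that]] by simp
  obtain e :: "nat \<Rightarrow> 'a" where e: "bij_betw e {..<DIM('a)} Basis"
    using ex_bij_betw_nat_finite[of "Basis :: 'a set"] by (auto simp: lessThan_atLeast0)
  have Ck: "Ck_on k g V" for k
  proof (induction k)
    case 0
    then show ?case using contg by simp
  next
    case (Suc k)
    show ?case
    proof (rule Ck_on_SucI[OF derg g(4)])
      fix w
      show "Ck_on k (\<lambda>y. inv (D (g y)) w) V"
      proof (rule Ck_on_componentwise[OF _ g(4)])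
        fix b :: 'a assume "b \<in> Basis"
        then obtain j where j: "j < DIM('a)" "b = e j" using e by (auto simp: bij_betw_def)
        have lin: "linear (D (g y))" if "y \<in> V" for y using bl[OF gU[OF that]] bounded_linear.linear by blast
        have orth: "e j \<bullet> e i = (if j = i then 1 else 0)" if "i < DIM('a)" "j < DIM('a)" for i j
          using that bij_betwE[OF e] bij_betw_imp_inj_on[OF e] by (auto simp: inner_Basis inj_on_def)
        have sum_e: "(\<Sum>j<DIM('a). c (e j) *\<^sub>R F (e j)) = (\<Sum>b\<in>Basis. c b *\<^sub>R F b)"
          for c and F :: "'a \<Rightarrow> 'a" by (rule sum.reindex_bij_betw[OF e])
        \<comment> \<open>Written as an application to \<open>j\<close> in order to match the
          pattern \<open>a j\<close> of the elimination lemma.\<close>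
        have "Ck_on k ((\<lambda>j y. inv (D (g y)) w \<bullet> e j) j) V"
        proof (rule Ck_on_frame_coefficients[where v="\<lambda>j y. D (g y) (e j)" and y="\<lambda>_. w" and r="DIM('a)", OF g(4)])
          show "Ck_on k (\<lambda>y. D (g y) (e j)) V" for j
            by (rule Ck_on_compose[OF Suc _ g(4) gV])
              (use smooth_on_derivative[OF assms(2)] in \<open>simp add: D_def smooth_on_def\<close>)
          show "Ck_on k (\<lambda>_. w) V" by (rule Ck_on_const)
          show "\<forall>j<DIM('a). c j = 0" if y: "y \<in> V" and "(\<Sum>j<DIM('a). c j *\<^sub>R D (g y) (e j)) = 0" for y c
          proof -
            have "D (g y) (\<Sum>j<DIM('a). c j *\<^sub>R e j) = D (g y) 0"
              using that lin[OF y] by (simp add: linear_sum linear_scale linear_0)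
            then have *: "(\<Sum>j<DIM('a). c j *\<^sub>R e j) = 0" using bijDg[OF y] bij_is_inj injD by metis
            show ?thesis
            proof (intro allI impI)
              fix i assume i: "i < DIM('a)"
              have "0 = (\<Sum>j<DIM('a). c j *\<^sub>R e j) \<bullet> e i" using * by simp
              also have "\<dots> = (\<Sum>j<DIM('a). if j = i then c j else 0)"
                unfolding inner_sum_left using orth i by (intro sum.cong) auto
              finally show "c i = 0" using i by simp
            qed
          qed
          show "w = (\<Sum>j<DIM('a). (inv (D (g y)) w \<bullet> e j) *\<^sub>R D (g y) (e j))" if y: "y \<in> V" for y
            unfolding sum_e[of "\<lambda>b. inv (D (g y)) w \<bullet> b"] linear_eq_sum_Basis[OF lin[OF y], symmetric]
            using bijDg[OF y] by (simp add: bij_is_surj surj_f_inv_f)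
        qed (use j in auto)
        then show "Ck_on k (\<lambda>y. inv (D (g y)) w \<bullet> b) V" using j by simp
      qed
    qed
  qed
  then show ?thesis using that g(1-6) by (simp add: smooth_on_def)
qed

text \<open>Precomposing with the affine map \<open>c\<close>, built from a linear right inverse
  \<open>J\<close> of the derivative, gives a map with derivative \<open>id\<close> at 0. Its local
  inverse followed by \<open>c\<close> is the section.\<close>

lemma smooth_local_section:
  fixes f :: "'a::euclidean_space \<Rightarrow> 'b::euclidean_space"
  assumes "open U" "smooth_on f U" "x0 \<in> U" "surj (frechet_derivative f (at x0))"
  obtains V s where "open V" "f x0 \<in> V" "smooth_on s V" "s ` V \<subseteq> U" "s (f x0) = x0"
    "\<And>y. y \<in> V \<Longrightarrow> f (s y) = y"
proof -
  let ?D = "frechet_derivative f (at x0)"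
  have derf: "(f has_derivative ?D) (at x0)" using smooth_on_has_derivative assms by blast
  then have "linear ?D" using has_derivative_linear by blast
  then obtain J where J: "linear J" "?D \<circ> J = id"
    using assms(4) linear_surjective_right_inverse by blast
  then have blJ: "bounded_linear J" by (simp add: linear_conv_bounded_linear)
  define c where "c z = x0 + J z" for z
  define O' where "O' = c -` U"
  have contc: "continuous_on UNIV c" unfolding c_def
    by (intro continuous_on_add continuous_on_const linear_continuous_on blJ)
  then have openO: "open O'" unfolding O'_def using assms(1) by (simp add: open_vimage)
  have zero: "c 0 = x0" using J by (simp add: c_def linear_0)
  then have zO: "0 \<in> O'" using assms(3) by (simp add: O'_def)
  have smc: "smooth_on c S" if "open S" for S unfolding c_def
    by (intro smooth_on_add smooth_on_const smooth_on_linear blJ that)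
  have sm: "smooth_on (\<lambda>z. f (c z)) O'"
    by (rule smooth_on_compose[OF smc[OF openO] assms(2) openO]) (auto simp: O'_def)
  have "(c has_derivative J) (at 0)" unfolding c_def
    by (auto intro!: derivative_eq_intros bounded_linear_imp_has_derivative blJ)
  then have "((\<lambda>z. f (c z)) has_derivative (\<lambda>z. ?D (J z))) (at 0)"
    using derf zero by (intro has_derivative_compose[of c J 0 UNIV f ?D]) auto
  moreover have "(\<lambda>z. ?D (J z)) = id" using J(2) by (simp add: comp_def)
  ultimately have "frechet_derivative (\<lambda>z. f (c z)) (at 0) = id"
    using frechet_derivative_eqI by metis
  then have "bij (frechet_derivative (\<lambda>z. f (c z)) (at 0))" by simp
  then obtain U' V g where g: "open U'" "U' \<subseteq> O'" "0 \<in> U'" "open V" "f (c 0) \<in> V"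
    "homeomorphism U' V (\<lambda>z. f (c z)) g" "smooth_on g V"
    using smooth_inverse_function[OF openO sm zO] by metis
  show ?thesis
  proof (rule that[of V "\<lambda>y. c (g y)"])
    show "smooth_on (\<lambda>y. c (g y)) V"
      by (rule smooth_on_compose[OF g(7) smc[OF open_UNIV] g(4)]) simp
    show "(\<lambda>y. c (g y)) ` V \<subseteq> U" using g(2,6) by (auto simp: homeomorphism_def O'_def)
    show "c (g (f x0)) = x0" using g(3,6) zero by (auto simp: homeomorphism_def)
    show "f (c (g y)) = y" if "y \<in> V" for y using g(6) that by (auto simp: homeomorphism_def)
  qed (use g zero in auto)
qed

section \<open>Charts, tangent vectors and differentials\<close>

locale smooth_mfd =
  fixes M :: "('p, 'v::euclidean_space) manifold"
  assumes smooth_manifold: "smooth_manifold M"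
begin

lemma topological_chart_Atlas: "c \<in> Atlas M \<Longrightarrow> topological_chart (Top M) c"
  using smooth_manifold by (simp add: smooth_manifold_def)

lemma chart_domain_open: "c \<in> Atlas M \<Longrightarrow> openin (Top M) (fst c)"
  using topological_chart_Atlas by (simp add: topological_chart_def)

lemma chart_domain_subset: "c \<in> Atlas M \<Longrightarrow> fst c \<subseteq> topspace (Top M)"
  using chart_domain_open openin_subset by blast

lemma chart_homeomorphic:
  "c \<in> Atlas M \<Longrightarrow> homeomorphic_map (subtopology (Top M) (fst c)) (top_of_set (snd c ` fst c)) (snd c)"
  using topological_chart_Atlas by (simp add: topological_chart_def)

lemma open_chart_image:
  assumes "c \<in> Atlas M" "openin (Top M) U"
  shows "open (snd c ` (fst c \<inter> U))"
proof -
  have "open_map (subtopology (Top M) (fst c)) (top_of_set (snd c ` fst c)) (snd c)"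
    using chart_homeomorphic[OF assms(1)] by (simp add: homeomorphic_eq_everything_map)
  then have "openin (top_of_set (snd c ` fst c)) (snd c ` (fst c \<inter> U))"
    using assms(2) by (simp add: open_map_def openin_subtopology_Int2)
  then show ?thesis
    using topological_chart_Atlas[OF assms(1)] openin_open_trans by (auto simp: topological_chart_def)
qed

lemma open_chart_range: "c \<in> Atlas M \<Longrightarrow> open (snd c ` fst c)"
  using topological_chart_Atlas by (simp add: topological_chart_def)

lemma chart_inj:
  assumes "c \<in> Atlas M" shows "inj_on (snd c) (fst c)"
proof -
  have "topspace (subtopology (Top M) (fst c)) = fst c"
    using chart_domain_subset[OF assms] by auto
  then show ?thesis
    using chart_homeomorphic[OF assms] by (simp add: homeomorphic_eq_everything_map)
qed

lemma chart_inv_left: "c \<in> Atlas M \<Longrightarrow> p \<in> fst c \<Longrightarrow> chart_inv c (snd c p) = p"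
  by (simp add: chart_inv_def chart_inj)

lemma chart_inv_right: "x \<in> snd c ` fst c \<Longrightarrow> snd c (chart_inv c x) = x"
  by (simp add: chart_inv_def f_inv_into_f)

lemma chart_inv_into: "x \<in> snd c ` fst c \<Longrightarrow> chart_inv c x \<in> fst c"
  by (simp add: chart_inv_def inv_into_into)

lemma open_chart_vimage:
  assumes "c \<in> Atlas M" "open S"
  shows "openin (Top M) {p \<in> fst c. snd c p \<in> S}"
proof -
  have tp: "topspace (subtopology (Top M) (fst c)) = fst c"
    using chart_domain_subset[OF assms(1)] by auto
  have "continuous_map (subtopology (Top M) (fst c)) (top_of_set (snd c ` fst c)) (snd c)"
    using chart_homeomorphic[OF assms(1)] homeomorphic_imp_continuous_map by blast
  then have "openin (subtopology (Top M) (fst c)) {p \<in> fst c. snd c p \<in> snd c ` fst c \<inter> S}"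
    using assms(2) tp unfolding continuous_map_def by (metis (mono_tags, lifting) Collect_cong openin_open_Int)
  moreover have "{p \<in> fst c. snd c p \<in> snd c ` fst c \<inter> S} = {p \<in> fst c. snd c p \<in> S}" by auto
  ultimately show ?thesis
    using openin_trans_full[OF _ chart_domain_open[OF assms(1)]] by metis
qed

lemma charts_at_iff: "c \<in> charts_at M p \<longleftrightarrow> c \<in> Atlas M \<and> p \<in> fst c"
  by (simp add: charts_at_def)

lemma charts_at_nonempty: "p \<in> topspace (Top M) \<Longrightarrow> \<exists>c. c \<in> charts_at M p"
  using smooth_manifold unfolding smooth_manifold_def charts_at_def by blast

lemma charts_at_topspace: "c \<in> charts_at M p \<Longrightarrow> p \<in> topspace (Top M)"
  using chart_domain_subset charts_at_iff by blast

lemma some_chart: "p \<in> topspace (Top M) \<Longrightarrow> (SOME c. c \<in> charts_at M p) \<in> charts_at M p"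
  using charts_at_nonempty someI_ex by metis

lemma smooth_transition:
  "c \<in> Atlas M \<Longrightarrow> d \<in> Atlas M \<Longrightarrow> smooth_on (transition c d) (snd c ` (fst c \<inter> fst d))"
  using smooth_manifold unfolding smooth_manifold_def compatible_charts_def by blast

lemma open_overlap: "c \<in> Atlas M \<Longrightarrow> d \<in> Atlas M \<Longrightarrow> open (snd c ` (fst c \<inter> fst d))"
  using open_chart_image chart_domain_open by blast

lemma transition_apply: "c \<in> charts_at M p \<Longrightarrow> transition c d (snd c p) = snd d p"
  by (simp add: transition_def charts_at_iff chart_inv_left)

lemma transition_differentiable:
  "c \<in> charts_at M p \<Longrightarrow> d \<in> charts_at M p \<Longrightarrow> transition c d differentiable (at (snd c p))"
  by (rule smooth_on_differentiable[OF smooth_transition]) (auto simp: charts_at_iff)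

lemma transition_derivative_linear:
  "c \<in> charts_at M p \<Longrightarrow> d \<in> charts_at M p \<Longrightarrow> linear (frechet_derivative (transition c d) (at (snd c p)))"
  using transition_differentiable linear_frechet_derivative by blast

lemma transition_derivative_self:
  assumes "c \<in> charts_at M p"
  shows "frechet_derivative (transition c c) (at (snd c p)) v = v"
proof -
  have c: "c \<in> Atlas M" "p \<in> fst c" using assms by (auto simp: charts_at_iff)
  have "(transition c c has_derivative (\<lambda>v. v)) (at (snd c p))"
    by (rule has_derivative_transform_within_open[OF has_derivative_ident open_chart_range[OF c(1)]])
      (use c in \<open>auto simp: transition_def chart_inv_left\<close>)
  then show ?thesis using frechet_derivative_eqI by metis
qed

lemma transition_derivative_chain:
  assumes "c \<in> charts_at M p" "d \<in> charts_at M p" "e \<in> charts_at M p"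
  shows "frechet_derivative (transition c e) (at (snd c p)) v =
    frechet_derivative (transition d e) (at (snd d p)) (frechet_derivative (transition c d) (at (snd c p)) v)"
proof -
  have c: "c \<in> Atlas M" "p \<in> fst c" "d \<in> Atlas M" "p \<in> fst d" using assms by (auto simp: charts_at_iff)
  have *: "transition c d (snd c p) = snd d p" using assms transition_apply by blast
  have "frechet_derivative (transition c e) (at (snd c p)) v =
    frechet_derivative (transition d e) (at (transition c d (snd c p))) (frechet_derivative (transition c d) (at (snd c p)) v)"
  proof (rule frechet_derivative_chain_local[where W="snd c ` (fst c \<inter> fst d)"])
    show "transition d e differentiable at (transition c d (snd c p))"
      unfolding * by (rule transition_differentiable[OF assms(2,3)])
    show "transition c e y = transition d e (transition c d y)" if "y \<in> snd c ` (fst c \<inter> fst d)" for y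
      using that c by (auto simp: transition_def chart_inv_left)
  qed (use c transition_differentiable[OF assms(1,2)] open_overlap in auto)
  then show ?thesis using * by simp
qed

section \<open>Tangent vectors and covectors\<close>

lemma tangent_transform:
  "X \<in> tangent_space M p \<Longrightarrow> c \<in> charts_at M p \<Longrightarrow> d \<in> charts_at M p \<Longrightarrow>
    X d = frechet_derivative (transition c d) (at (snd c p)) (X c)"
  unfolding tangent_space_def by blast

lemma tangent_outside: "X \<in> tangent_space M p \<Longrightarrow> c \<notin> charts_at M p \<Longrightarrow> X c = 0"
  unfolding tangent_space_def by blast

lemma coordinate_vector_tangent:
  assumes "c \<in> charts_at M p" shows "coordinate_vector M c v p \<in> tangent_space M p"
  unfolding tangent_space_def
proof (intro CollectI conjI ballI)
  fix d e assume "d \<in> charts_at M p" "e \<in> charts_at M p"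
  then show "coordinate_vector M c v p e =
      frechet_derivative (transition d e) (at (snd d p)) (coordinate_vector M c v p d)"
    unfolding coordinate_vector_def using transition_derivative_chain[OF assms, of d e v] by simp
qed (simp add: coordinate_vector_def)

lemma coordinate_vector_apply: "c \<in> charts_at M p \<Longrightarrow> coordinate_vector M c v p c = v"
  by (simp add: coordinate_vector_def transition_derivative_self)

lemma tangent_eqI:
  assumes "X \<in> tangent_space M p" "Y \<in> tangent_space M p" "c \<in> charts_at M p" "X c = Y c"
  shows "X = Y"
proof
  fix d
  show "X d = Y d"
  proof (cases "d \<in> charts_at M p")
    case True
    then show ?thesis using tangent_transform assms by metis
  qed (simp add: tangent_outside[OF assms(1)] tangent_outside[OF assms(2)])
qed

lemma tangent_eq_coordinate_vector:
  "X \<in> tangent_space M p \<Longrightarrow> c \<in> charts_at M p \<Longrightarrow> X = coordinate_vector M c (X c) p"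
  by (rule tangent_eqI) (auto intro: coordinate_vector_tangent simp: coordinate_vector_apply)

lemma tangent_zero: "(\<lambda>_. 0) \<in> tangent_space M p"
proof -
  have "frechet_derivative (transition c d) (at (snd c p)) 0 = 0"
    if "c \<in> charts_at M p" "d \<in> charts_at M p" for c d
    using transition_derivative_linear[OF that] linear_0 by blast
  then show ?thesis by (simp add: tangent_space_def)
qed

lemma tangent_add:
  assumes "X \<in> tangent_space M p" "Y \<in> tangent_space M p"
  shows "(\<lambda>c. X c + Y c) \<in> tangent_space M p"
  unfolding tangent_space_def
proof (intro CollectI conjI ballI)
  fix c d assume cd: "c \<in> charts_at M p" "d \<in> charts_at M p"
  show "X d + Y d = frechet_derivative (transition c d) (at (snd c p)) (X c + Y c)"
    unfolding linear_add[OF transition_derivative_linear[OF cd]]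
      tangent_transform[OF assms(1) cd] tangent_transform[OF assms(2) cd] ..
qed (simp add: tangent_outside[OF assms(1)] tangent_outside[OF assms(2)])

lemma tangent_scale:
  assumes "X \<in> tangent_space M p"
  shows "(\<lambda>c. a *\<^sub>R X c) \<in> tangent_space M p"
  unfolding tangent_space_def
proof (intro CollectI conjI ballI)
  fix c d assume cd: "c \<in> charts_at M p" "d \<in> charts_at M p"
  show "a *\<^sub>R X d = frechet_derivative (transition c d) (at (snd c p)) (a *\<^sub>R X c)"
    unfolding linear_scale[OF transition_derivative_linear[OF cd]] tangent_transform[OF assms(1) cd] ..
qed (simp add: tangent_outside[OF assms])

lemma tangent_sum:
  "(\<And>i. i \<in> I \<Longrightarrow> X i \<in> tangent_space M p) \<Longrightarrow> (\<lambda>c. \<Sum>i\<in>I. a i *\<^sub>R X i c) \<in> tangent_space M p"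
  by (induction I rule: infinite_finite_induct) (auto simp: tangent_zero intro!: tangent_add tangent_scale)

lemma cotangent_add:
  "\<alpha> \<in> cotangent_space M p \<Longrightarrow> X \<in> tangent_space M p \<Longrightarrow> Y \<in> tangent_space M p \<Longrightarrow>
    \<alpha> (\<lambda>c. X c + Y c) = \<alpha> X + \<alpha> Y"
  by (simp add: cotangent_space_def)

lemma cotangent_scale:
  "\<alpha> \<in> cotangent_space M p \<Longrightarrow> X \<in> tangent_space M p \<Longrightarrow> \<alpha> (\<lambda>c. a *\<^sub>R X c) = a * \<alpha> X"
  by (simp add: cotangent_space_def)

lemma cotangent_zero:
  assumes "\<alpha> \<in> cotangent_space M p" shows "\<alpha> (\<lambda>_. 0) = 0"
  using cotangent_scale[OF assms tangent_zero, of 0] by simp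

lemma cotangent_sum:
  assumes "\<alpha> \<in> cotangent_space M p" "\<And>i. i \<in> I \<Longrightarrow> X i \<in> tangent_space M p"
  shows "\<alpha> (\<lambda>c. \<Sum>i\<in>I. a i *\<^sub>R X i c) = (\<Sum>i\<in>I. a i * \<alpha> (X i))"
  using assms(2)
proof (induction I rule: infinite_finite_induct)
  case (insert i I)
  then have "(\<lambda>c. \<Sum>i\<in>I. a i *\<^sub>R X i c) \<in> tangent_space M p" by (intro tangent_sum) auto
  then show ?case
    using insert cotangent_add[OF assms(1)] cotangent_scale[OF assms(1)] tangent_scale by simp
qed (auto simp: cotangent_zero[OF assms(1)])

lemma cotangent_expand:
  assumes "\<alpha> \<in> cotangent_space M p" "X \<in> tangent_space M p" "c \<in> charts_at M p"
  shows "\<alpha> X = (\<Sum>b\<in>Basis. (X c \<bullet> b) * \<alpha> (coordinate_vector M c b p))"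
proof -
  have "X = (\<lambda>d. \<Sum>b\<in>Basis. (X c \<bullet> b) *\<^sub>R coordinate_vector M c b p d)"
    by (rule tangent_eqI[OF assms(2) _ assms(3)])
      (auto intro!: tangent_sum coordinate_vector_tangent assms
        simp: coordinate_vector_apply[OF assms(3)] euclidean_representation)
  then have "\<alpha> X = \<alpha> (\<lambda>d. \<Sum>b\<in>Basis. (X c \<bullet> b) *\<^sub>R coordinate_vector M c b p d)" by metis
  also have "\<dots> = (\<Sum>b\<in>Basis. (X c \<bullet> b) * \<alpha> (coordinate_vector M c b p))"
    by (rule cotangent_sum[OF assms(1)]) (auto intro: coordinate_vector_tangent assms)
  finally show ?thesis .
qed

lemma cotangent_eqI:
  assumes "\<alpha> \<in> cotangent_space M p" "\<beta> \<in> cotangent_space M p"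
    "\<And>X. X \<in> tangent_space M p \<Longrightarrow> \<alpha> X = \<beta> X"
  shows "\<alpha> = \<beta>"
proof (rule extensionalityI)
  show "\<alpha> \<in> extensional (tangent_space M p)" "\<beta> \<in> extensional (tangent_space M p)"
    using assms(1,2) unfolding cotangent_space_def by blast+
qed (rule assms(3))

lemma cotangent_lincomb:
  assumes "\<alpha> \<in> cotangent_space M p" "\<beta> \<in> cotangent_space M p"
  shows "(\<lambda>X\<in>tangent_space M p. a * \<alpha> X + b * \<beta> X) \<in> cotangent_space M p"
  unfolding cotangent_space_def
  by (auto simp: tangent_add tangent_scale cotangent_add[OF assms(1)] cotangent_add[OF assms(2)]
      cotangent_scale[OF assms(1)] cotangent_scale[OF assms(2)] algebra_simps)

text \<open>Kept general in \<open>C\<close>, which is later a cotangent space or one of the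
  fibrewise kernels. The element \<xi> is there for the empty sum: the zero covector is obtained as
  \<open>0 * \<xi> X + 0 * \<xi> X\<close>.\<close>

lemma lincomb_sum_closed:
  fixes C :: "('p, 'v) cotangent set"
  assumes closed: "\<And>\<alpha> \<beta> a b. \<alpha> \<in> C \<Longrightarrow> \<beta> \<in> C \<Longrightarrow> (\<lambda>X\<in>tangent_space M p. a * \<alpha> X + b * \<beta> X) \<in> C"
    and \<xi>: "\<xi> \<in> C" and \<theta>: "\<And>i. i < r \<Longrightarrow> \<theta> i \<in> C"
  shows "(\<lambda>X\<in>tangent_space M p. \<Sum>i<(r::nat). x i * \<theta> i X) \<in> C"
  using \<theta>
proof (induction r)
  case 0
  have "(\<lambda>X\<in>tangent_space M p. \<Sum>i<(0::nat). x i * \<theta> i X) = (\<lambda>X\<in>tangent_space M p. 0 * \<xi> X + 0 * \<xi> X)"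
    by (rule restrict_ext) simp
  then show ?case using closed[OF \<xi> \<xi>] by metis
next
  case (Suc r)
  let ?s = "\<lambda>X\<in>tangent_space M p. \<Sum>i<r. x i * \<theta> i X"
  have "?s \<in> C" by (rule Suc.IH[OF Suc.prems]) simp
  from closed[OF this Suc.prems[OF lessI], of 1 "x r"]
  have "(\<lambda>X\<in>tangent_space M p. 1 * ?s X + x r * \<theta> r X) \<in> C" .
  moreover have "(\<lambda>X\<in>tangent_space M p. \<Sum>i<Suc r. x i * \<theta> i X)
      = (\<lambda>X\<in>tangent_space M p. 1 * ?s X + x r * \<theta> r X)"
    by (rule restrict_ext) simp
  ultimately show ?case by metis
qed

lemma lincomb_difference_closed:
  fixes C :: "('p, 'v) cotangent set"
  assumes closed: "\<And>\<alpha> \<beta> a b. \<alpha> \<in> C \<Longrightarrow> \<beta> \<in> C \<Longrightarrow> (\<lambda>X\<in>tangent_space M p. a * \<alpha> X + b * \<beta> X) \<in> C"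
    and \<xi>: "\<xi> \<in> C" and \<theta>: "\<And>i. i < r \<Longrightarrow> \<theta> i \<in> C"
  shows "(\<lambda>X\<in>tangent_space M p. \<xi> X - (\<Sum>i<(r::nat). x i * \<theta> i X)) \<in> C"
proof -
  let ?s = "\<lambda>X\<in>tangent_space M p. \<Sum>i<r. x i * \<theta> i X"
  have "(\<lambda>X\<in>tangent_space M p. \<xi> X - (\<Sum>i<r. x i * \<theta> i X)) = (\<lambda>X\<in>tangent_space M p. 1 * \<xi> X + (-1) * ?s X)"
    by (rule restrict_ext) simp
  moreover have "?s \<in> C" by (rule lincomb_sum_closed[OF closed \<xi> \<theta>])
  ultimately show ?thesis using closed[OF \<xi>, of ?s 1 "-1"] by metis
qed

section \<open>Smooth functions and their differentials\<close>

lemma smooth_fun_chart: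
  "smooth_fun M U f \<Longrightarrow> c \<in> Atlas M \<Longrightarrow> smooth_on (f \<circ> chart_inv c) (snd c ` (fst c \<inter> U))"
  by (simp add: smooth_fun_def)

lemma smooth_fun_open: "smooth_fun M U f \<Longrightarrow> openin (Top M) U"
  by (simp add: smooth_fun_def)

lemma smooth_fun_topspace: "smooth_fun M U f \<Longrightarrow> p \<in> U \<Longrightarrow> p \<in> topspace (Top M)"
  using openin_subset[OF smooth_fun_open] by blast

text \<open>One chart around each point suffices, because any other representation arises from it by
  composing with a smooth transition map.\<close>

lemma smooth_funI:
  assumes "\<And>p. p \<in> U \<Longrightarrow> \<exists>c\<in>charts_at M p. \<exists>W. openin (Top M) W \<and> p \<in> W \<and> W \<subseteq> U \<and> W \<subseteq> fst c \<and>
    smooth_on (f \<circ> chart_inv c) (snd c ` W)"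
  shows "smooth_fun M U f"
  unfolding smooth_fun_def
proof (intro conjI ballI)
  show "openin (Top M) U" by (subst openin_subopen) (use assms in blast)
  fix c' assume c': "c' \<in> Atlas M"
  show "smooth_on (f \<circ> chart_inv c') (snd c' ` (fst c' \<inter> U))"
  proof (rule smooth_on_local)
    fix x assume "x \<in> snd c' ` (fst c' \<inter> U)"
    then obtain p where p: "x = snd c' p" "p \<in> fst c'" "p \<in> U" by blast
    obtain c W where c: "c \<in> charts_at M p" "openin (Top M) W" "p \<in> W" "W \<subseteq> U" "W \<subseteq> fst c"
      "smooth_on (f \<circ> chart_inv c) (snd c ` W)"
      using assms[OF p(3)] by blast
    have cA: "c \<in> Atlas M" using c charts_at_iff by blast
    let ?W = "snd c' ` (fst c' \<inter> W)"
    have o: "open ?W" using open_chart_image c' c by blast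
    have "smooth_on (\<lambda>x. (f \<circ> chart_inv c) (transition c' c x)) ?W"
    proof (rule smooth_on_compose[OF _ c(6) o])
      show "smooth_on (transition c' c) ?W"
        by (rule smooth_on_subset[OF smooth_transition[OF c' cA]]) (use c in auto)
      show "transition c' c ` ?W \<subseteq> snd c ` W"
        using c' by (auto simp: transition_def chart_inv_left)
    qed
    then have "smooth_on (f \<circ> chart_inv c') ?W"
      by (rule smooth_on_cong[OF _ o]) (use c' cA c(5) in \<open>auto simp: transition_def chart_inv_left subset_iff\<close>)
    then show "\<exists>W. open W \<and> x \<in> W \<and> smooth_on (f \<circ> chart_inv c') W"
      using o p c by blast
  qed
qed

lemma smooth_fun_subset:
  "smooth_fun M U f \<Longrightarrow> openin (Top M) W \<Longrightarrow> W \<subseteq> U \<Longrightarrow> smooth_fun M W f"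
  by (auto simp: smooth_fun_def intro: smooth_on_subset)

lemma smooth_fun_cong:
  assumes "smooth_fun M U f" "\<And>p. p \<in> U \<Longrightarrow> f p = g p"
  shows "smooth_fun M U g"
  unfolding smooth_fun_def
proof (intro conjI ballI)
  fix c assume c: "c \<in> Atlas M"
  show "smooth_on (g \<circ> chart_inv c) (snd c ` (fst c \<inter> U))"
    by (rule smooth_on_cong[OF smooth_fun_chart[OF assms(1) c] open_chart_image[OF c smooth_fun_open[OF assms(1)]]])
      (use assms(2) c in \<open>auto simp: chart_inv_left\<close>)
qed (use assms smooth_fun_open in blast)

lemma smooth_fun_local:
  assumes "\<And>p. p \<in> U \<Longrightarrow> \<exists>W. p \<in> W \<and> W \<subseteq> U \<and> smooth_fun M W f"
  shows "smooth_fun M U f"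
proof (rule smooth_funI)
  fix p assume p: "p \<in> U"
  then obtain W where W: "p \<in> W" "W \<subseteq> U" "smooth_fun M W f" using assms by blast
  obtain c where c: "c \<in> charts_at M p"
    using charts_at_nonempty[OF smooth_fun_topspace[OF W(3,1)]] by blast
  then have cA: "c \<in> Atlas M" "p \<in> fst c" by (auto simp: charts_at_iff)
  show "\<exists>c\<in>charts_at M p. \<exists>W. openin (Top M) W \<and> p \<in> W \<and> W \<subseteq> U \<and> W \<subseteq> fst c \<and>
    smooth_on (f \<circ> chart_inv c) (snd c ` W)"
    using smooth_fun_chart[OF W(3) cA(1)] W c cA chart_domain_open[OF cA(1)] smooth_fun_open[OF W(3)]
    by (intro bexI[OF _ c] exI[of _ "fst c \<inter> W"]) (auto intro!: openin_Int)
qed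

lemma smooth_fun_const: "openin (Top M) U \<Longrightarrow> smooth_fun M U (\<lambda>_. a)"
  by (auto simp: smooth_fun_def o_def smooth_on_const)

lemma smooth_fun_add:
  "smooth_fun M U f \<Longrightarrow> smooth_fun M U g \<Longrightarrow> smooth_fun M U (\<lambda>p. f p + g p)"
  unfolding smooth_fun_def o_def by (auto intro!: smooth_on_add open_chart_image)

lemma smooth_fun_mult:
  "smooth_fun M U f \<Longrightarrow> smooth_fun M U g \<Longrightarrow> smooth_fun M U (\<lambda>p. f p * g p)"
  unfolding smooth_fun_def o_def by (auto intro!: smooth_on_mult open_chart_image)

lemma smooth_fun_sum:
  "openin (Top M) U \<Longrightarrow> (\<And>i. i \<in> I \<Longrightarrow> smooth_fun M U (f i)) \<Longrightarrow> smooth_fun M U (\<lambda>p. \<Sum>i\<in>I. f i p)"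
  by (induction I rule: infinite_finite_induct) (auto simp: smooth_fun_const intro: smooth_fun_add)

lemma smooth_fun_of_chart:
  assumes c: "c \<in> Atlas M" and "open S" "smooth_on F S"
  shows "smooth_fun M {p \<in> fst c. snd c p \<in> S} (\<lambda>p. F (snd c p))"
proof (rule smooth_funI, intro bexI exI conjI)
  let ?W = "{p \<in> fst c. snd c p \<in> S}"
  fix p assume p: "p \<in> ?W"
  show "openin (Top M) ?W" using open_chart_vimage assms by blast
  have o: "open (snd c ` ?W)"
    using open_chart_image[OF c open_chart_vimage[OF c assms(2)]] by (simp add: Int_absorb1)
  show "smooth_on ((\<lambda>p. F (snd c p)) \<circ> chart_inv c) (snd c ` ?W)"
    by (rule smooth_on_cong[OF smooth_on_subset[OF assms(3)] o]) (auto simp: chart_inv_left c)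
qed (use assms in \<open>auto simp: charts_at_iff\<close>)

lemma smooth_fun_differentiable:
  "smooth_fun M U f \<Longrightarrow> p \<in> U \<Longrightarrow> c \<in> charts_at M p \<Longrightarrow> (f \<circ> chart_inv c) differentiable (at (snd c p))"
  by (rule smooth_on_differentiable[OF smooth_fun_chart]) (auto simp: charts_at_iff)

text \<open>The definition evaluates in a chart picked by choice; the chain rule for the transition
  map moves the value to any chart at \<open>p\<close>.\<close>

lemma diff_fun_chart:
  assumes "smooth_fun M U f" "p \<in> U" "X \<in> tangent_space M p" "c \<in> charts_at M p"
  shows "diff_fun M f p X = frechet_derivative (f \<circ> chart_inv c) (at (snd c p)) (X c)"
proof -
  define d where "d = (SOME d. d \<in> charts_at M p)"
  have d: "d \<in> charts_at M p" unfolding d_def by (rule some_chart[OF charts_at_topspace[OF assms(4)]])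
  have A: "c \<in> Atlas M" "p \<in> fst c" "d \<in> Atlas M" "p \<in> fst d" using assms d by (auto simp: charts_at_iff)
  have t: "transition d c (snd d p) = snd c p" by (rule transition_apply[OF d])
  have "frechet_derivative (f \<circ> chart_inv d) (at (snd d p)) (X d) =
    frechet_derivative (f \<circ> chart_inv c) (at (transition d c (snd d p)))
      (frechet_derivative (transition d c) (at (snd d p)) (X d))"
  proof (rule frechet_derivative_chain_local[where W="snd d ` (fst d \<inter> fst c)"])
    show "transition d c differentiable at (snd d p)"
      by (rule transition_differentiable[OF d assms(4)])
    show "f \<circ> chart_inv c differentiable at (transition d c (snd d p))"
      unfolding t by (rule smooth_fun_differentiable[OF assms(1,2,4)])
    show "(f \<circ> chart_inv d) y = (f \<circ> chart_inv c) (transition d c y)" if "y \<in> snd d ` (fst d \<inter> fst c)" for y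
      using that A by (auto simp: transition_def chart_inv_left)
  qed (use A open_overlap in auto)
  then show ?thesis
    using assms tangent_transform[OF assms(3) d assms(4)] t by (simp add: diff_fun_def Let_def d_def)
qed

lemma diff_fun_cong:
  assumes "smooth_fun M U f" "p \<in> U" "\<And>q. q \<in> U \<Longrightarrow> f q = g q"
  shows "diff_fun M f p = diff_fun M g p"
proof -
  have g: "smooth_fun M U g" by (rule smooth_fun_cong[OF assms(1,3)])
  obtain c where c: "c \<in> charts_at M p"
    using charts_at_nonempty[OF smooth_fun_topspace[OF assms(1,2)]] by blast
  then have A: "c \<in> Atlas M" "p \<in> fst c" by (auto simp: charts_at_iff)
  have "frechet_derivative (f \<circ> chart_inv c) (at (snd c p)) = frechet_derivative (g \<circ> chart_inv c) (at (snd c p))"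
  proof (rule frechet_derivative_transform_within_open[where X="snd c ` (fst c \<inter> U)"])
    show "f \<circ> chart_inv c differentiable at (snd c p)"
      by (rule smooth_fun_differentiable[OF assms(1,2) c])
    show "open (snd c ` (fst c \<inter> U))"
      by (rule open_chart_image[OF A(1) smooth_fun_open[OF assms(1)]])
    show "(f \<circ> chart_inv c) x = (g \<circ> chart_inv c) x" if "x \<in> snd c ` (fst c \<inter> U)" for x
      using that A assms(3) by (auto simp: chart_inv_left)
  qed (use A assms(2) in auto)
  then have "diff_fun M f p X = diff_fun M g p X" if "X \<in> tangent_space M p" for X
    using diff_fun_chart[OF assms(1,2) that c] diff_fun_chart[OF g assms(2) that c] by simp
  then show ?thesis by (auto simp: diff_fun_def fun_eq_iff)
qed

lemma diff_fun_cotangent: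
  assumes "smooth_fun M U f" "p \<in> U"
  shows "diff_fun M f p \<in> cotangent_space M p"
proof -
  obtain c where c: "c \<in> charts_at M p"
    using charts_at_nonempty[OF smooth_fun_topspace[OF assms(1,2)]] by blast
  have "linear (frechet_derivative (f \<circ> chart_inv c) (at (snd c p)))"
    by (rule linear_frechet_derivative[OF smooth_fun_differentiable[OF assms c]])
  then show ?thesis
    using diff_fun_chart[OF assms _ c] tangent_add tangent_scale
    by (auto simp: cotangent_space_def diff_fun_def linear_add linear_scale)
qed

lemma diff_fun_one_form:
  assumes "smooth_fun M U f"
  shows "restrict (diff_fun M f) U \<in> one_forms M U"
  unfolding one_forms_def
proof (intro CollectI conjI ballI allI)
  fix c :: "('p, 'v) chart" and v assume c: "c \<in> Atlas M"
  have "smooth_on (\<lambda>x. frechet_derivative (f \<circ> chart_inv c) (at x) v) (snd c ` (fst c \<inter> U))"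
    by (rule smooth_on_derivative[OF smooth_fun_chart[OF assms c]])
  from smooth_fun_of_chart[OF c open_chart_image[OF c smooth_fun_open[OF assms]] this]
  have "smooth_fun M (fst c \<inter> U) (\<lambda>p. frechet_derivative (f \<circ> chart_inv c) (at (snd c p)) v)"
    by (rule smooth_fun_subset) (auto intro: openin_Int[OF chart_domain_open[OF c] smooth_fun_open[OF assms]])
  then show "smooth_fun M (fst c \<inter> U) (\<lambda>p. restrict (diff_fun M f) U p (coordinate_vector M c v p))"
    by (rule smooth_fun_cong)
      (use c in \<open>auto simp: diff_fun_chart[OF assms] charts_at_iff coordinate_vector_tangent coordinate_vector_apply\<close>)
qed (use diff_fun_cotangent[OF assms] in auto)

definition coordinate :: "('p, 'v) chart \<Rightarrow> 'v \<Rightarrow> 'p \<Rightarrow> real" where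
  "coordinate c b p = snd c p \<bullet> b"

lemma smooth_coordinate:
  assumes "c \<in> Atlas M" shows "smooth_fun M (fst c) (coordinate c b)"
  using smooth_fun_of_chart[OF assms open_UNIV, of "\<lambda>x. x \<bullet> b"]
  by (simp add: coordinate_def[abs_def] smooth_on_linear bounded_linear_inner_left)

lemma diff_coordinate:
  assumes "c \<in> charts_at M p" "X \<in> tangent_space M p"
  shows "diff_fun M (coordinate c b) p X = X c \<bullet> b"
proof -
  have A: "c \<in> Atlas M" "p \<in> fst c" using assms by (auto simp: charts_at_iff)
  have "(coordinate c b \<circ> chart_inv c has_derivative (\<lambda>x. x \<bullet> b)) (at (snd c p))"
    by (rule has_derivative_transform_within_open[where f="\<lambda>x. x \<bullet> b" and s="snd c ` fst c"])
      (use A in \<open>auto simp: coordinate_def chart_inv_left open_chart_range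
        intro!: bounded_linear_imp_has_derivative bounded_linear_inner_left\<close>)
  then show ?thesis
    using diff_fun_chart[OF smooth_coordinate[OF A(1)] A(2) assms(2,1)] by (simp add: frechet_derivative_eqI)
qed

text \<open>Finite dimension makes every linear functional on the cotangent space an evaluation.\<close>

lemma vector_of_functional:
  assumes p: "p \<in> topspace (Top M)"
    and l: "\<And>\<alpha> \<beta> a b. \<alpha> \<in> cotangent_space M p \<Longrightarrow> \<beta> \<in> cotangent_space M p \<Longrightarrow>
      l (\<lambda>X\<in>tangent_space M p. a * \<alpha> X + b * \<beta> X) = a * l \<alpha> + b * l \<beta>"
  shows "vector_of_functional M p l \<in> tangent_space M p \<and>
    (\<forall>\<beta>\<in>cotangent_space M p. \<beta> (vector_of_functional M p l) = l \<beta>)"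
proof -
  obtain c where c: "c \<in> charts_at M p" using p charts_at_nonempty by blast
  then have A: "c \<in> Atlas M" "p \<in> fst c" by (auto simp: charts_at_iff)
  define dx where "dx b = diff_fun M (coordinate c b) p" for b
  have dx: "dx b \<in> cotangent_space M p" for b
    unfolding dx_def by (rule diff_fun_cotangent[OF smooth_coordinate[OF A(1)] A(2)])
  have dxX: "dx b X = X c \<bullet> b" if "X \<in> tangent_space M p" for X b
    unfolding dx_def using diff_coordinate[OF c that] .
  have zero: "(\<lambda>X\<in>tangent_space M p. 0) \<in> cotangent_space M p"
    using cotangent_lincomb[OF dx dx, of 0 _ 0] by simp
  have l0: "l (\<lambda>X\<in>tangent_space M p. 0) = 0" using l[OF dx dx, of 0 _ 0] by simp
  \<comment> \<open>Additivity of \<open>l\<close> is assumed only for binary combinations, so it is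
    extended to finite sums together with membership in the cotangent space.\<close>
  have lsum: "(\<lambda>X\<in>tangent_space M p. \<Sum>b\<in>I. a b * dx b X) \<in> cotangent_space M p \<and>
    l (\<lambda>X\<in>tangent_space M p. \<Sum>b\<in>I. a b * dx b X) = (\<Sum>b\<in>I. a b * l (dx b))" for I a
  proof (induction I rule: infinite_finite_induct)
    case (insert b I)
    let ?s = "\<lambda>X\<in>tangent_space M p. \<Sum>b\<in>I. a b * dx b X"
    have eq: "(\<lambda>X\<in>tangent_space M p. \<Sum>b\<in>insert b I. a b * dx b X)
      = (\<lambda>X\<in>tangent_space M p. a b * dx b X + 1 * ?s X)"
      using insert by (auto simp: fun_eq_iff)
    have s: "?s \<in> cotangent_space M p" "l ?s = (\<Sum>b\<in>I. a b * l (dx b))" using insert by blast+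
    show ?case unfolding eq
      using l[OF dx s(1), of "a b" b 1] cotangent_lincomb[OF dx s(1), of "a b" b 1] s(2) insert(1,2)
      by (simp only: sum.insert if_False mult_1 simp_thms)
  next
    case (infinite I)
    then show ?case using zero l0 by (simp only: sum.infinite simp_thms if_False)
  next
    case empty
    then show ?case using zero l0 by (simp only: sum.empty simp_thms)
  qed
  \<comment> \<open>These components are forced: \<open>dx b\<close> reads off the component along
    \<open>b\<close>, and must give \<open>l (dx b)\<close>.\<close>
  let ?X = "coordinate_vector M c (\<Sum>b\<in>Basis. l (dx b) *\<^sub>R b) p"
  have "\<exists>!X. X \<in> tangent_space M p \<and> (\<forall>\<beta>\<in>cotangent_space M p. \<beta> X = l \<beta>)"
  proof (rule ex1I[of _ ?X], intro conjI ballI)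
    show X: "?X \<in> tangent_space M p" using coordinate_vector_tangent c by blast
    fix \<beta> assume \<beta>: "\<beta> \<in> cotangent_space M p"
    let ?a = "\<lambda>b. \<beta> (coordinate_vector M c b p)"
    have "\<beta> = (\<lambda>X\<in>tangent_space M p. \<Sum>b\<in>Basis. ?a b * dx b X)"
      by (rule cotangent_eqI[OF \<beta> conjunct1[OF lsum]])
        (simp add: cotangent_expand[OF \<beta> _ c] dxX mult.commute)
    then have "l \<beta> = (\<Sum>b\<in>Basis. ?a b * l (dx b))" using lsum[where I=Basis and a="?a"] by metis
    moreover have "\<beta> ?X = (\<Sum>b\<in>Basis. l (dx b) * ?a b)"
      using cotangent_expand[OF \<beta> X c] by (simp add: coordinate_vector_apply[OF c] inner_sum_left_Basis)
    ultimately show "\<beta> ?X = l \<beta>" by (simp add: mult.commute)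
  next
    fix Y assume Y: "Y \<in> tangent_space M p \<and> (\<forall>\<beta>\<in>cotangent_space M p. \<beta> Y = l \<beta>)"
    have "Y c \<bullet> b = ?X c \<bullet> b" if "b \<in> Basis" for b
      using Y dx dxX[of Y b] that by (simp add: coordinate_vector_apply[OF c] inner_sum_left_Basis)
    then have "Y c = ?X c" by (rule euclidean_eqI)
    then show "Y = ?X" using tangent_eqI Y c coordinate_vector_tangent by blast
  qed
  then show ?thesis unfolding vector_of_functional_def by (rule theI')
qed

end

section \<open>Poisson manifolds and smooth maps\<close>

context smooth_mfd
begin

text \<open>Differentials of coordinate functions already separate tangent vectors.\<close>

lemma tangent_eq_of_cotangent:
  assumes p: "p \<in> topspace (Top M)" and X: "X \<in> tangent_space M p" "Y \<in> tangent_space M p"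
    and eq: "\<And>\<beta>. \<beta> \<in> cotangent_space M p \<Longrightarrow> \<beta> X = \<beta> Y"
  shows "X = Y"
proof -
  obtain c where c: "c \<in> charts_at M p" using charts_at_nonempty[OF p] by blast
  then have A: "c \<in> Atlas M" "p \<in> fst c" by (auto simp: charts_at_iff)
  have "X c \<bullet> b = Y c \<bullet> b" for b
    using eq[OF diff_fun_cotangent[OF smooth_coordinate[OF A(1), of b] A(2)]]
    by (simp add: diff_coordinate[OF c] X)
  then have "X c = Y c" by (rule euclidean_eqI)
  then show ?thesis by (rule tangent_eqI[OF X c])
qed

lemma diff_linear_chart:
  assumes c: "c \<in> charts_at M p" and "X \<in> tangent_space M p" "linear (F :: 'v \<Rightarrow> real)"
  shows "diff_fun M (\<lambda>q. F (snd c q)) p X = F (X c)"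
    and "smooth_fun M (fst c) (\<lambda>q. F (snd c q))"
proof -
  have A: "c \<in> Atlas M" "p \<in> fst c" using c by (auto simp: charts_at_iff)
  have bl: "bounded_linear F" using assms(3) by (simp add: linear_conv_bounded_linear)
  show sm: "smooth_fun M (fst c) (\<lambda>q. F (snd c q))"
    using smooth_fun_of_chart[OF A(1) open_UNIV smooth_on_linear[OF bl open_UNIV]] by simp
  have "((\<lambda>q. F (snd c q)) \<circ> chart_inv c has_derivative F) (at (snd c p))"
    by (rule has_derivative_transform_within_open[OF bounded_linear_imp_has_derivative[OF bl] open_chart_range[OF A(1)]])
      (use A in \<open>auto simp: chart_inv_left\<close>)
  then show "diff_fun M (\<lambda>q. F (snd c q)) p X = F (X c)"
    using diff_fun_chart[OF sm A(2) assms(2) c] by (simp add: frechet_derivative_eqI)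
qed

lemma cotangent_chart_functional:
  assumes "\<alpha> \<in> cotangent_space M p" and c: "c \<in> charts_at M p"
  shows "linear (\<lambda>v. \<alpha> (coordinate_vector M c v p))"
    and "X \<in> tangent_space M p \<Longrightarrow> \<alpha> X = \<alpha> (coordinate_vector M c (X c) p)"
proof -
  have "\<alpha> (coordinate_vector M c v p) = (\<Sum>b\<in>Basis. (v \<bullet> b) * \<alpha> (coordinate_vector M c b p))" for v
    by (rule cotangent_expand[OF assms(1) coordinate_vector_tangent[OF c, of v] c,
          unfolded coordinate_vector_apply[OF c]])
  then have eq: "(\<lambda>v. \<alpha> (coordinate_vector M c v p)) = (\<lambda>v. \<Sum>b\<in>Basis. (v \<bullet> b) * \<alpha> (coordinate_vector M c b p))"
    by (rule ext)
  show "linear (\<lambda>v. \<alpha> (coordinate_vector M c v p))"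
    unfolding eq by (rule linearI) (simp_all add: inner_add_left distrib_right sum.distrib sum_distrib_left mult.assoc)
  show "\<alpha> X = \<alpha> (coordinate_vector M c (X c) p)" if "X \<in> tangent_space M p"
    by (rule arg_cong[OF tangent_eq_coordinate_vector[OF that c]])
qed

text \<open>Take the function that is linear in a chart with the prescribed differential. This
  translates pointwise statements about covectors into statements about functions, the language of
  the Jacobi identity and of Poisson maps.\<close>

lemma cotangent_is_differential:
  assumes "\<alpha> \<in> cotangent_space M p" "p \<in> topspace (Top M)"
  obtains U h where "smooth_fun M U h" "p \<in> U" "diff_fun M h p = \<alpha>"
proof -
  obtain c where c: "c \<in> charts_at M p" using charts_at_nonempty[OF assms(2)] by blast
  then have A: "c \<in> Atlas M" "p \<in> fst c" by (auto simp: charts_at_iff)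
  let ?F = "\<lambda>v. \<alpha> (coordinate_vector M c v p)"
  let ?h = "\<lambda>q. ?F (snd c q)"
  have lin: "linear ?F" by (rule cotangent_chart_functional[OF assms(1) c])
  have sm: "smooth_fun M (fst c) ?h"
    by (rule diff_linear_chart(2)[OF c tangent_zero lin])
  have "diff_fun M ?h p = \<alpha>"
  proof (rule cotangent_eqI[OF diff_fun_cotangent[OF sm A(2)] assms(1)])
    fix X assume X: "X \<in> tangent_space M p"
    show "diff_fun M ?h p X = \<alpha> X"
      by (rule trans[OF diff_linear_chart(1)[OF c X lin] sym[OF cotangent_chart_functional(2)[OF assms(1) c X]]])
  qed
  then show ?thesis using that[OF sm A(2)] by blast
qed

end

section \<open>Poisson bivectors, brackets and Hamiltonian vectors\<close>

locale poisson_mfd = smooth_mfd M for M :: "('p, 'v::euclidean_space) manifold" +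
  fixes P :: "('p, 'v) bivector"
  assumes poisson: "poisson_manifold M P"
begin

lemma bivector_antisym:
  "p \<in> topspace (Top M) \<Longrightarrow> \<alpha> \<in> cotangent_space M p \<Longrightarrow> \<beta> \<in> cotangent_space M p \<Longrightarrow> P p \<alpha> \<beta> = - P p \<beta> \<alpha>"
  using poisson unfolding poisson_manifold_def bivector_field_def by blast

lemma bivector_linear1:
  "p \<in> topspace (Top M) \<Longrightarrow> \<alpha> \<in> cotangent_space M p \<Longrightarrow> \<beta> \<in> cotangent_space M p \<Longrightarrow> \<gamma> \<in> cotangent_space M p \<Longrightarrow>
   P p (\<lambda>X\<in>tangent_space M p. a * \<alpha> X + b * \<beta> X) \<gamma> = a * P p \<alpha> \<gamma> + b * P p \<beta> \<gamma>"
  using poisson unfolding poisson_manifold_def bivector_field_def by blast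

lemma bivector_linear2:
  assumes "p \<in> topspace (Top M)" "\<alpha> \<in> cotangent_space M p" "\<beta> \<in> cotangent_space M p" "\<gamma> \<in> cotangent_space M p"
  shows "P p \<gamma> (\<lambda>X\<in>tangent_space M p. a * \<alpha> X + b * \<beta> X) = a * P p \<gamma> \<alpha> + b * P p \<gamma> \<beta>"
proof -
  let ?s = "\<lambda>X\<in>tangent_space M p. a * \<alpha> X + b * \<beta> X"
  have "P p \<gamma> ?s = - P p ?s \<gamma>"
    by (rule bivector_antisym[OF assms(1,4) cotangent_lincomb[OF assms(2,3)]])
  also have "\<dots> = - (a * P p \<alpha> \<gamma> + b * P p \<beta> \<gamma>)" unfolding bivector_linear1[OF assms] ..
  also have "\<dots> = a * P p \<gamma> \<alpha> + b * P p \<gamma> \<beta>"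
    using bivector_antisym[OF assms(1,4,2)] bivector_antisym[OF assms(1,4,3)] by simp
  finally show ?thesis .
qed

lemma bivector_smooth:
  "\<omega> \<in> one_forms M U \<Longrightarrow> \<eta> \<in> one_forms M U \<Longrightarrow> openin (Top M) U \<Longrightarrow> smooth_fun M U (\<lambda>p. P p (\<omega> p) (\<eta> p))"
  using poisson unfolding poisson_manifold_def bivector_field_def by blast

lemma sharp:
  assumes "p \<in> topspace (Top M)" "\<alpha> \<in> cotangent_space M p"
  shows "sharp M P p \<alpha> \<in> tangent_space M p"
    and "\<beta> \<in> cotangent_space M p \<Longrightarrow> \<beta> (sharp M P p \<alpha>) = P p \<alpha> \<beta>"
proof -
  have *: "sharp M P p \<alpha> \<in> tangent_space M p \<and> (\<forall>\<beta>\<in>cotangent_space M p. \<beta> (sharp M P p \<alpha>) = P p \<alpha> \<beta>)"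
    unfolding sharp_def
    by (rule vector_of_functional[OF assms(1)]) (rule bivector_linear2[OF assms(1) _ _ assms(2)])
  show "sharp M P p \<alpha> \<in> tangent_space M p" by (rule conjunct1[OF *])
  show "\<beta> \<in> cotangent_space M p \<Longrightarrow> \<beta> (sharp M P p \<alpha>) = P p \<alpha> \<beta>" by (rule bspec[OF conjunct2[OF *]])
qed

lemma sharp_zero_iff:
  assumes "p \<in> topspace (Top M)" "\<alpha> \<in> cotangent_space M p"
  shows "sharp M P p \<alpha> = (\<lambda>_. 0) \<longleftrightarrow> (\<forall>\<beta>\<in>cotangent_space M p. P p \<alpha> \<beta> = 0)"
proof
  assume 0: "sharp M P p \<alpha> = (\<lambda>_. 0)"
  show "\<forall>\<beta>\<in>cotangent_space M p. P p \<alpha> \<beta> = 0"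
  proof
    fix \<beta> assume \<beta>: "\<beta> \<in> cotangent_space M p"
    show "P p \<alpha> \<beta> = 0" using sharp(2)[OF assms \<beta>] cotangent_zero[OF \<beta>] unfolding 0 by simp
  qed
next
  assume "\<forall>\<beta>\<in>cotangent_space M p. P p \<alpha> \<beta> = 0"
  then show "sharp M P p \<alpha> = (\<lambda>_. 0)"
    by (intro tangent_eq_of_cotangent[OF assms(1) sharp(1)[OF assms] tangent_zero])
      (simp add: sharp(2)[OF assms] cotangent_zero)
qed

lemma hamiltonian_vector:
  assumes "smooth_fun M U h" "p \<in> U"
  shows "hamiltonian_vector M P h p \<in> tangent_space M p"
    and "\<alpha> \<in> cotangent_space M p \<Longrightarrow> \<alpha> (hamiltonian_vector M P h p) = P p \<alpha> (diff_fun M h p)"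
proof -
  let ?X = "hamiltonian_vector M P h p"
  have *: "?X \<in> tangent_space M p \<and> (\<forall>\<beta>\<in>cotangent_space M p. \<beta> ?X = P p \<beta> (diff_fun M h p))"
    unfolding hamiltonian_vector_def
    by (rule vector_of_functional[OF smooth_fun_topspace[OF assms]])
      (rule bivector_linear1[OF smooth_fun_topspace[OF assms] _ _ diff_fun_cotangent[OF assms]])
  show "?X \<in> tangent_space M p" by (rule conjunct1[OF *])
  show "\<alpha> \<in> cotangent_space M p \<Longrightarrow> \<alpha> ?X = P p \<alpha> (diff_fun M h p)" by (rule bspec[OF conjunct2[OF *]])
qed

lemma bracket_smooth:
  assumes "smooth_fun M U f" "smooth_fun M U g"
  shows "smooth_fun M U (poisson_bracket M P f g)"
  by (rule smooth_fun_cong[OF bivector_smooth[OF assms[THEN diff_fun_one_form] smooth_fun_open[OF assms(1)]]])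
    (simp add: poisson_bracket_def)

lemma bracket_antisym:
  "smooth_fun M U f \<Longrightarrow> smooth_fun M U g \<Longrightarrow> p \<in> U \<Longrightarrow> poisson_bracket M P f g p = - poisson_bracket M P g f p"
  unfolding poisson_bracket_def by (intro bivector_antisym) (auto intro: diff_fun_cotangent smooth_fun_topspace)

lemma bracket_hamiltonian:
  assumes "smooth_fun M U f" "smooth_fun M U h" "p \<in> U"
  shows "poisson_bracket M P f h p = diff_fun M f p (hamiltonian_vector M P h p)"
  using hamiltonian_vector(2)[OF assms(2,3) diff_fun_cotangent[OF assms(1,3)]] by (simp add: poisson_bracket_def)

lemma bracket_cong1:
  assumes "smooth_fun M U f" "p \<in> U" "\<And>q. q \<in> U \<Longrightarrow> f q = g q"
  shows "poisson_bracket M P f h p = poisson_bracket M P g h p"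
    and "poisson_bracket M P h f p = poisson_bracket M P h g p"
  using diff_fun_cong[OF assms] by (simp_all add: poisson_bracket_def)

text \<open>Serves to pull a sign produced by antisymmetry out of an inner bracket of the Jacobi
  identity.\<close>

lemma bracket_minus1:
  assumes "smooth_fun M U f" "smooth_fun M U h" "p \<in> U"
  shows "poisson_bracket M P (\<lambda>q. - f q) h p = - poisson_bracket M P f h p"
proof -
  have m: "smooth_fun M U (\<lambda>q. - f q)"
    using smooth_fun_mult[OF smooth_fun_const[OF smooth_fun_open[OF assms(1)], of "-1"] assms(1)] by simp
  let ?X = "hamiltonian_vector M P h p"
  have X: "?X \<in> tangent_space M p" by (rule hamiltonian_vector(1)[OF assms(2,3)])
  obtain c where c: "c \<in> charts_at M p" using charts_at_nonempty[OF smooth_fun_topspace[OF assms(1,3)]] by blast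
  have "((\<lambda>q. - f q) \<circ> chart_inv c has_derivative (\<lambda>v. - frechet_derivative (f \<circ> chart_inv c) (at (snd c p)) v)) (at (snd c p))"
    using has_derivative_minus[OF has_derivative_frechet[OF smooth_fun_differentiable[OF assms(1,3) c]]]
    by (simp add: o_def)
  then show ?thesis
    unfolding bracket_hamiltonian[OF assms] bracket_hamiltonian[OF m assms(2,3)]
      diff_fun_chart[OF assms(1,3) X c] diff_fun_chart[OF m assms(3) X c]
    by (simp add: frechet_derivative_eqI)
qed

lemma bracket_zero:
  assumes "smooth_fun M U f" "smooth_fun M U h" "p \<in> U" "\<And>q. q \<in> U \<Longrightarrow> h q = 0"
  shows "poisson_bracket M P f h p = 0"
proof -
  let ?X = "hamiltonian_vector M P f p"
  have X: "?X \<in> tangent_space M p" by (rule hamiltonian_vector(1)[OF assms(1,3)])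
  have z: "smooth_fun M U (\<lambda>_. 0)" by (rule smooth_fun_const[OF smooth_fun_open[OF assms(1)]])
  obtain c where c: "c \<in> charts_at M p" using charts_at_nonempty[OF smooth_fun_topspace[OF assms(1,3)]] by blast
  have "diff_fun M h p ?X = diff_fun M (\<lambda>_. 0) p ?X"
    using diff_fun_cong[OF assms(2,3,4)] by simp
  also have "\<dots> = 0" using diff_fun_chart[OF z assms(3) X c] by (simp add: o_def)
  finally show ?thesis
    using bracket_antisym[OF assms(1-3)] bracket_hamiltonian[OF assms(2,1,3)] by simp
qed

lemma jacobi:
  "smooth_fun M U f \<Longrightarrow> smooth_fun M U g \<Longrightarrow> smooth_fun M U h \<Longrightarrow> p \<in> U \<Longrightarrow>
   poisson_bracket M P f (poisson_bracket M P g h) p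
             + poisson_bracket M P g (poisson_bracket M P h f) p
             + poisson_bracket M P h (poisson_bracket M P f g) p = 0"
  using poisson unfolding poisson_manifold_def by blast

text \<open>As \<open>{u, f}\<close> is the derivative of \<open>u\<close> along the Hamiltonian
  field of \<open>f\<close>, this is the commutation of the fields of \<open>f\<close> and
  \<open>g\<close>, tested on \<open>u\<close>. In the Jacobi identity the term containing
  \<open>{f, g}\<close> drops out.\<close>

lemma commuting_brackets:
  assumes f: "smooth_fun M U f" and g: "smooth_fun M U g" and u: "smooth_fun M U u" and p: "p \<in> U"
    and 0: "\<And>q. q \<in> U \<Longrightarrow> poisson_bracket M P f g q = 0"
  shows "poisson_bracket M P (poisson_bracket M P u f) g p = poisson_bracket M P (poisson_bracket M P u g) f p"
proof -
  let ?b = "poisson_bracket M P"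
  have gu: "?b f (?b g u) p = ?b (?b u g) f p"
  proof -
    have "?b f (?b g u) p = - ?b (?b g u) f p" by (rule bracket_antisym[OF f bracket_smooth[OF g u] p])
    also have "?b (?b g u) f p = ?b (\<lambda>q. - ?b u g q) f p"
      by (rule bracket_cong1(1)[OF bracket_smooth[OF g u] p bracket_antisym[OF g u]])
    also have "\<dots> = - ?b (?b u g) f p" by (rule bracket_minus1[OF bracket_smooth[OF u g] f p])
    finally show ?thesis by simp
  qed
  have "?b g (?b u f) p = - ?b (?b u f) g p" by (rule bracket_antisym[OF g bracket_smooth[OF u f] p])
  moreover have "?b u (?b f g) p = 0" by (rule bracket_zero[OF u bracket_smooth[OF f g] p 0])
  ultimately show ?thesis using jacobi[OF u f g p] gu by simp
qed

section \<open>Hamiltonian vector fields in a chart\<close>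

definition chart_field :: "('p, 'v) chart \<Rightarrow> ('p \<Rightarrow> real) \<Rightarrow> 'v \<Rightarrow> 'v" where
  "chart_field c h x = hamiltonian_vector M P h (chart_inv c x) c"

lemma chart_field_component:
  assumes c: "c \<in> Atlas M" and "smooth_fun M U h" and U: "U \<subseteq> fst c" and "p \<in> U"
  shows "chart_field c h (snd c p) \<bullet> b = poisson_bracket M P (coordinate c b) h p"
proof -
  have pc: "c \<in> charts_at M p" using assms by (auto simp: charts_at_iff)
  have u: "smooth_fun M U (coordinate c b)"
    by (rule smooth_fun_subset[OF smooth_coordinate[OF c] smooth_fun_open[OF assms(2)] U])
  have "poisson_bracket M P (coordinate c b) h p = hamiltonian_vector M P h p c \<bullet> b"
    unfolding bracket_hamiltonian[OF u assms(2,4)]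
    by (rule diff_coordinate[OF pc hamiltonian_vector(1)[OF assms(2,4)]])
  then show ?thesis using assms chart_inv_left[OF c, of p] by (auto simp: chart_field_def)
qed

text \<open>Each component is the bracket of a coordinate function with \<open>h\<close>, and
  brackets of smooth functions are smooth.\<close>

lemma chart_field_smooth:
  assumes c: "c \<in> Atlas M" and h: "smooth_fun M U h" and U: "U \<subseteq> fst c"
  shows "smooth_on (chart_field c h) (snd c ` U)"
proof (rule smooth_on_componentwise)
  have UU: "fst c \<inter> U = U" using U by blast
  show o: "open (snd c ` U)" using open_chart_image[OF c smooth_fun_open[OF h]] unfolding UU .
  fix b
  have u: "smooth_fun M U (coordinate c b)"
    by (rule smooth_fun_subset[OF smooth_coordinate[OF c] smooth_fun_open[OF h] U])
  have "smooth_on (poisson_bracket M P (coordinate c b) h \<circ> chart_inv c) (snd c ` U)"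
    using smooth_fun_chart[OF bracket_smooth[OF u h] c] unfolding UU .
  then show "smooth_on (\<lambda>x. chart_field c h x \<bullet> b) (snd c ` U)"
    by (rule smooth_on_cong[OF _ o]) (use U in \<open>auto simp: chart_field_component[OF c h U] chart_inv_left[OF c] subset_iff\<close>)
qed

text \<open>The coordinate form of a vanishing Lie bracket. Component \<open>b\<close> of either
  side is an iterated bracket starting from the coordinate function along \<open>b\<close>, so the
  Jacobi identity applies component by component.\<close>

lemma chart_fields_commute:
  assumes c: "c \<in> Atlas M" and f: "smooth_fun M U f" and g: "smooth_fun M U g" and U: "U \<subseteq> fst c" and p: "p \<in> U"
    and 0: "\<And>q. q \<in> U \<Longrightarrow> poisson_bracket M P f g q = 0"
  shows "frechet_derivative (chart_field c f) (at (snd c p)) (chart_field c g (snd c p)) =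
    frechet_derivative (chart_field c g) (at (snd c p)) (chart_field c f (snd c p))"
proof (rule euclidean_eqI)
  fix b :: 'v
  have pc: "c \<in> charts_at M p" using assms by (auto simp: charts_at_iff)
  have u: "smooth_fun M U (coordinate c b)"
    by (rule smooth_fun_subset[OF smooth_coordinate[OF c] smooth_fun_open[OF f] U])
  have UU: "fst c \<inter> U = U" using U by blast
  have o: "open (snd c ` U)" using open_chart_image[OF c smooth_fun_open[OF f]] unfolding UU .
  have px: "snd c p \<in> snd c ` U" using p by blast
  have *: "frechet_derivative (chart_field c f) (at (snd c p)) (chart_field c g (snd c p)) \<bullet> b =
      poisson_bracket M P (poisson_bracket M P (coordinate c b) f) g p"
    if f: "smooth_fun M U f" and g: "smooth_fun M U g" for f g
  proof -
    let ?w = "hamiltonian_vector M P g p c"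
    let ?uf = "poisson_bracket M P (coordinate c b) f"
    have w: "chart_field c g (snd c p) = ?w" using chart_inv_left[OF c, of p] U p by (auto simp: chart_field_def)
    have "(chart_field c f has_derivative frechet_derivative (chart_field c f) (at (snd c p))) (at (snd c p))"
      by (rule smooth_on_has_derivative[OF chart_field_smooth[OF c f U] px])
    then have "((\<lambda>x. chart_field c f x \<bullet> b) has_derivative (\<lambda>v. frechet_derivative (chart_field c f) (at (snd c p)) v \<bullet> b)) (at (snd c p))"
      by (rule has_derivative_inner_left)
    then have "(?uf \<circ> chart_inv c has_derivative (\<lambda>v. frechet_derivative (chart_field c f) (at (snd c p)) v \<bullet> b)) (at (snd c p))"
      by (rule has_derivative_transform_within_open[OF _ o px])
        (use U in \<open>auto simp: chart_field_component[OF c f U] chart_inv_left[OF c] subset_iff\<close>)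
    from frechet_derivative_eqI[OF this] show ?thesis
      unfolding w bracket_hamiltonian[OF bracket_smooth[OF u f] g p]
        diff_fun_chart[OF bracket_smooth[OF u f] p hamiltonian_vector(1)[OF g p] pc] by simp
  qed
  show "frechet_derivative (chart_field c f) (at (snd c p)) (chart_field c g (snd c p)) \<bullet> b =
    frechet_derivative (chart_field c g) (at (snd c p)) (chart_field c f (snd c p)) \<bullet> b"
    unfolding *[OF f g] *[OF g f] by (rule commuting_brackets[OF f g u p 0])
qed

end

section \<open>Smooth maps, their differentials and pullbacks\<close>

locale smooth_mfd_map = M: smooth_mfd M + N: smooth_mfd N
  for M :: "('p, 'v::euclidean_space) manifold" and N :: "('q, 'w::euclidean_space) manifold" +
  fixes \<phi> :: "'p \<Rightarrow> 'q"
  assumes smooth_map: "smooth_map M N \<phi>"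
begin

lemma map_topspace: "p \<in> topspace (Top M) \<Longrightarrow> \<phi> p \<in> topspace (Top N)"
  using smooth_map by (auto simp: smooth_map_def continuous_map_def)

lemma map_open_vimage:
  "openin (Top N) V \<Longrightarrow> openin (Top M) {p \<in> topspace (Top M). \<phi> p \<in> V}"
  using smooth_map by (auto simp: smooth_map_def continuous_map_def)

lemma local_rep_smooth:
  "c \<in> Atlas M \<Longrightarrow> d \<in> Atlas N \<Longrightarrow> smooth_on (snd d \<circ> \<phi> \<circ> chart_inv c) (snd c ` {p \<in> fst c. \<phi> p \<in> fst d})"
  using smooth_map unfolding smooth_map_def by blast

lemma local_rep_domain:
  assumes "c \<in> Atlas M" "d \<in> Atlas N"
  shows "openin (Top M) {p \<in> fst c. \<phi> p \<in> fst d}" "open (snd c ` {p \<in> fst c. \<phi> p \<in> fst d})"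
proof -
  have eq: "{p \<in> fst c. \<phi> p \<in> fst d} = fst c \<inter> {p \<in> topspace (Top M). \<phi> p \<in> fst d}"
    using M.chart_domain_subset[OF assms(1)] by auto
  show "openin (Top M) {p \<in> fst c. \<phi> p \<in> fst d}"
    unfolding eq by (rule openin_Int[OF M.chart_domain_open[OF assms(1)] map_open_vimage[OF N.chart_domain_open[OF assms(2)]]])
  show "open (snd c ` {p \<in> fst c. \<phi> p \<in> fst d})"
    unfolding eq by (rule M.open_chart_image[OF assms(1) map_open_vimage[OF N.chart_domain_open[OF assms(2)]]])
qed

lemma local_rep_differentiable:
  assumes "c \<in> charts_at M p" "d \<in> charts_at N (\<phi> p)"
  shows "(snd d \<circ> \<phi> \<circ> chart_inv c) differentiable (at (snd c p))"
proof (rule smooth_on_differentiable[OF local_rep_smooth])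
  show "c \<in> Atlas M" "d \<in> Atlas N" "snd c p \<in> snd c ` {p \<in> fst c. \<phi> p \<in> fst d}"
    using assms by (auto simp: M.charts_at_iff N.charts_at_iff)
qed

lemma diff_map_chart:
  assumes "X \<in> tangent_space M p" and c: "c \<in> charts_at M p" and d: "d \<in> charts_at N (\<phi> p)"
  shows "diff_map M N \<phi> p X d = frechet_derivative (snd d \<circ> \<phi> \<circ> chart_inv c) (at (snd c p)) (X c)"
proof -
  define c' where "c' = (SOME c. c \<in> charts_at M p)"
  have c': "c' \<in> charts_at M p" unfolding c'_def by (rule M.some_chart[OF M.charts_at_topspace[OF c]])
  have A: "c \<in> Atlas M" "p \<in> fst c" "c' \<in> Atlas M" "p \<in> fst c'" using c c' by (auto simp: M.charts_at_iff)
  have t: "transition c' c (snd c' p) = snd c p" by (rule M.transition_apply[OF c'])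
  have "frechet_derivative (snd d \<circ> \<phi> \<circ> chart_inv c') (at (snd c' p)) (X c') =
    frechet_derivative (snd d \<circ> \<phi> \<circ> chart_inv c) (at (transition c' c (snd c' p)))
      (frechet_derivative (transition c' c) (at (snd c' p)) (X c'))"
  proof (rule frechet_derivative_chain_local[where W="snd c' ` (fst c' \<inter> fst c)"])
    show "transition c' c differentiable at (snd c' p)"
      by (rule M.transition_differentiable[OF c' c])
    show "(snd d \<circ> \<phi> \<circ> chart_inv c) differentiable at (transition c' c (snd c' p))"
      unfolding t by (rule local_rep_differentiable[OF c d])
    show "(snd d \<circ> \<phi> \<circ> chart_inv c') y = (snd d \<circ> \<phi> \<circ> chart_inv c) (transition c' c y)" if "y \<in> snd c' ` (fst c' \<inter> fst c)" for y
      using that A by (auto simp: transition_def M.chart_inv_left)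
  qed (use A M.open_overlap in auto)
  then show ?thesis
    using d M.tangent_transform[OF assms(1) c' c] t by (simp add: diff_map_def Let_def c'_def)
qed

lemma diff_map_tangent:
  assumes X: "X \<in> tangent_space M p" and p: "p \<in> topspace (Top M)"
  shows "diff_map M N \<phi> p X \<in> tangent_space N (\<phi> p)"
  unfolding tangent_space_def
proof (intro CollectI conjI ballI)
  obtain c where c: "c \<in> charts_at M p" using M.charts_at_nonempty[OF p] by blast
  then have A: "c \<in> Atlas M" "p \<in> fst c" by (auto simp: M.charts_at_iff)
  fix d e assume d: "d \<in> charts_at N (\<phi> p)" and e: "e \<in> charts_at N (\<phi> p)"
  then have B: "d \<in> Atlas N" "\<phi> p \<in> fst d" "e \<in> Atlas N" "\<phi> p \<in> fst e" by (auto simp: N.charts_at_iff)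
  have at: "(snd d \<circ> \<phi> \<circ> chart_inv c) (snd c p) = snd d (\<phi> p)" using A by (simp add: M.chart_inv_left)
  have "frechet_derivative (snd e \<circ> \<phi> \<circ> chart_inv c) (at (snd c p)) (X c) =
    frechet_derivative (transition d e) (at ((snd d \<circ> \<phi> \<circ> chart_inv c) (snd c p)))
      (frechet_derivative (snd d \<circ> \<phi> \<circ> chart_inv c) (at (snd c p)) (X c))"
  proof (rule frechet_derivative_chain_local[where W="snd c ` {p \<in> fst c. \<phi> p \<in> fst d}"])
    show "(snd d \<circ> \<phi> \<circ> chart_inv c) differentiable at (snd c p)" by (rule local_rep_differentiable[OF c d])
    show "transition d e differentiable at ((snd d \<circ> \<phi> \<circ> chart_inv c) (snd c p))"
      unfolding at by (rule N.transition_differentiable[OF d e])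
    show "(snd e \<circ> \<phi> \<circ> chart_inv c) y = transition d e ((snd d \<circ> \<phi> \<circ> chart_inv c) y)" if "y \<in> snd c ` {p \<in> fst c. \<phi> p \<in> fst d}" for y
      using that A B by (auto simp: transition_def M.chart_inv_left N.chart_inv_left)
    show "open (snd c ` {p \<in> fst c. \<phi> p \<in> fst d})" by (rule local_rep_domain(2)[OF A(1) B(1)])
  qed (use A B in auto)
  then show "diff_map M N \<phi> p X e = frechet_derivative (transition d e) (at (snd d (\<phi> p))) (diff_map M N \<phi> p X d)"
    unfolding diff_map_chart[OF X c d] diff_map_chart[OF X c e] at .
next
  show "\<forall>c. c \<notin> charts_at N (\<phi> p) \<longrightarrow> diff_map M N \<phi> p X c = 0" by (simp add: diff_map_def)
qed

lemma smooth_fun_pullback: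
  assumes h: "smooth_fun N V h"
  shows "smooth_fun M {p \<in> topspace (Top M). \<phi> p \<in> V} (h \<circ> \<phi>)"
proof (rule M.smooth_funI)
  let ?U = "{p \<in> topspace (Top M). \<phi> p \<in> V}"
  fix p assume p: "p \<in> ?U"
  obtain c where c: "c \<in> charts_at M p" using p M.charts_at_nonempty by blast
  obtain d where d: "d \<in> charts_at N (\<phi> p)" using p N.charts_at_nonempty[OF N.smooth_fun_topspace[OF h]] by blast
  have A: "c \<in> Atlas M" "p \<in> fst c" "d \<in> Atlas N" "\<phi> p \<in> fst d" using c d by (auto simp: M.charts_at_iff N.charts_at_iff)
  let ?W = "{p \<in> fst c. \<phi> p \<in> fst d} \<inter> ?U"
  have oW: "openin (Top M) ?W"
    by (rule openin_Int[OF local_rep_domain(1)[OF A(1,3)] map_open_vimage[OF N.smooth_fun_open[OF h]]])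
  have WW: "fst c \<inter> ?W = ?W" by blast
  have o: "open (snd c ` ?W)" using M.open_chart_image[OF A(1) oW] unfolding WW .
  have "smooth_on (\<lambda>x. (h \<circ> chart_inv d) ((snd d \<circ> \<phi> \<circ> chart_inv c) x)) (snd c ` ?W)"
  proof (rule smooth_on_compose[OF _ N.smooth_fun_chart[OF h A(3)] o])
    show "smooth_on (snd d \<circ> \<phi> \<circ> chart_inv c) (snd c ` ?W)"
      by (rule smooth_on_subset[OF local_rep_smooth[OF A(1,3)]]) blast
    show "(snd d \<circ> \<phi> \<circ> chart_inv c) ` snd c ` ?W \<subseteq> snd d ` (fst d \<inter> V)"
      using A(1) by (auto simp: M.chart_inv_left)
  qed
  then have "smooth_on ((h \<circ> \<phi>) \<circ> chart_inv c) (snd c ` ?W)"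
    by (rule smooth_on_cong[OF _ o]) (use A in \<open>auto simp: M.chart_inv_left N.chart_inv_left\<close>)
  then show "\<exists>c\<in>charts_at M p. \<exists>W. openin (Top M) W \<and> p \<in> W \<and> W \<subseteq> ?U \<and> W \<subseteq> fst c \<and>
    smooth_on ((h \<circ> \<phi>) \<circ> chart_inv c) (snd c ` W)"
    using oW p A by (intro bexI[OF _ c] exI[of _ ?W]) auto
qed

lemma diff_fun_pullback:
  assumes h: "smooth_fun N V h" and p: "p \<in> topspace (Top M)" "\<phi> p \<in> V" and X: "X \<in> tangent_space M p"
  shows "diff_fun M (h \<circ> \<phi>) p X = diff_fun N h (\<phi> p) (diff_map M N \<phi> p X)"
proof -
  obtain c where c: "c \<in> charts_at M p" using p M.charts_at_nonempty by blast
  obtain d where d: "d \<in> charts_at N (\<phi> p)" using N.charts_at_nonempty[OF N.smooth_fun_topspace[OF h p(2)]] by blast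
  have A: "c \<in> Atlas M" "p \<in> fst c" "d \<in> Atlas N" "\<phi> p \<in> fst d" using c d by (auto simp: M.charts_at_iff N.charts_at_iff)
  have pU: "p \<in> {p \<in> topspace (Top M). \<phi> p \<in> V}" using p by blast
  have at: "(snd d \<circ> \<phi> \<circ> chart_inv c) (snd c p) = snd d (\<phi> p)" using A by (simp add: M.chart_inv_left)
  have "frechet_derivative ((h \<circ> \<phi>) \<circ> chart_inv c) (at (snd c p)) (X c) =
    frechet_derivative (h \<circ> chart_inv d) (at ((snd d \<circ> \<phi> \<circ> chart_inv c) (snd c p)))
      (frechet_derivative (snd d \<circ> \<phi> \<circ> chart_inv c) (at (snd c p)) (X c))"
  proof (rule frechet_derivative_chain_local[where W="snd c ` {p \<in> fst c. \<phi> p \<in> fst d}"])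
    show "(snd d \<circ> \<phi> \<circ> chart_inv c) differentiable at (snd c p)" by (rule local_rep_differentiable[OF c d])
    show "(h \<circ> chart_inv d) differentiable at ((snd d \<circ> \<phi> \<circ> chart_inv c) (snd c p))"
      unfolding at by (rule N.smooth_fun_differentiable[OF h p(2) d])
    show "((h \<circ> \<phi>) \<circ> chart_inv c) y = (h \<circ> chart_inv d) ((snd d \<circ> \<phi> \<circ> chart_inv c) y)"
      if "y \<in> snd c ` {p \<in> fst c. \<phi> p \<in> fst d}" for y
      using that A by (auto simp: M.chart_inv_left N.chart_inv_left)
    show "open (snd c ` {p \<in> fst c. \<phi> p \<in> fst d})" by (rule local_rep_domain(2)[OF A(1,3)])
  qed (use A in auto)
  then show ?thesis
    unfolding M.diff_fun_chart[OF smooth_fun_pullback[OF h] pU X c]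
      N.diff_fun_chart[OF h p(2) diff_map_tangent[OF X p(1)] d] diff_map_chart[OF X c d] at .
qed

lemma pullback_differential:
  assumes h: "smooth_fun N V h" and p: "p \<in> topspace (Top M)" "\<phi> p \<in> V"
  shows "pullback M N \<phi> p (diff_fun N h (\<phi> p)) = diff_fun M (h \<circ> \<phi>) p"
proof -
  have pU: "p \<in> {p \<in> topspace (Top M). \<phi> p \<in> V}" using p by blast
  have "diff_fun M (h \<circ> \<phi>) p \<in> extensional (tangent_space M p)" by (simp add: diff_fun_def)
  then show ?thesis
    using diff_fun_pullback[OF assms] by (intro extensionalityI[of _ "tangent_space M p"]) (auto simp: pullback_def)
qed

text \<open>Locally the covector is a differential \<open>dh\<close>, so its pullback is the
  differential of \<open>h \<circ> \<phi>\<close>.\<close>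

lemma pullback_cotangent:
  assumes "\<alpha> \<in> cotangent_space N (\<phi> p)" "p \<in> topspace (Top M)"
  shows "pullback M N \<phi> p \<alpha> \<in> cotangent_space M p"
proof -
  obtain V h where h: "smooth_fun N V h" "\<phi> p \<in> V" "diff_fun N h (\<phi> p) = \<alpha>"
    using N.cotangent_is_differential[OF assms(1) map_topspace[OF assms(2)]] by metis
  show ?thesis
    using M.diff_fun_cotangent[OF smooth_fun_pullback[OF h(1)]] pullback_differential[OF h(1) assms(2) h(2)] assms(2) h(2,3)
    by simp
qed

end

section \<open>Frames, kernels and commuting vector fields\<close>

text \<open>The orthogonal complement of the kernel is mapped onto the target, so it has at least
  the target's dimension. This bounds the dimension of the kernel by \<open>dim S\<close>, and the
  inclusion of \<open>S\<close> in the kernel becomes an equality.\<close>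

lemma kernel_eq_of_dim:
  fixes L :: "'a::euclidean_space \<Rightarrow> 'b::euclidean_space"
  assumes L: "linear L" "surj L" and S: "subspace S" "DIM('a) = DIM('b) + dim S"
    and z: "\<And>x. x \<in> S \<Longrightarrow> L x = 0" and x: "L x = 0"
  shows "x \<in> S"
proof -
  define K where "K = {x. L x = 0}"
  have K: "subspace K" unfolding K_def by (rule linear_subspace_kernel[OF L(1)])
  define C where "C = {y. \<forall>x\<in>K. orthogonal x y}"
  have dimC: "dim C + dim K = DIM('a)"
    using dim_subspace_orthogonal_to_vectors[OF K subspace_UNIV subset_UNIV] by (simp add: C_def)
  have "L ` C = UNIV"
  proof (intro equalityI subset_UNIV subsetI)
    fix z
    obtain y where y: "z = L y" using L(2) by (metis surjD)
    obtain u w where uw: "u \<in> span K" "\<And>k. k \<in> span K \<Longrightarrow> orthogonal w k" "y = u + w"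
      using orthogonal_subspace_decomp_exists[of K y] by metis
    have "L u = 0" using uw(1) K by (simp add: span_eq_iff[THEN iffD2] K_def)
    then have "z = L w" using y uw(3) linear_add[OF L(1)] by simp
    moreover have "w \<in> C" using uw(2) span_base by (auto simp: C_def orthogonal_commute)
    ultimately show "z \<in> L ` C" by blast
  qed
  then have "DIM('b) \<le> dim C"
    using dim_image_le[OF L(1), of C] by simp
  then have "dim K \<le> dim S" using dimC S(2) by simp
  moreover have "S \<subseteq> K" using z by (auto simp: K_def)
  ultimately have "S = K" using subspace_dim_equal[OF S(1) K] by blast
  then show ?thesis using x by (simp add: K_def)
qed

text \<open>A count: the image of \<open>v\<close> spans a space of dimension \<open>r\<close>, so
  it has exactly \<open>r\<close> elements. Hence \<open>v\<close> is injective on the indices and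
  its image is independent.\<close>

lemma spanning_independent:
  fixes v :: "nat \<Rightarrow> 'a::euclidean_space"
  assumes "subspace S" "dim S = r" "\<And>x. x \<in> S \<Longrightarrow> \<exists>a. x = (\<Sum>i<r. a i *\<^sub>R v i)"
    "\<And>i. i < r \<Longrightarrow> v i \<in> S" "(\<Sum>i<r. c i *\<^sub>R v i) = 0" "i < r"
  shows "c i = 0"
proof -
  let ?V = "v ` {..<r}"
  have sub: "S \<subseteq> span ?V"
  proof
    fix x assume "x \<in> S"
    then obtain a where "x = (\<Sum>i<r. a i *\<^sub>R v i)" using assms(3) by blast
    moreover have "(\<Sum>i<r. a i *\<^sub>R v i) \<in> span ?V"
      by (rule span_sum) (simp add: span_scale span_base)
    ultimately show "x \<in> span ?V" by simp
  qed
  have VS: "?V \<subseteq> S" using assms(4) by blast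
  have "dim S \<le> card ?V" by (rule span_card_ge_dim[OF VS sub]) simp
  then have card: "card ?V = r" using assms(2) card_image_le[of "{..<r}" v] by simp
  then have inj: "inj_on v {..<r}" by (intro eq_card_imp_inj_on) auto
  have ind: "independent ?V"
    by (rule card_le_dim_spanning[OF VS sub]) (simp_all add: card assms(2))
  \<comment> \<open>Independence concerns sets of vectors; injectivity turns the indexed relation
    into one over the image.\<close>
  have "(\<Sum>x\<in>?V. c (inv_into {..<r} v x) *\<^sub>R x) = (\<Sum>i<r. c i *\<^sub>R v i)"
    by (subst sum.reindex[OF inj]) (auto intro!: sum.cong simp: inv_into_f_f[OF inj])
  then have "c (inv_into {..<r} v (v i)) = 0"
    using independentD[OF ind _ subset_refl, of "\<lambda>x. c (inv_into {..<r} v x)" "v i"] assms(5,6) by simp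
  then show ?thesis using assms(6) by (simp add: inv_into_f_f[OF inj])
qed

text \<open>Gronwall: \<open>e\<^sup>-\<^sup>2\<^sup>C\<^sup>t y \<bullet> y\<close> decreases and \<open>e\<^sup>2\<^sup>C\<^sup>t y \<bullet> y\<close> increases.\<close>

lemma vanishing_of_derivative_bound:
  fixes y :: "real \<Rightarrow> 'a::real_inner"
  assumes I: "convex I"
    and der: "\<And>t. t \<in> I \<Longrightarrow> (y has_vector_derivative y' t) (at t)"
    and bound: "\<And>t. t \<in> I \<Longrightarrow> norm (y' t) \<le> C * norm (y t)"
    and s: "s \<in> I" "y s = 0" and t: "t \<in> I"
  shows "y t = 0"
proof -
  have seg: "u \<in> I" if "a \<in> I" "b \<in> I" "a \<le> u" "u \<le> b" for a b u
    using mem_is_interval_1_I[OF iffD2[OF is_interval_convex_1 I]] that by blast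
  have der_E: "((\<lambda>t. exp (k * t) * (y t \<bullet> y t)) has_real_derivative
      exp (k * u) * (k * (y u \<bullet> y u) + 2 * (y u \<bullet> y' u))) (at u)" if "u \<in> I" for k u
  proof -
    have "((\<lambda>t. y t \<bullet> y t) has_real_derivative (y u \<bullet> y' u + y' u \<bullet> y u)) (at u)"
      unfolding has_field_derivative_def
      by (rule has_derivative_eq_rhs[OF has_derivative_inner[OF der[OF that, unfolded has_vector_derivative_def]
            der[OF that, unfolded has_vector_derivative_def]]]) (auto simp: algebra_simps)
    then show ?thesis
      by (auto intro!: derivative_eq_intros simp: algebra_simps inner_commute)
  qed
  have bd: "\<bar>2 * (y u \<bullet> y' u)\<bar> \<le> 2 * C * (y u \<bullet> y u)" if "u \<in> I" for u
  proof -
    have "\<bar>y u \<bullet> y' u\<bar> \<le> norm (y u) * norm (y' u)" by (rule Cauchy_Schwarz_ineq2)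
    also have "\<dots> \<le> norm (y u) * (C * norm (y u))" by (rule mult_left_mono[OF bound[OF that] norm_ge_zero])
    also have "\<dots> = C * (y u \<bullet> y u)" by (simp add: power2_norm_eq_inner[symmetric] power2_eq_square)
    finally show ?thesis by simp
  qed
  have "y t \<bullet> y t \<le> 0"
  proof (cases "s \<le> t")
    case True
    have "exp (- 2 * C * t) * (y t \<bullet> y t) \<le> exp (- 2 * C * s) * (y s \<bullet> y s)"
    proof (rule DERIV_nonpos_imp_nonincreasing[OF True])
      fix u assume "s \<le> u" "u \<le> t"
      then have u: "u \<in> I" using seg s t by blast
      have "exp (- 2 * C * u) * (- 2 * C * (y u \<bullet> y u) + 2 * (y u \<bullet> y' u)) \<le> 0"
        using bd[OF u] by (intro mult_nonneg_nonpos) auto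
      then show "\<exists>z. ((\<lambda>t. exp (- 2 * C * t) * (y t \<bullet> y t)) has_real_derivative z) (at u) \<and> z \<le> 0"
        using der_E[OF u] by blast
    qed
    then show ?thesis using s by (simp add: mult_le_0_iff)
  next
    case False
    have "exp (2 * C * t) * (y t \<bullet> y t) \<le> exp (2 * C * s) * (y s \<bullet> y s)"
    proof (rule DERIV_nonneg_imp_nondecreasing[of t s])
      show "t \<le> s" using False by simp
      fix u assume "t \<le> u" "u \<le> s"
      then have u: "u \<in> I" using seg s t by blast
      have "0 \<le> exp (2 * C * u) * (2 * C * (y u \<bullet> y u) + 2 * (y u \<bullet> y' u))"
        using bd[OF u] by (intro mult_nonneg_nonneg) auto
      then show "\<exists>z. ((\<lambda>t. exp (2 * C * t) * (y t \<bullet> y t)) has_real_derivative z) (at u) \<and> 0 \<le> z"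
        using der_E[OF u] by blast
    qed
    then show ?thesis using s by (simp add: mult_le_0_iff)
  qed
  then show ?thesis by (metis inner_eq_zero_iff inner_ge_zero order_antisym)
qed

text \<open>If \<open>Y\<close> commutes with a frame, then along a line whose direction \<open>w\<close> is spanned by the frame it
  satisfies a linear differential equation: \<open>D\<^sub>w Y = \<Sum> a\<^sub>i D\<^sub>Y v\<^sub>i\<close>.\<close>

lemma commuting_field_vanishing:
  fixes Y :: "'a::euclidean_space \<Rightarrow> 'a" and v :: "nat \<Rightarrow> 'a \<Rightarrow> 'a"
  assumes S: "open S" and Y: "smooth_on Y S" and v: "\<And>i. i < r \<Longrightarrow> smooth_on (v i) S"
    and ind: "\<And>x c. x \<in> S \<Longrightarrow> (\<Sum>i<r. c i *\<^sub>R v i x) = 0 \<Longrightarrow> \<forall>i<r. c i = (0::real)"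
    and w: "\<And>x. x \<in> S \<Longrightarrow> \<exists>a. w = (\<Sum>i<r. a i *\<^sub>R v i x)"
    and comm: "\<And>x i. x \<in> S \<Longrightarrow> i < r \<Longrightarrow>
      frechet_derivative Y (at x) (v i x) = frechet_derivative (v i) (at x) (Y x)"
    and x0: "x0 \<in> S"
  obtains e where "e > 0" "\<And>s t. \<bar>s\<bar> < e \<Longrightarrow> \<bar>t\<bar> < e \<Longrightarrow> Y (x0 + s *\<^sub>R w) = 0 \<Longrightarrow> Y (x0 + t *\<^sub>R w) = 0"
proof -
  obtain a where a: "\<And>x. x \<in> S \<Longrightarrow> w = (\<Sum>i<r. a x i *\<^sub>R v i x)" using w by metis
  have sa: "smooth_on (\<lambda>x. a x i) S" if "i < r" for i
    by (rule smooth_on_frame_coefficients[where a="\<lambda>i x. a x i" and v=v and y="\<lambda>_. w", OF S v smooth_on_const ind a that])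
  \<comment> \<open>\<open>K x\<close> bounds the linear map sending \<open>y\<close> to the
    combination with coefficients \<open>a x i\<close> of the derivatives of \<open>v i\<close> in
    direction \<open>y\<close>. Sums over \<open>Basis\<close> make its continuity immediate, hence
    its boundedness on a compact ball.\<close>
  define K where "K x = (\<Sum>i<r. \<bar>a x i\<bar> * (\<Sum>b\<in>Basis. norm (frechet_derivative (v i) (at x) b)))" for x
  have contK: "continuous_on S K" unfolding K_def
    by (intro continuous_on_sum continuous_on_mult continuous_on_rabs continuous_on_norm smooth_on_imp_continuous_on
       sa smooth_on_derivative v) auto
  obtain d where d: "d > 0" "cball x0 d \<subseteq> S" using S x0 open_contains_cball by blast
  have "compact (K ` cball x0 d)"
    by (rule compact_continuous_image[OF continuous_on_subset[OF contK d(2)] compact_cball])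
  then have "bounded (K ` cball x0 d)" by (rule compact_imp_bounded)
  then obtain C where "\<forall>z\<in>K ` cball x0 d. norm z \<le> C" unfolding bounded_iff by blast
  then have C: "K x \<le> C" if "x \<in> cball x0 d" for x
    using that by force
  have DY: "norm (frechet_derivative Y (at x) w) \<le> C * norm (Y x)" if x: "x \<in> cball x0 d" for x
  proof -
    have xS: "x \<in> S" using x d by blast
    have linY: "linear (frechet_derivative Y (at x))"
      by (rule linear_frechet_derivative[OF smooth_on_differentiable[OF Y xS]])
    have "frechet_derivative Y (at x) w = frechet_derivative Y (at x) (\<Sum>i<r. a x i *\<^sub>R v i x)"
      using a[OF xS] by (rule arg_cong)
    also have "\<dots> = (\<Sum>i<r. a x i *\<^sub>R frechet_derivative Y (at x) (v i x))"
      by (simp add: linear_sum[OF linY] linear_scale[OF linY])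
    also have "\<dots> = (\<Sum>i<r. a x i *\<^sub>R frechet_derivative (v i) (at x) (Y x))"
      using comm[OF xS] by (intro sum.cong) auto
    finally have eq: "frechet_derivative Y (at x) w = (\<Sum>i<r. a x i *\<^sub>R frechet_derivative (v i) (at x) (Y x))" .
    have "norm (frechet_derivative (v i) (at x) (Y x)) \<le> (\<Sum>b\<in>Basis. norm (frechet_derivative (v i) (at x) b)) * norm (Y x)"
      if i: "i < r" for i
    proof -
      have lin: "linear (frechet_derivative (v i) (at x))"
        by (rule linear_frechet_derivative[OF smooth_on_differentiable[OF v[OF i] xS]])
      have "norm (frechet_derivative (v i) (at x) (Y x)) = norm (\<Sum>b\<in>Basis. (Y x \<bullet> b) *\<^sub>R frechet_derivative (v i) (at x) b)"
        by (rule arg_cong[OF linear_eq_sum_Basis[OF lin]])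
      also have "\<dots> \<le> (\<Sum>b\<in>Basis. norm ((Y x \<bullet> b) *\<^sub>R frechet_derivative (v i) (at x) b))"
        by (rule norm_sum)
      also have "\<dots> \<le> (\<Sum>b\<in>Basis. norm (frechet_derivative (v i) (at x) b) * norm (Y x))"
        by (intro sum_mono) (simp add: mult.commute[of _ "norm (Y x)"] mult_right_mono Basis_le_norm)
      finally show ?thesis by (simp add: sum_distrib_right)
    qed
    then have "norm (a x i *\<^sub>R frechet_derivative (v i) (at x) (Y x)) \<le>
        \<bar>a x i\<bar> * (\<Sum>b\<in>Basis. norm (frechet_derivative (v i) (at x) b)) * norm (Y x)" if "i < r" for i
      using that by (simp add: mult.assoc mult_left_mono)
    then have "norm (frechet_derivative Y (at x) w) \<le> K x * norm (Y x)"
      unfolding eq K_def sum_distrib_right by (intro order_trans[OF norm_sum] sum_mono) auto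
    also have "\<dots> \<le> C * norm (Y x)" by (rule mult_right_mono[OF C[OF x] norm_ge_zero])
    finally show ?thesis .
  qed
  \<comment> \<open>Keeps the line inside the closed ball for parameters below \<open>e\<close>;
    adding 1 makes the denominator positive also for \<open>w = 0\<close>.\<close>
  define e where "e = d / (norm w + 1)"
  have nw: "norm w + 1 > 0" using norm_ge_zero[of w] by linarith
  have e: "e > 0" using d(1) nw by (simp add: e_def)
  have inb: "x0 + t *\<^sub>R w \<in> cball x0 d" if "\<bar>t\<bar> < e" for t
  proof -
    have "\<bar>t\<bar> * norm w \<le> e * (norm w + 1)" using that e by (intro mult_mono) auto
    also have "\<dots> = d" using nw by (simp add: e_def)
    finally show ?thesis by (simp add: dist_norm)
  qed
  show ?thesis
  proof (rule that[OF e])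
    fix s t :: real assume st: "\<bar>s\<bar> < e" "\<bar>t\<bar> < e" "Y (x0 + s *\<^sub>R w) = 0"
    have der: "((\<lambda>t. Y (x0 + t *\<^sub>R w)) has_vector_derivative frechet_derivative Y (at (x0 + t *\<^sub>R w)) w) (at t)"
      if "t \<in> ball 0 e" for t
    proof -
      have tS: "x0 + t *\<^sub>R w \<in> S" using inb[of t] that d by (auto simp: dist_norm)
      have dY: "(Y has_derivative frechet_derivative Y (at (x0 + t *\<^sub>R w))) (at (x0 + t *\<^sub>R w))"
        by (rule smooth_on_has_derivative[OF Y tS])
      have "((\<lambda>t. x0 + t *\<^sub>R w) has_derivative (\<lambda>h. h *\<^sub>R w)) (at t)"
        by (auto intro!: derivative_eq_intros)
      from has_derivative_compose[OF this dY]
      show ?thesis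
        by (simp add: has_vector_derivative_def linear_scale[OF has_derivative_linear[OF dY]])
    qed
    show "Y (x0 + t *\<^sub>R w) = 0"
    proof (rule vanishing_of_derivative_bound[OF convex_ball der, where s=s])
      show "norm (frechet_derivative Y (at (x0 + t *\<^sub>R w)) w) \<le> C * norm (Y (x0 + t *\<^sub>R w))" if "t \<in> ball 0 e" for t
        using DY[OF inb[of t]] that by (auto simp: dist_norm)
    qed (use st in \<open>auto simp: dist_norm\<close>)
  qed
qed

section \<open>Non-commutative integrable systems\<close>

locale nci = smooth_mfd_map M B \<phi> + M: poisson_mfd M P + N: poisson_mfd B Q
  for M :: "('m, 'x::euclidean_space) manifold" and B :: "('b, 'y::euclidean_space) manifold"
    and \<phi> :: "'m \<Rightarrow> 'b" and P :: "('m, 'x) bivector" and Q :: "('b, 'y) bivector" +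
  fixes r :: nat and S :: "'x set" and D :: "('m, 'x) chart set"
  assumes abstract_nci: "abstract_nci M P r S D"
    and dimension: "DIM('x) = DIM('y) + r"
    and submersion: "submersion M B \<phi>"
    and surjective: "\<phi> ` topspace (Top M) = topspace (Top B)"
    and fibres: "\<And>p q. p \<in> topspace (Top M) \<Longrightarrow> q \<in> topspace (Top M) \<Longrightarrow> \<phi> p = \<phi> q \<longleftrightarrow> same_leaf S D p q"
    and poisson_map: "poisson_map M P B Q \<phi>"
begin

section \<open>Leaves as fibres of the projection\<close>

lemma foliated_atlas:
  "subspace S" "dim S = r" "D \<subseteq> Atlas M" "\<Union> (fst ` D) = topspace (Top M)"
  "c \<in> D \<Longrightarrow> convex (snd c ` fst c)"
  using abstract_nci unfolding abstract_nci_def foliated_atlas_def by blast+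

lemma foliated_chart:
  assumes "p \<in> topspace (Top M)"
  obtains c where "c \<in> D" "c \<in> charts_at M p"
  using foliated_atlas(3,4) assms unfolding charts_at_def by blast

lemma same_fibre:
  assumes "c \<in> D" "p \<in> fst c" "q \<in> fst c" "snd c p - snd c q \<in> S"
  shows "\<phi> p = \<phi> q"
proof -
  have c: "c \<in> Atlas M" using assms(1) foliated_atlas(3) by blast
  have "same_plaque S D p q" using assms unfolding same_plaque_def by blast
  then have "same_leaf S D p q" unfolding same_leaf_def by (rule r_into_rtranclp)
  then show ?thesis using fibres M.chart_domain_subset[OF c] assms(2,3) by blast
qed

lemma diff_map_surj:
  "p \<in> topspace (Top M) \<Longrightarrow> diff_map M B \<phi> p ` tangent_space M p = tangent_space B (\<phi> p)"
  using submersion unfolding submersion_def by blast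

lemma local_rep_derivative_surj:
  assumes c: "c \<in> charts_at M p" and d: "d \<in> charts_at B (\<phi> p)"
  shows "surj (frechet_derivative (snd d \<circ> \<phi> \<circ> chart_inv c) (at (snd c p)))"
  unfolding surj_def
proof
  fix w
  let ?W = "coordinate_vector B d w (\<phi> p)"
  have "?W \<in> diff_map M B \<phi> p ` tangent_space M p"
    unfolding diff_map_surj[OF M.charts_at_topspace[OF c]] by (rule N.coordinate_vector_tangent[OF d])
  then obtain X where X: "X \<in> tangent_space M p" "?W = diff_map M B \<phi> p X" by blast
  have "w = ?W d" using N.coordinate_vector_apply[OF d] by simp
  also have "\<dots> = diff_map M B \<phi> p X d" using X(2) by (rule arg_cong)
  also have "\<dots> = frechet_derivative (snd d \<circ> \<phi> \<circ> chart_inv c) (at (snd c p)) (X c)"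
    by (rule diff_map_chart[OF X(1) c d])
  finally show "\<exists>x. w = frechet_derivative (snd d \<circ> \<phi> \<circ> chart_inv c) (at (snd c p)) x" by blast
qed

text \<open>One inclusion holds because plaques lie in fibres, so \<phi> is constant along them.
  Equality then follows by dimension, from the submersion property and
  \<open>DIM('x) = DIM('y) + r\<close>.\<close>

lemma kernel_local_rep:
  assumes "c \<in> D" and c: "c \<in> charts_at M p" and d: "d \<in> charts_at B (\<phi> p)"
  shows "v \<in> S \<longleftrightarrow> frechet_derivative (snd d \<circ> \<phi> \<circ> chart_inv c) (at (snd c p)) v = 0"
proof -
  let ?f = "snd d \<circ> \<phi> \<circ> chart_inv c"
  let ?L = "frechet_derivative ?f (at (snd c p))"
  have A: "c \<in> Atlas M" "p \<in> fst c" using c by (auto simp: M.charts_at_iff)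
  have der: "(?f has_derivative ?L) (at (snd c p))"
    by (rule has_derivative_frechet[OF local_rep_differentiable[OF c d]])
  have lin: "linear ?L" by (rule has_derivative_linear[OF der])
  have z: "?L v = 0" if v: "v \<in> S" for v
  proof -
    have line: "((\<lambda>t. snd c p + t *\<^sub>R v) has_derivative (\<lambda>h. h *\<^sub>R v)) (at 0)"
      by (auto intro!: derivative_eq_intros)
    have 1: "((\<lambda>t. ?f (snd c p + t *\<^sub>R v)) has_derivative (\<lambda>h. ?L (h *\<^sub>R v))) (at 0)"
      by (rule has_derivative_compose[OF line]) (use der in \<open>simp only: scaleR_zero_left add_0_right\<close>)
    have op: "open ((\<lambda>t. snd c p + t *\<^sub>R v) -` (snd c ` fst c))"
      by (rule open_vimage[OF M.open_chart_range[OF A(1)]]) (intro continuous_intros)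
    \<comment> \<open>As long as the line in direction \<open>v\<close> stays in the chart image it
      stays in the plaque of \<open>p\<close>, so the composite is constant near 0.\<close>
    have "((\<lambda>t. ?f (snd c p)) has_derivative (\<lambda>h. ?L (h *\<^sub>R v))) (at (0::real))"
    proof (rule has_derivative_transform_within_open[OF 1 op])
      show "(0::real) \<in> (\<lambda>t. snd c p + t *\<^sub>R v) -` (snd c ` fst c)" using A by simp
      fix t assume t: "t \<in> (\<lambda>t. snd c p + t *\<^sub>R v) -` (snd c ` fst c)"
      then obtain q where q: "q \<in> fst c" "snd c q = snd c p + t *\<^sub>R v" by (metis image_iff vimage_eq)
      have "\<phi> q = \<phi> p"
        by (rule same_fibre[OF assms(1) q(1) A(2)]) (simp add: q(2) subspace_scale[OF foliated_atlas(1) v])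
      then show "?f (snd c p + t *\<^sub>R v) = ?f (snd c p)"
        using M.chart_inv_left[OF A(1)] A(2) q by (simp flip: q(2))
    qed
    then have "(\<lambda>h::real. ?L (h *\<^sub>R v)) = (\<lambda>_. 0)"
      by (rule has_derivative_unique[OF _ has_derivative_const])
    from fun_cong[OF this, of 1] show ?thesis by simp
  qed
  show ?thesis
    using kernel_eq_of_dim[OF lin local_rep_derivative_surj[OF c d] foliated_atlas(1) _ z] z dimension foliated_atlas(2)
    by blast
qed

text \<open>The leaf tangent space imposes its condition in every foliated chart at
  \<open>p\<close>; each of these conditions is the same chart-free one, that the differential of
  \<phi> kills \<open>X\<close>.\<close>

lemma leaf_tangent_iff:
  assumes p: "p \<in> topspace (Top M)"
  shows "X \<in> leaf_tangent_space M S D p \<longleftrightarrow> X \<in> tangent_space M p \<and> diff_map M B \<phi> p X = (\<lambda>_. 0)"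
proof -
  obtain d where d: "d \<in> charts_at B (\<phi> p)" using N.charts_at_nonempty[OF map_topspace[OF p]] by blast
  have key: "X c \<in> S \<longleftrightarrow> diff_map M B \<phi> p X = (\<lambda>_. 0)"
    if X: "X \<in> tangent_space M p" and c: "c \<in> D" "p \<in> fst c" for c
  proof -
    have cp: "c \<in> charts_at M p" using c foliated_atlas(3) by (auto simp: M.charts_at_iff)
    have "X c \<in> S \<longleftrightarrow> diff_map M B \<phi> p X d = 0"
      unfolding kernel_local_rep[OF c(1) cp d] diff_map_chart[OF X cp d] ..
    also have "\<dots> \<longleftrightarrow> diff_map M B \<phi> p X = (\<lambda>_. 0)"
      using N.tangent_eqI[OF diff_map_tangent[OF X p] N.tangent_zero d] by auto
    finally show ?thesis .
  qed
  obtain c where "c \<in> D" "c \<in> charts_at M p" by (rule foliated_chart[OF p])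
  then have c: "c \<in> D" "p \<in> fst c" by (auto simp: M.charts_at_iff)
  show ?thesis unfolding leaf_tangent_space_def using key c by blast
qed

lemma diff_map_zero_kills:
  assumes "\<xi> \<in> cotangent_space B (\<phi> p)" "diff_map M B \<phi> p X = (\<lambda>_. 0)"
  shows "\<xi> (diff_map M B \<phi> p X) = 0"
  unfolding assms(2) by (rule N.cotangent_zero[OF assms(1)])

text \<open>The local data of the integrable system with leaves replaced by fibres of \<phi>, which
  is the form needed for descending the functions to \<open>B\<close>.\<close>

definition frame_at :: "'m set \<Rightarrow> (nat \<Rightarrow> 'm \<Rightarrow> real) \<Rightarrow> bool" where
  "frame_at U f \<longleftrightarrow> openin (Top M) U \<and> (\<forall>i<r. smooth_fun M U (f i)) \<and>
     (\<forall>i<r. \<forall>p\<in>U. \<forall>q\<in>U. \<phi> p = \<phi> q \<longrightarrow> f i p = f i q) \<and>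
     (\<forall>p\<in>U. leaf_tangent_space M S D p =
           {X. \<exists>a::nat \<Rightarrow> real. X = (\<lambda>c. \<Sum>i<r. a i *\<^sub>R hamiltonian_vector M P (f i) p c)})"

lemma frame_at_exists:
  assumes "m \<in> topspace (Top M)"
  obtains U f where "frame_at U f" "m \<in> U"
proof -
  obtain U f where *: "openin (Top M) U" "m \<in> U" "\<And>i. i < r \<Longrightarrow> first_integral M S D U (f i)"
    "\<forall>p\<in>U. leaf_tangent_space M S D p =
           {X. \<exists>a::nat \<Rightarrow> real. X = (\<lambda>c. \<Sum>i<r. a i *\<^sub>R hamiltonian_vector M P (f i) p c)}"
    using abstract_nci assms unfolding abstract_nci_def by blast
  have U: "p \<in> topspace (Top M)" if "p \<in> U" for p using openin_subset[OF *(1)] that by blast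
  have eq: "f i p = f i q" if "i < r" "p \<in> U" "q \<in> U" "\<phi> p = \<phi> q" for i p q
    using *(3)[OF that(1)] fibres[OF U U] that unfolding first_integral_def by blast
  have sm: "smooth_fun M U (f i)" if "i < r" for i
    using *(3)[OF that] unfolding first_integral_def by blast
  have "frame_at U f" unfolding frame_at_def
    by (intro conjI allI impI ballI *(1) sm eq bspec[OF *(4)])
  then show ?thesis using that *(2) by blast
qed

section \<open>Hamiltonian frames of the leaves\<close>

context
  fixes U f assumes frame: "frame_at U f"
begin

lemma frame_open: "openin (Top M) U"
  using frame unfolding frame_at_def by blast

lemma frame_topspace: "p \<in> U \<Longrightarrow> p \<in> topspace (Top M)"
  using openin_subset[OF frame_open] by blast

lemma frame_smooth: "i < r \<Longrightarrow> smooth_fun M U (f i)"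
  using frame unfolding frame_at_def by blast

lemma frame_fibre: "i < r \<Longrightarrow> p \<in> U \<Longrightarrow> q \<in> U \<Longrightarrow> \<phi> p = \<phi> q \<Longrightarrow> f i p = f i q"
  using frame unfolding frame_at_def by blast

lemma frame_tangent: "i < r \<Longrightarrow> p \<in> U \<Longrightarrow> hamiltonian_vector M P (f i) p \<in> tangent_space M p"
  by (rule M.hamiltonian_vector(1)[OF frame_smooth])

lemma frame_span:
  "p \<in> U \<Longrightarrow> X \<in> leaf_tangent_space M S D p \<longleftrightarrow> (\<exists>a. X = (\<lambda>c. \<Sum>i<r. a i *\<^sub>R hamiltonian_vector M P (f i) p c))"
  using frame unfolding frame_at_def by blast

lemma frame_leaf:
  assumes "i < r" "p \<in> U" shows "hamiltonian_vector M P (f i) p \<in> leaf_tangent_space M S D p"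
proof -
  have "hamiltonian_vector M P (f i) p = (\<lambda>c. \<Sum>j<r. (if j = i then 1 else 0) *\<^sub>R hamiltonian_vector M P (f j) p c)"
    using assms(1) by (auto simp: if_distrib[of "\<lambda>a. a *\<^sub>R _"] cong: if_cong)
  then show ?thesis unfolding frame_span[OF assms(2)] by (rule exI[of _ "\<lambda>j. if j = i then 1 else 0"])
qed

lemma frame_vertical:
  assumes "i < r" "p \<in> U" shows "diff_map M B \<phi> p (hamiltonian_vector M P (f i) p) = (\<lambda>_. 0)"
  using frame_leaf[OF assms] leaf_tangent_iff[OF frame_topspace[OF assms(2)]] by blast

lemma frame_chart_span:
  assumes "p \<in> U" "c \<in> D" "c \<in> charts_at M p" "v \<in> S"
  shows "\<exists>a. v = (\<Sum>i<r. a i *\<^sub>R hamiltonian_vector M P (f i) p c)"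
proof -
  have p: "p \<in> topspace (Top M)" by (rule frame_topspace[OF assms(1)])
  obtain d where d: "d \<in> charts_at B (\<phi> p)" using N.charts_at_nonempty[OF map_topspace[OF p]] by blast
  let ?X = "coordinate_vector M c v p"
  have X: "?X \<in> tangent_space M p" by (rule M.coordinate_vector_tangent[OF assms(3)])
  have Xc: "?X c = v" by (rule M.coordinate_vector_apply[OF assms(3)])
  have "diff_map M B \<phi> p ?X d = 0"
    unfolding diff_map_chart[OF X assms(3) d] Xc using kernel_local_rep[OF assms(2,3) d] assms(4) by blast
  then have "diff_map M B \<phi> p ?X = (\<lambda>_. 0)"
    by (rule N.tangent_eqI[OF diff_map_tangent[OF X p] N.tangent_zero d])
  then have "?X \<in> leaf_tangent_space M S D p" using leaf_tangent_iff[OF p] X by blast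
  then obtain a where "?X = (\<lambda>c. \<Sum>i<r. a i *\<^sub>R hamiltonian_vector M P (f i) p c)"
    using frame_span[OF assms(1)] by blast
  from fun_cong[OF this, of c] show ?thesis unfolding Xc by blast
qed

text \<open>In a foliated chart the \<open>r\<close> coordinate vectors lie in \<open>S\<close> and
  span it, so counting gives independence. A relation read in another chart is first moved to a
  foliated one.\<close>

lemma frame_independent:
  assumes p: "p \<in> U" and c: "c \<in> charts_at M p" and "(\<Sum>i<r. a i *\<^sub>R hamiltonian_vector M P (f i) p c) = 0" "i < r"
  shows "a i = 0"
proof -
  obtain d where d: "d \<in> D" "d \<in> charts_at M p" by (rule foliated_chart[OF frame_topspace[OF p]])
  have "(\<lambda>c. \<Sum>i<r. a i *\<^sub>R hamiltonian_vector M P (f i) p c) = (\<lambda>_. 0)"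
    by (rule M.tangent_eqI[OF M.tangent_sum M.tangent_zero c]) (use assms frame_tangent in auto)
  from fun_cong[OF this, of d] have z: "(\<Sum>i<r. a i *\<^sub>R hamiltonian_vector M P (f i) p d) = 0" .
  have inS: "hamiltonian_vector M P (f i) p d \<in> S" if "i < r" for i
    using frame_leaf[OF that p] d by (auto simp: leaf_tangent_space_def M.charts_at_iff)
  show ?thesis
    by (rule spanning_independent[OF foliated_atlas(1,2) frame_chart_span[OF p d] inS z assms(4)])
qed

end

text \<open>The bracket is \<open>dh\<close> evaluated on the image under d\<phi> of the Hamiltonian
  vector of \<open>f\<close>.\<close>

lemma bracket_vertical:
  assumes "smooth_fun M U f" "p \<in> U" "smooth_fun B V h" "\<phi> p \<in> V"
    and v: "diff_map M B \<phi> p (hamiltonian_vector M P f p) = (\<lambda>_. 0)"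
  shows "poisson_bracket M P (h \<circ> \<phi>) f p = 0"
proof -
  have p: "p \<in> topspace (Top M)" by (rule M.smooth_fun_topspace[OF assms(1,2)])
  let ?W = "U \<inter> {p \<in> topspace (Top M). \<phi> p \<in> V}"
  have oW: "openin (Top M) ?W"
    by (rule openin_Int[OF M.smooth_fun_open[OF assms(1)] map_open_vimage[OF N.smooth_fun_open[OF assms(3)]]])
  have f: "smooth_fun M ?W f" by (rule M.smooth_fun_subset[OF assms(1) oW]) blast
  have h: "smooth_fun M ?W (h \<circ> \<phi>)" by (rule M.smooth_fun_subset[OF smooth_fun_pullback[OF assms(3)] oW]) blast
  have pW: "p \<in> ?W" using assms p by blast
  show ?thesis
    unfolding M.bracket_hamiltonian[OF h f pW]
      diff_fun_pullback[OF assms(3) p assms(4) M.hamiltonian_vector(1)[OF assms(1,2)]]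
    by (rule diff_map_zero_kills[OF N.diff_fun_cotangent[OF assms(3,4)] v])
qed

text \<open>The vanishing locus of \<open>X\<^bsub>h \<circ> \<phi>\<^esub>\<close> on a fibre is open and closed in every plaque.\<close>

lemma hamiltonian_vanishing_plaque:
  assumes h: "smooth_fun B V h" and "\<phi> p \<in> V" and c: "c \<in> D" and p: "p \<in> fst c" and q: "q \<in> fst c" "snd c p - snd c q \<in> S"
    and 0: "hamiltonian_vector M P (h \<circ> \<phi>) p = (\<lambda>_. 0)"
  shows "hamiltonian_vector M P (h \<circ> \<phi>) q = (\<lambda>_. 0)"
proof -
  let ?f = "h \<circ> \<phi>"
  let ?O = "{p \<in> topspace (Top M). \<phi> p \<in> V}"
  have cA: "c \<in> Atlas M" using c foliated_atlas(3) by blast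
  define w where "w = snd c q - snd c p"
  have wS: "w \<in> S" using subspace_neg[OF foliated_atlas(1) q(2)] by (simp add: w_def)
  \<comment> \<open>The segment from \<open>p\<close> at 0 to \<open>q\<close> at 1, which runs in a
    direction of \<open>S\<close>. The set \<open>J\<close> of parameters for which it stays in the
    chart image is convex because that image is, so it is connected.\<close>
  define g where "g t = snd c p + t *\<^sub>R w" for t :: real
  define J where "J = g -` (snd c ` fst c)"
  have chart: "chart_inv c (g t) \<in> fst c" "snd c (chart_inv c (g t)) = g t" if "t \<in> J" for t
  proof -
    have *: "g t \<in> snd c ` fst c" using that by (simp add: J_def)
    show "chart_inv c (g t) \<in> fst c" by (rule M.chart_inv_into[OF *])
    show "snd c (chart_inv c (g t)) = g t" by (rule M.chart_inv_right[OF *])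
  qed
  have fib: "\<phi> (chart_inv c (g t)) = \<phi> p" if "t \<in> J" for t
  proof (rule same_fibre[OF c chart(1)[OF that] p])
    show "snd c (chart_inv c (g t)) - snd c p \<in> S"
      unfolding chart(2)[OF that] by (simp add: g_def subspace_scale[OF foliated_atlas(1) wS])
  qed
  have top: "x \<in> topspace (Top M)" if "x \<in> fst c" for x using M.chart_domain_subset[OF cA] that by blast
  have "convex J"
  proof (rule convexI)
    fix s t u v :: real assume st: "s \<in> J" "t \<in> J" "0 \<le> u" "0 \<le> v" "u + v = 1"
    have "g (u *\<^sub>R s + v *\<^sub>R t) = (u + v) *\<^sub>R snd c p + (u * s + v * t) *\<^sub>R w" using st by (simp add: g_def)
    also have "\<dots> = u *\<^sub>R g s + v *\<^sub>R g t" by (simp add: g_def algebra_simps)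
    also have "\<dots> \<in> snd c ` fst c"
      using st by (intro convexD[OF foliated_atlas(5)[OF c]]) (auto simp: J_def)
    finally show "u *\<^sub>R s + v *\<^sub>R t \<in> J" by (simp add: J_def)
  qed
  then have conn: "connected J" by (rule convex_connected)
  \<comment> \<open>Vanishing is tested on the coordinate expression in the one chart
    \<open>c\<close>, where the differential equation is available.\<close>
  define Z where "Z t \<longleftrightarrow> M.chart_field c ?f (g t) = 0" for t
  have Z_iff: "Z t \<longleftrightarrow> hamiltonian_vector M P ?f (chart_inv c (g t)) = (\<lambda>_. 0)" if t: "t \<in> J" for t
  proof -
    let ?m = "chart_inv c (g t)"
    have m: "?m \<in> ?O" using fib[OF t] top[OF chart(1)[OF t]] assms(2) by simp
    have cm: "c \<in> charts_at M ?m" using cA chart(1)[OF t] by (simp add: M.charts_at_iff)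
    show ?thesis unfolding Z_def M.chart_field_def
      using M.tangent_eqI[OF M.hamiltonian_vector(1)[OF smooth_fun_pullback[OF h] m] M.tangent_zero cm] by auto
  qed
  \<comment> \<open>By connectedness of \<open>J\<close> it is enough that around every parameter
    there is a neighbourhood in which one zero forces all parameters to be zeros.\<close>
  have "Z 1"
  proof (rule connected_induction_simple[OF conn, where P=Z and a=0 and b=1])
    show "0 \<in> J" "1 \<in> J" using p q by (auto simp: J_def g_def w_def)
    then show "Z 0" using Z_iff[of 0] 0 M.chart_inv_left[OF cA p] by (simp add: g_def)
    fix t0 assume t0: "t0 \<in> J"
    let ?m = "chart_inv c (g t0)"
    obtain U f where frame: "frame_at U f" "?m \<in> U" by (rule frame_at_exists[OF top[OF chart(1)[OF t0]]])
    define W where "W = U \<inter> ?O \<inter> fst c"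
    have oW: "openin (Top M) W" unfolding W_def
      by (intro openin_Int frame_open[OF frame(1)] map_open_vimage N.smooth_fun_open[OF h] M.chart_domain_open[OF cA])
    have W: "W \<subseteq> fst c" "W \<subseteq> U" "W \<subseteq> ?O" unfolding W_def by blast+
    have mW: "?m \<in> W" using frame(2) fib[OF t0] top chart(1)[OF t0] assms(2) by (simp add: W_def)
    have fW: "smooth_fun M W ?f" by (rule M.smooth_fun_subset[OF smooth_fun_pullback[OF h] oW W(3)])
    have fiW: "smooth_fun M W (f i)" if "i < r" for i
      by (rule M.smooth_fun_subset[OF frame_smooth[OF frame(1) that] oW W(2)])
    have WW: "fst c \<inter> W = W" using W(1) by blast
    have open_img: "open (snd c ` W)" using M.open_chart_image[OF cA oW] unfolding WW .
    have field_W: "M.chart_field c k (snd c x) = hamiltonian_vector M P k x c" if "x \<in> W" for x k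
      using M.chart_inv_left[OF cA] that W(1) by (auto simp: M.chart_field_def)
    have cW: "c \<in> charts_at M x" if "x \<in> W" for x using cA that W(1) by (auto simp: M.charts_at_iff)
    \<comment> \<open>A pullback from \<open>B\<close> Poisson-commutes with the frame functions, as
      their Hamiltonian vectors are tangent to the fibres. Consequently the Hamiltonian fields
      commute too.\<close>
    have comm0: "poisson_bracket M P ?f (f i) x = 0" if "i < r" "x \<in> W" for i x
      by (rule bracket_vertical[OF fiW[OF that(1)] that(2) h])
        (use that W frame_vertical[OF frame(1) that(1), of x] in auto)
    obtain e where e: "e > 0" "\<And>s t. \<bar>s\<bar> < e \<Longrightarrow> \<bar>t\<bar> < e \<Longrightarrow>
        M.chart_field c ?f (snd c ?m + s *\<^sub>R w) = 0 \<Longrightarrow> M.chart_field c ?f (snd c ?m + t *\<^sub>R w) = 0"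
    proof (rule commuting_field_vanishing[where Y="M.chart_field c ?f" and v="\<lambda>i. M.chart_field c (f i)"
          and S="snd c ` W" and r=r and w=w and ?x0.0="snd c ?m"])
      show "open (snd c ` W)" by (rule open_img)
      show "smooth_on (M.chart_field c ?f) (snd c ` W)" by (rule M.chart_field_smooth[OF cA fW W(1)])
      show "smooth_on (M.chart_field c (f i)) (snd c ` W)" if "i < r" for i
        by (rule M.chart_field_smooth[OF cA fiW[OF that] W(1)])
      show "\<forall>i<r. a i = 0" if xi: "\<xi> \<in> snd c ` W" and s: "(\<Sum>i<r. a i *\<^sub>R M.chart_field c (f i) \<xi>) = 0" for \<xi> a
      proof -
        obtain x where x: "x \<in> W" "\<xi> = snd c x" using xi by blast
        have "(\<Sum>i<r. a i *\<^sub>R hamiltonian_vector M P (f i) x c) = 0"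
          using s unfolding x(2) field_W[OF x(1)] .
        then show ?thesis using frame_independent[OF frame(1) subsetD[OF W(2) x(1)] cW[OF x(1)]] by blast
      qed
      show "\<exists>a. w = (\<Sum>i<r. a i *\<^sub>R M.chart_field c (f i) \<xi>)" if xi: "\<xi> \<in> snd c ` W" for \<xi>
      proof -
        obtain x where x: "x \<in> W" "\<xi> = snd c x" using xi by blast
        show ?thesis unfolding x(2) field_W[OF x(1)]
          by (rule frame_chart_span[OF frame(1) subsetD[OF W(2) x(1)] c cW[OF x(1)] wS])
      qed
      show "frechet_derivative (M.chart_field c ?f) (at \<xi>) (M.chart_field c (f i) \<xi>) =
          frechet_derivative (M.chart_field c (f i)) (at \<xi>) (M.chart_field c ?f \<xi>)"
        if xi: "\<xi> \<in> snd c ` W" and i: "i < r" for \<xi> i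
      proof -
        obtain x where x: "x \<in> W" "\<xi> = snd c x" using xi by blast
        show ?thesis unfolding x(2)
          by (rule M.chart_fields_commute[OF cA fW fiW[OF i] W(1) x(1) comm0[OF i]])
      qed
      show "snd c ?m \<in> snd c ` W" using mW by blast
    qed (rule that)
    \<comment> \<open>The direction \<open>w\<close> of the segment lies in \<open>S\<close>, so the
      commuting fields give such a neighbourhood of radius \<open>e\<close>; parameters are shifted
      by \<open>t0\<close>.\<close>
    show "\<exists>T. openin (top_of_set J) T \<and> t0 \<in> T \<and> (\<forall>x\<in>T. \<forall>y\<in>T. Z x \<longrightarrow> Z y)"
    proof (intro exI conjI ballI impI)
      show "openin (top_of_set J) (J \<inter> ball t0 e)" by (rule openin_open_Int[OF open_ball])
      show "t0 \<in> J \<inter> ball t0 e" using t0 e by simp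
      fix s t assume st: "s \<in> J \<inter> ball t0 e" "t \<in> J \<inter> ball t0 e" "Z s"
      have "g s = snd c ?m + (s - t0) *\<^sub>R w" for s
        unfolding chart(2)[OF t0] by (simp add: g_def algebra_simps)
      then have Z_eq: "Z s \<longleftrightarrow> M.chart_field c ?f (snd c ?m + (s - t0) *\<^sub>R w) = 0" for s
        unfolding Z_def by metis
      have "\<bar>s - t0\<bar> < e" "\<bar>t - t0\<bar> < e" using st by (auto simp: dist_real_def)
      then show "Z t" using e(2) st(3) unfolding Z_eq by blast
    qed
  qed
  moreover have "1 \<in> J" using q by (simp add: J_def g_def w_def)
  ultimately show ?thesis using Z_iff[of 1] M.chart_inv_left[OF cA q(1)] by (simp add: g_def w_def)
qed

text \<open>A fibre is a leaf, hence its points are joined by chains of plaques. The induction also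
  carries that \<phi> stays in \<open>V\<close>, which the passage along the next plaque
  requires.\<close>

lemma hamiltonian_vanishing_fibre:
  assumes h: "smooth_fun B V h" and V: "\<phi> p \<in> V" and p: "p \<in> topspace (Top M)" and q: "q \<in> topspace (Top M)" "\<phi> p = \<phi> q"
    and 0: "hamiltonian_vector M P (h \<circ> \<phi>) p = (\<lambda>_. 0)"
  shows "hamiltonian_vector M P (h \<circ> \<phi>) q = (\<lambda>_. 0)"
proof -
  have "(same_plaque S D)\<^sup>*\<^sup>* p q" using fibres[OF p q(1)] q(2) unfolding same_leaf_def by blast
  then have "hamiltonian_vector M P (h \<circ> \<phi>) q = (\<lambda>_. 0) \<and> \<phi> q \<in> V"
  proof (induction rule: rtranclp_induct)
    case base
    then show ?case using 0 V by blast
  next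
    case (step y z)
    obtain c where c: "c \<in> D" "y \<in> fst c" "z \<in> fst c" "snd c y - snd c z \<in> S"
      using step(2) unfolding same_plaque_def by blast
    have "\<phi> y = \<phi> z" by (rule same_fibre[OF c])
    moreover have "hamiltonian_vector M P (h \<circ> \<phi>) z = (\<lambda>_. 0)"
      by (rule hamiltonian_vanishing_plaque[OF h _ c]) (use step(3) in blast)+
    ultimately show ?case using step(3) by metis
  qed
  then show ?thesis by blast
qed

section \<open>The two kernels, fibre by fibre\<close>

definition ker_base :: "'b \<Rightarrow> ('b, 'y) cotangent set" where
  "ker_base b = {\<xi> \<in> cotangent_space B b. sharp B Q b \<xi> = (\<lambda>_. 0)}"

text \<open>A covector at \<open>b\<close> has a separate pullback at every point over
  \<open>b\<close>; the kernel sheaf demands that all of them are annihilated.\<close>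

definition ker_pullback :: "'b \<Rightarrow> ('b, 'y) cotangent set" where
  "ker_pullback b = {\<xi> \<in> cotangent_space B b. \<forall>p\<in>topspace (Top M). \<phi> p = b \<longrightarrow>
     sharp M P p (pullback M B \<phi> p \<xi>) = (\<lambda>_. 0)}"

definition image_vector :: "'m \<Rightarrow> ('m, 'x) cotangent \<Rightarrow> ('b, 'y) tangent" where
  "image_vector p \<beta> = diff_map M B \<phi> p (sharp M P p \<beta>)"

lemma image_vector_tangent:
  "p \<in> topspace (Top M) \<Longrightarrow> \<beta> \<in> cotangent_space M p \<Longrightarrow> image_vector p \<beta> \<in> tangent_space B (\<phi> p)"
  unfolding image_vector_def by (rule diff_map_tangent[OF M.sharp(1)])

text \<open>The kernel of \<open>\<Pi>\<^sup>\<sharp> \<circ> \<phi>\<^sup>*\<close> is the annihilator of the vectors \<open>d\<phi>(\<Pi>\<^sup>\<sharp> \<beta>)\<close>.\<close>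

lemma bivector_pullback:
  assumes p: "p \<in> topspace (Top M)" and \<xi>: "\<xi> \<in> cotangent_space B (\<phi> p)" and \<beta>: "\<beta> \<in> cotangent_space M p"
  shows "P p (pullback M B \<phi> p \<xi>) \<beta> = - \<xi> (image_vector p \<beta>)"
proof -
  have c: "pullback M B \<phi> p \<xi> \<in> cotangent_space M p" by (rule pullback_cotangent[OF \<xi> p])
  have "P p (pullback M B \<phi> p \<xi>) \<beta> = - P p \<beta> (pullback M B \<phi> p \<xi>)" by (rule M.bivector_antisym[OF p c \<beta>])
  also have "P p \<beta> (pullback M B \<phi> p \<xi>) = pullback M B \<phi> p \<xi> (sharp M P p \<beta>)" by (rule M.sharp(2)[OF p \<beta> c, symmetric])
  also have "\<dots> = \<xi> (image_vector p \<beta>)" using M.sharp(1)[OF p \<beta>] by (simp add: pullback_def image_vector_def)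
  finally show ?thesis .
qed

lemma sharp_pullback_zero_iff:
  assumes p: "p \<in> topspace (Top M)" and \<xi>: "\<xi> \<in> cotangent_space B (\<phi> p)"
  shows "sharp M P p (pullback M B \<phi> p \<xi>) = (\<lambda>_. 0) \<longleftrightarrow> (\<forall>\<beta>\<in>cotangent_space M p. \<xi> (image_vector p \<beta>) = 0)"
  unfolding M.sharp_zero_iff[OF p pullback_cotangent[OF \<xi> p]] using bivector_pullback[OF p \<xi>] by simp

text \<open>The pullback of \<open>dh\<close> is \<open>d(h \<circ> \<phi>)\<close>, which the sharp
  map sends to minus the Hamiltonian vector of \<open>h \<circ> \<phi>\<close>.\<close>

lemma sharp_pullback_zero_iff_hamiltonian:
  assumes p: "p \<in> topspace (Top M)" and h: "smooth_fun B V h" "\<phi> p \<in> V"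
  shows "sharp M P p (pullback M B \<phi> p (diff_fun B h (\<phi> p))) = (\<lambda>_. 0) \<longleftrightarrow> hamiltonian_vector M P (h \<circ> \<phi>) p = (\<lambda>_. 0)"
proof -
  let ?X = "hamiltonian_vector M P (h \<circ> \<phi>) p"
  let ?\<alpha> = "diff_fun M (h \<circ> \<phi>) p"
  have pU: "p \<in> {p \<in> topspace (Top M). \<phi> p \<in> V}" using p h by blast
  have sm: "smooth_fun M {p \<in> topspace (Top M). \<phi> p \<in> V} (h \<circ> \<phi>)" by (rule smooth_fun_pullback[OF h(1)])
  have \<alpha>: "?\<alpha> \<in> cotangent_space M p" by (rule M.diff_fun_cotangent[OF sm pU])
  have eq: "P p ?\<alpha> \<beta> = - \<beta> ?X" if "\<beta> \<in> cotangent_space M p" for \<beta>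
    using M.hamiltonian_vector(2)[OF sm pU that] M.bivector_antisym[OF p \<alpha> that] by simp
  have "(\<forall>\<beta>\<in>cotangent_space M p. \<beta> ?X = 0) \<longleftrightarrow> ?X = (\<lambda>_. 0)"
  proof
    assume "\<forall>\<beta>\<in>cotangent_space M p. \<beta> ?X = 0"
    then show "?X = (\<lambda>_. 0)"
      by (intro M.tangent_eq_of_cotangent[OF p M.hamiltonian_vector(1)[OF sm pU] M.tangent_zero]) (simp add: M.cotangent_zero)
  next
    assume X: "?X = (\<lambda>_. 0)"
    show "\<forall>\<beta>\<in>cotangent_space M p. \<beta> ?X = 0" unfolding X using M.cotangent_zero by blast
  qed
  then show ?thesis
    unfolding pullback_differential[OF h(1) p h(2)] M.sharp_zero_iff[OF p \<alpha>] using eq by simp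
qed

text \<open>Reduces a condition on an entire fibre to a single point, which can be taken in the
  domain of a frame. The reason is the transport along leaves, applied to a function with
  differential \<xi> at the point.\<close>

lemma ker_pullback_of_point:
  assumes p: "p \<in> topspace (Top M)" and \<xi>: "\<xi> \<in> cotangent_space B (\<phi> p)"
    and 0: "sharp M P p (pullback M B \<phi> p \<xi>) = (\<lambda>_. 0)"
  shows "\<xi> \<in> ker_pullback (\<phi> p)"
proof -
  obtain V h where h: "smooth_fun B V h" "\<phi> p \<in> V" "diff_fun B h (\<phi> p) = \<xi>"
    by (rule N.cotangent_is_differential[OF \<xi> map_topspace[OF p]])
  have 1: "hamiltonian_vector M P (h \<circ> \<phi>) p = (\<lambda>_. 0)"
    using sharp_pullback_zero_iff_hamiltonian[OF p h(1,2)] 0 h(3) by simp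
  have "sharp M P q (pullback M B \<phi> q \<xi>) = (\<lambda>_. 0)" if q: "q \<in> topspace (Top M)" "\<phi> q = \<phi> p" for q
  proof -
    have "hamiltonian_vector M P (h \<circ> \<phi>) q = (\<lambda>_. 0)"
      by (rule hamiltonian_vanishing_fibre[OF h(1,2) p q(1) q(2)[symmetric] 1])
    moreover have "\<phi> q \<in> V" using q(2) h(2) by simp
    ultimately have "sharp M P q (pullback M B \<phi> q (diff_fun B h (\<phi> q))) = (\<lambda>_. 0)"
      using sharp_pullback_zero_iff_hamiltonian[OF q(1) h(1)] by blast
    then show ?thesis unfolding q(2) h(3) .
  qed
  then show ?thesis unfolding ker_pullback_def using \<xi> by blast
qed

lemma ker_pullback_iff:
  "\<xi> \<in> ker_pullback b \<longleftrightarrow> \<xi> \<in> cotangent_space B b \<and>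
    (\<forall>p\<in>topspace (Top M). \<phi> p = b \<longrightarrow> (\<forall>\<beta>\<in>cotangent_space M p. \<xi> (image_vector p \<beta>) = 0))"
  unfolding ker_pullback_def using sharp_pullback_zero_iff by blast

lemma ker_pullback_lincomb:
  assumes "\<xi> \<in> ker_pullback b" "\<eta> \<in> ker_pullback b"
  shows "(\<lambda>X\<in>tangent_space B b. a * \<xi> X + a' * \<eta> X) \<in> ker_pullback b"
proof -
  have c: "\<xi> \<in> cotangent_space B b" "\<eta> \<in> cotangent_space B b" using assms unfolding ker_pullback_def by blast+
  have "(\<lambda>X\<in>tangent_space B b. a * \<xi> X + a' * \<eta> X) (image_vector p \<beta>) = 0"
    if p: "p \<in> topspace (Top M)" "\<phi> p = b" and \<beta>: "\<beta> \<in> cotangent_space M p" for p \<beta>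
  proof -
    have "image_vector p \<beta> \<in> tangent_space B b" using image_vector_tangent[OF p(1) \<beta>] unfolding p(2) .
    moreover have "\<xi> (image_vector p \<beta>) = 0" "\<eta> (image_vector p \<beta>) = 0"
      using assms p \<beta> unfolding ker_pullback_iff by blast+
    ultimately show ?thesis by simp
  qed
  then show ?thesis unfolding ker_pullback_iff using N.cotangent_lincomb[OF c] by blast
qed

lemma ker_base_iff:
  "b \<in> topspace (Top B) \<Longrightarrow> \<xi> \<in> ker_base b \<longleftrightarrow> \<xi> \<in> cotangent_space B b \<and> (\<forall>\<eta>\<in>cotangent_space B b. Q b \<xi> \<eta> = 0)"
  unfolding ker_base_def using N.sharp_zero_iff by blast

lemma ker_base_lincomb:
  assumes b: "b \<in> topspace (Top B)" and "\<xi> \<in> ker_base b" "\<eta> \<in> ker_base b"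
  shows "(\<lambda>X\<in>tangent_space B b. a * \<xi> X + a' * \<eta> X) \<in> ker_base b"
proof -
  have c: "\<xi> \<in> cotangent_space B b" "\<eta> \<in> cotangent_space B b"
    "\<And>\<zeta>. \<zeta> \<in> cotangent_space B b \<Longrightarrow> Q b \<xi> \<zeta> = 0" "\<And>\<zeta>. \<zeta> \<in> cotangent_space B b \<Longrightarrow> Q b \<eta> \<zeta> = 0"
    using assms unfolding ker_base_iff[OF b] by blast+
  show ?thesis unfolding ker_base_iff[OF b]
    using N.cotangent_lincomb[OF c(1,2)] N.bivector_linear1[OF b c(1,2)] c(3,4) by simp
qed

text \<open>Poisson maps are defined through brackets of functions; representing both covectors by
  differentials on a common domain gives the pointwise identity.\<close>

lemma bivector_pullback_pullback:
  assumes p: "p \<in> topspace (Top M)" and "\<xi> \<in> cotangent_space B (\<phi> p)" "\<eta> \<in> cotangent_space B (\<phi> p)"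
  shows "P p (pullback M B \<phi> p \<xi>) (pullback M B \<phi> p \<eta>) = Q (\<phi> p) \<xi> \<eta>"
proof -
  obtain V h where h: "smooth_fun B V h" "\<phi> p \<in> V" "diff_fun B h (\<phi> p) = \<xi>"
    by (rule N.cotangent_is_differential[OF assms(2) map_topspace[OF p]])
  obtain W k where k: "smooth_fun B W k" "\<phi> p \<in> W" "diff_fun B k (\<phi> p) = \<eta>"
    by (rule N.cotangent_is_differential[OF assms(3) map_topspace[OF p]])
  have o: "openin (Top B) (V \<inter> W)" by (rule openin_Int[OF N.smooth_fun_open[OF h(1)] N.smooth_fun_open[OF k(1)]])
  have hk: "smooth_fun B (V \<inter> W) h" "smooth_fun B (V \<inter> W) k"
    by (rule N.smooth_fun_subset[OF h(1) o], blast, rule N.smooth_fun_subset[OF k(1) o], blast)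
  have "poisson_bracket M P (h \<circ> \<phi>) (k \<circ> \<phi>) p = poisson_bracket B Q h k (\<phi> p)"
    using poisson_map hk p h(2) k(2) unfolding poisson_map_def by blast
  then show ?thesis
    unfolding poisson_bracket_def pullback_differential[OF h(1) p h(2), symmetric]
      pullback_differential[OF k(1) p k(2), symmetric] h(3) k(3) .
qed

text \<open>The Euclidean section of a chart representation, transported to the manifolds. The last
  clause is the form in which its smoothness is used: functions on \<open>M\<close> restrict along
  the section to smooth functions on \<open>B\<close>.\<close>

lemma local_section:
  assumes U: "openin (Top M) U" and p: "p \<in> U"
  obtains V s where "openin (Top B) V" "\<phi> p \<in> V" "\<And>b. b \<in> V \<Longrightarrow> s b \<in> U" "\<And>b. b \<in> V \<Longrightarrow> \<phi> (s b) = b"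
    "\<And>f. smooth_fun M U f \<Longrightarrow> smooth_fun B V (f \<circ> s)"
proof -
  have pt: "p \<in> topspace (Top M)" using openin_subset[OF U] p by blast
  obtain c where c: "c \<in> charts_at M p" using M.charts_at_nonempty[OF pt] by blast
  obtain d where d: "d \<in> charts_at B (\<phi> p)" using N.charts_at_nonempty[OF map_topspace[OF pt]] by blast
  have A: "c \<in> Atlas M" "p \<in> fst c" "d \<in> Atlas B" "\<phi> p \<in> fst d" using c d by (auto simp: M.charts_at_iff N.charts_at_iff)
  let ?f = "snd d \<circ> \<phi> \<circ> chart_inv c"
  define W where "W = {p \<in> fst c. \<phi> p \<in> fst d} \<inter> U"
  have oW: "openin (Top M) W" unfolding W_def by (rule openin_Int[OF local_rep_domain(1)[OF A(1,3)] U])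
  have WW: "fst c \<inter> W = W" by (auto simp: W_def)
  have o: "open (snd c ` W)" using M.open_chart_image[OF A(1) oW] unfolding WW .
  have sm: "smooth_on ?f (snd c ` W)" by (rule smooth_on_subset[OF local_rep_smooth[OF A(1,3)]]) (auto simp: W_def)
  have pW: "snd c p \<in> snd c ` W" using A p by (auto simp: W_def)
  obtain V0 s0 where s0: "open V0" "?f (snd c p) \<in> V0" "smooth_on s0 V0" "s0 ` V0 \<subseteq> snd c ` W" "s0 (?f (snd c p)) = snd c p"
    "\<And>y. y \<in> V0 \<Longrightarrow> ?f (s0 y) = y"
    using smooth_local_section[OF o sm pW local_rep_derivative_surj[OF c d]] by metis
  define V where "V = {b \<in> fst d. snd d b \<in> V0}"
  define s where "s b = chart_inv c (s0 (snd d b))" for b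
  have sW: "s b \<in> W" "snd c (s b) = s0 (snd d b)" if b: "b \<in> V" for b
  proof -
    have "s0 (snd d b) \<in> snd c ` W" using s0(4) b by (auto simp: V_def)
    then obtain q where q: "q \<in> W" "s0 (snd d b) = snd c q" by blast
    moreover have "q \<in> fst c" using q by (simp add: W_def)
    ultimately show "s b \<in> W" "snd c (s b) = s0 (snd d b)" using M.chart_inv_left[OF A(1)] by (simp_all add: s_def)
  qed
  show ?thesis
  proof (rule that[of V s])
    show "openin (Top B) V" unfolding V_def by (rule N.open_chart_vimage[OF A(3) s0(1)])
    show "\<phi> p \<in> V" using s0(2) A M.chart_inv_left[OF A(1,2)] by (simp add: V_def)
    show "s b \<in> U" if "b \<in> V" for b using sW(1)[OF that] by (simp add: W_def)
    show "\<phi> (s b) = b" if b: "b \<in> V" for b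
    proof -
      have bd: "b \<in> fst d" "snd d b \<in> V0" using b by (auto simp: V_def)
      have sb: "s b \<in> fst c" "\<phi> (s b) \<in> fst d" using sW(1)[OF b] by (auto simp: W_def)
      have "snd d (\<phi> (s b)) = ?f (snd c (s b))" using M.chart_inv_left[OF A(1) sb(1)] by simp
      also have "\<dots> = snd d b" unfolding sW(2)[OF b] by (rule s0(6)[OF bd(2)])
      finally show ?thesis using inj_onD[OF N.chart_inj[OF A(3)]] sb(2) bd(1) by blast
    qed
    fix f assume f: "smooth_fun M U f"
    have "smooth_on (\<lambda>y. (f \<circ> chart_inv c) (s0 y)) V0"
    proof (rule smooth_on_compose[OF s0(3) _ s0(1) s0(4)])
      show "smooth_on (f \<circ> chart_inv c) (snd c ` W)"
        by (rule smooth_on_subset[OF M.smooth_fun_chart[OF f A(1)]]) (auto simp: W_def)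
    qed
    from N.smooth_fun_of_chart[OF A(3) s0(1) this]
    show "smooth_fun B V (f \<circ> s)" unfolding V_def[symmetric] by (simp add: s_def comp_def)
  qed
qed

section \<open>Forms on the base induced by a frame\<close>

context
  fixes U f assumes frame: "frame_at U f"
begin

text \<open>For \<open>i < r\<close> and \<open>b\<close> in the image of \<open>U\<close> the
  chosen preimage is immaterial, since \<open>f i\<close> is constant on the part of a fibre inside
  \<open>U\<close>.\<close>

definition base_function :: "nat \<Rightarrow> 'b \<Rightarrow> real" where
  "base_function i b = f i (SOME p. p \<in> U \<and> \<phi> p = b)"

lemma base_function_apply:
  assumes "i < r" "p \<in> U" shows "base_function i (\<phi> p) = f i p"
proof -
  have "(SOME q. q \<in> U \<and> \<phi> q = \<phi> p) \<in> U \<and> \<phi> (SOME q. q \<in> U \<and> \<phi> q = \<phi> p) = \<phi> p"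
    by (rule someI[of _ p]) (simp add: assms)
  then show ?thesis unfolding base_function_def using frame_fibre[OF frame assms(1) _ assms(2)] by blast
qed

lemma base_open: "openin (Top B) (\<phi> ` U)"
proof (subst openin_subopen, intro ballI)
  fix b assume "b \<in> \<phi> ` U"
  then obtain p where p: "p \<in> U" "b = \<phi> p" by blast
  obtain V s where V: "openin (Top B) V" "\<phi> p \<in> V" "\<And>b. b \<in> V \<Longrightarrow> s b \<in> U" "\<And>b. b \<in> V \<Longrightarrow> \<phi> (s b) = b"
    using local_section[OF frame_open[OF frame] p(1)] by metis
  have "V \<subseteq> \<phi> ` U" using V(3,4) by (metis image_eqI subsetI)
  then show "\<exists>T. openin (Top B) T \<and> b \<in> T \<and> T \<subseteq> \<phi> ` U" using V(1,2) p(2) by blast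
qed

text \<open>Near each point it coincides with \<open>f i \<circ> s\<close> for a local section
  \<open>s\<close>.\<close>

lemma base_function_smooth:
  assumes i: "i < r" shows "smooth_fun B (\<phi> ` U) (base_function i)"
proof (rule N.smooth_fun_local)
  fix b assume "b \<in> \<phi> ` U"
  then obtain p where p: "p \<in> U" "b = \<phi> p" by blast
  obtain V s where V: "openin (Top B) V" "\<phi> p \<in> V" "\<And>b. b \<in> V \<Longrightarrow> s b \<in> U" "\<And>b. b \<in> V \<Longrightarrow> \<phi> (s b) = b"
    "\<And>f. smooth_fun M U f \<Longrightarrow> smooth_fun B V (f \<circ> s)"
    using local_section[OF frame_open[OF frame] p(1)] by metis
  have sub: "V \<subseteq> \<phi> ` U" using V(3,4) by (metis image_eqI subsetI)
  have "smooth_fun B V (base_function i)"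
  proof (rule N.smooth_fun_cong[OF V(5)[OF frame_smooth[OF frame i]]])
    fix b assume b: "b \<in> V"
    show "(f i \<circ> s) b = base_function i b"
      using base_function_apply[OF i V(3)[OF b]] V(4)[OF b] by simp
  qed
  then show "\<exists>W. b \<in> W \<and> W \<subseteq> \<phi> ` U \<and> smooth_fun B W (base_function i)" using sub V(2) p(2) by blast
qed

lemma base_topspace: "b \<in> \<phi> ` U \<Longrightarrow> b \<in> topspace (Top B)"
  using openin_subset[OF base_open] by blast

definition base_form :: "nat \<Rightarrow> 'b \<Rightarrow> ('b, 'y) cotangent" where
  "base_form i = restrict (diff_fun B (base_function i)) (\<phi> ` U)"

lemma base_form_one_form: "i < r \<Longrightarrow> base_form i \<in> one_forms B (\<phi> ` U)"
  unfolding base_form_def by (rule N.diff_fun_one_form[OF base_function_smooth])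

lemma base_form_cotangent: "i < r \<Longrightarrow> b \<in> \<phi> ` U \<Longrightarrow> base_form i b \<in> cotangent_space B b"
  using N.diff_fun_cotangent[OF base_function_smooth] by (simp add: base_form_def)

lemma pullback_base_form:
  assumes i: "i < r" and p: "p \<in> U"
  shows "pullback M B \<phi> p (base_form i (\<phi> p)) = diff_fun M (f i) p"
proof -
  have "pullback M B \<phi> p (base_form i (\<phi> p)) = diff_fun M (base_function i \<circ> \<phi>) p"
    using pullback_differential[OF base_function_smooth[OF i] frame_topspace[OF frame p] imageI[OF p]] p
    by (simp add: base_form_def)
  also have "\<dots> = diff_fun M (f i) p"
    by (rule M.diff_fun_cong[OF frame_smooth[OF frame i] p, symmetric]) (simp add: base_function_apply[OF i])
  finally show ?thesis .
qed

text \<open>The bridge between base and total space: on the vectors cutting out the smaller kernel,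
  the base forms become the Hamiltonian vectors of the frame, whose independence is known.\<close>

lemma base_form_image_vector:
  assumes i: "i < r" and p: "p \<in> U" and \<beta>: "\<beta> \<in> cotangent_space M p"
  shows "base_form i (\<phi> p) (image_vector p \<beta>) = \<beta> (hamiltonian_vector M P (f i) p)"
proof -
  have pt: "p \<in> topspace (Top M)" by (rule frame_topspace[OF frame p])
  have "base_form i (\<phi> p) (image_vector p \<beta>) = - P p (diff_fun M (f i) p) \<beta>"
    using bivector_pullback[OF pt base_form_cotangent[OF i imageI[OF p]] \<beta>] pullback_base_form[OF i p] by simp
  also have "\<dots> = P p \<beta> (diff_fun M (f i) p)"
    using M.bivector_antisym[OF pt \<beta> M.diff_fun_cotangent[OF frame_smooth[OF frame i] p]] by simp
  also have "\<dots> = \<beta> (hamiltonian_vector M P (f i) p)"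
    by (rule M.hamiltonian_vector(2)[OF frame_smooth[OF frame i] p \<beta>, symmetric])
  finally show ?thesis .
qed

lemma base_form_ker_base:
  assumes i: "i < r" and b: "b \<in> \<phi> ` U"
  shows "base_form i b \<in> ker_base b"
  unfolding ker_base_iff[OF base_topspace[OF b]]
proof (intro conjI ballI)
  show c: "base_form i b \<in> cotangent_space B b" by (rule base_form_cotangent[OF i b])
  fix \<eta> assume \<eta>: "\<eta> \<in> cotangent_space B b"
  obtain p where p: "p \<in> U" "b = \<phi> p" using b by blast
  have pt: "p \<in> topspace (Top M)" by (rule frame_topspace[OF frame p(1)])
  let ?\<beta> = "pullback M B \<phi> p \<eta>"
  let ?X = "hamiltonian_vector M P (f i) p"
  have \<beta>: "?\<beta> \<in> cotangent_space M p" using pullback_cotangent[OF _ pt] \<eta> p(2) by simp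
  have "Q b (base_form i b) \<eta> = P p (pullback M B \<phi> p (base_form i (\<phi> p))) ?\<beta>"
    using bivector_pullback_pullback[OF pt] c \<eta> p(2) by simp
  also have "\<dots> = - base_form i (\<phi> p) (image_vector p ?\<beta>)"
    by (rule bivector_pullback[OF pt base_form_cotangent[OF i imageI[OF p(1)]] \<beta>])
  also have "\<dots> = - ?\<beta> ?X" unfolding base_form_image_vector[OF i p(1) \<beta>] ..
  also have "?\<beta> ?X = \<eta> (diff_map M B \<phi> p ?X)"
    using frame_tangent[OF frame i p(1)] by (simp add: pullback_def)
  also have "\<dots> = 0"
    by (rule diff_map_zero_kills[OF _ frame_vertical[OF frame i p(1)]]) (use \<eta> p(2) in simp)
  finally show "Q b (base_form i b) \<eta> = 0" by simp
qed

text \<open>When this lies in the smaller kernel, \<open>x\<close> is the coordinate tuple of the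
  class of \<xi> in the quotient.\<close>

definition residue :: "'b \<Rightarrow> ('b, 'y) cotangent \<Rightarrow> (nat \<Rightarrow> real) \<Rightarrow> ('b, 'y) cotangent" where
  "residue b \<xi> x = (\<lambda>X\<in>tangent_space B b. \<xi> X - (\<Sum>i<r. x i * base_form i b X))"

lemma residue_cotangent:
  "b \<in> \<phi> ` U \<Longrightarrow> \<xi> \<in> cotangent_space B b \<Longrightarrow> residue b \<xi> x \<in> cotangent_space B b"
  unfolding residue_def by (rule N.lincomb_difference_closed[OF N.cotangent_lincomb]) (auto intro: base_form_cotangent)

lemma residue_image_vector:
  assumes p: "p \<in> U" and \<xi>: "\<xi> \<in> cotangent_space B (\<phi> p)" and \<beta>: "\<beta> \<in> cotangent_space M p"
  shows "residue (\<phi> p) \<xi> x (image_vector p \<beta>) =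
    \<xi> (image_vector p \<beta>) - \<beta> (\<lambda>c. \<Sum>i<r. x i *\<^sub>R hamiltonian_vector M P (f i) p c)"
proof -
  have "\<beta> (\<lambda>c. \<Sum>i<r. x i *\<^sub>R hamiltonian_vector M P (f i) p c) = (\<Sum>i<r. x i * \<beta> (hamiltonian_vector M P (f i) p))"
    by (rule M.cotangent_sum[OF \<beta>]) (use frame_tangent[OF frame _ p] in simp)
  then show ?thesis
    using image_vector_tangent[OF frame_topspace[OF frame p] \<beta>]
    by (simp add: residue_def base_form_image_vector[OF _ p \<beta>])
qed

text \<open>Pairing the image under d\<phi> of \<open>?Y\<close> with \<eta> gives
  \<open>Q (\<phi> p) \<xi> \<eta> = 0\<close>, so \<open>?Y\<close> is tangent to the leaf and
  expands in the frame. This settles the matter at one point of the fibre, which is enough.\<close>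

lemma residue_exists:
  assumes b: "b \<in> \<phi> ` U" and \<xi>: "\<xi> \<in> ker_base b"
  shows "\<exists>x. residue b \<xi> x \<in> ker_pullback b"
proof -
  obtain p where p: "p \<in> U" "b = \<phi> p" using b by blast
  have pt: "p \<in> topspace (Top M)" by (rule frame_topspace[OF frame p(1)])
  have \<xi>c: "\<xi> \<in> cotangent_space B (\<phi> p)" and "\<forall>\<eta>\<in>cotangent_space B (\<phi> p). Q (\<phi> p) \<xi> \<eta> = 0"
    using \<xi> ker_base_iff[OF base_topspace[OF b]] unfolding p(2) by blast+
  then have \<xi>0: "Q (\<phi> p) \<xi> \<eta> = 0" if "\<eta> \<in> cotangent_space B (\<phi> p)" for \<eta> using that by blast
  have pc: "pullback M B \<phi> p \<xi> \<in> cotangent_space M p" by (rule pullback_cotangent[OF \<xi>c pt])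
  let ?Y = "sharp M P p (pullback M B \<phi> p \<xi>)"
  have Y: "?Y \<in> tangent_space M p" by (rule M.sharp(1)[OF pt pc])
  have "diff_map M B \<phi> p ?Y = (\<lambda>_. 0)"
  proof (rule N.tangent_eq_of_cotangent[OF map_topspace[OF pt] diff_map_tangent[OF Y pt] N.tangent_zero])
    fix \<eta> assume \<eta>: "\<eta> \<in> cotangent_space B (\<phi> p)"
    have "\<eta> (diff_map M B \<phi> p ?Y) = pullback M B \<phi> p \<eta> ?Y" using Y by (simp add: pullback_def)
    also have "\<dots> = P p (pullback M B \<phi> p \<xi>) (pullback M B \<phi> p \<eta>)" by (rule M.sharp(2)[OF pt pc pullback_cotangent[OF \<eta> pt]])
    also have "\<dots> = 0" using bivector_pullback_pullback[OF pt \<xi>c \<eta>] \<xi>0[OF \<eta>] by simp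
    finally show "\<eta> (diff_map M B \<phi> p ?Y) = \<eta> (\<lambda>_. 0)" using N.cotangent_zero[OF \<eta>] by simp
  qed
  then have "?Y \<in> leaf_tangent_space M S D p" using leaf_tangent_iff[OF pt] Y by blast
  then obtain a where a: "?Y = (\<lambda>c. \<Sum>i<r. a i *\<^sub>R hamiltonian_vector M P (f i) p c)"
    using frame_span[OF frame p(1)] by blast
  \<comment> \<open>The signs are reversed because the sharp map sends \<open>df\<close> to minus
    the Hamiltonian vector of \<open>f\<close>.\<close>
  have neg: "(\<lambda>c. \<Sum>i<r. (- a i) *\<^sub>R hamiltonian_vector M P (f i) p c) = (\<lambda>c. (-1) *\<^sub>R ?Y c)"
    unfolding a by (simp add: scaleR_minus_left sum_negf)
  have "residue (\<phi> p) \<xi> (\<lambda>i. - a i) (image_vector p \<beta>) = 0" if \<beta>: "\<beta> \<in> cotangent_space M p" for \<beta>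
  proof -
    have "\<xi> (image_vector p \<beta>) = - \<beta> ?Y"
      using bivector_pullback[OF pt \<xi>c \<beta>] M.sharp(2)[OF pt pc \<beta>] by simp
    then show ?thesis
      unfolding residue_image_vector[OF p(1) \<xi>c \<beta>] neg M.cotangent_scale[OF \<beta> Y] by simp
  qed
  then have "sharp M P p (pullback M B \<phi> p (residue (\<phi> p) \<xi> (\<lambda>i. - a i))) = (\<lambda>_. 0)"
    using sharp_pullback_zero_iff[OF pt residue_cotangent[OF imageI[OF p(1)] \<xi>c]] by blast
  then have "residue b \<xi> (\<lambda>i. - a i) \<in> ker_pullback b"
    unfolding p(2) by (rule ker_pullback_of_point[OF pt residue_cotangent[OF imageI[OF p(1)] \<xi>c]])
  then show ?thesis by blast
qed

text \<open>Both residues vanish on all image vectors, so every \<beta> takes the same value on the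
  two combinations of Hamiltonian vectors. These are therefore equal, and the frame is
  independent.\<close>

lemma residue_unique:
  assumes b: "b \<in> \<phi> ` U" and \<xi>: "\<xi> \<in> cotangent_space B b"
    and x: "residue b \<xi> x \<in> ker_pullback b" and y: "residue b \<xi> y \<in> ker_pullback b" and i: "i < r"
  shows "x i = y i"
proof -
  obtain p where p: "p \<in> U" "b = \<phi> p" using b by blast
  have pt: "p \<in> topspace (Top M)" by (rule frame_topspace[OF frame p(1)])
  have \<xi>c: "\<xi> \<in> cotangent_space B (\<phi> p)" using \<xi> p(2) by simp
  let ?X = "\<lambda>x c. \<Sum>i<r. x i *\<^sub>R hamiltonian_vector M P (f i) p c"
  have X: "?X x \<in> tangent_space M p" for x by (rule M.tangent_sum) (use frame_tangent[OF frame _ p(1)] in simp)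
  have "?X x = ?X y"
  proof (rule M.tangent_eq_of_cotangent[OF pt X X])
    fix \<beta> assume \<beta>: "\<beta> \<in> cotangent_space M p"
    have "residue (\<phi> p) \<xi> x (image_vector p \<beta>) = 0" "residue (\<phi> p) \<xi> y (image_vector p \<beta>) = 0"
      using x y pt p(2) \<beta> unfolding ker_pullback_iff by blast+
    then show "\<beta> (?X x) = \<beta> (?X y)" unfolding residue_image_vector[OF p(1) \<xi>c \<beta>] by simp
  qed
  moreover obtain c where c: "c \<in> charts_at M p" using M.charts_at_nonempty[OF pt] by blast
  ultimately have "?X x c = ?X y c" by metis
  then have "(\<Sum>i<r. (x i - y i) *\<^sub>R hamiltonian_vector M P (f i) p c) = 0"
    by (simp add: scaleR_left_diff_distrib sum_subtractf)
  from frame_independent[OF frame p(1) c this i] show ?thesis by simp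
qed

text \<open>Evaluating the residue on the image vectors of coordinate differentials, along a local
  section \<open>s\<close>, gives equations for \<open>a b\<close> whose columns are the Hamiltonian
  vectors at \<open>s b\<close>. Smooth entries and independent columns make the solution
  smooth.\<close>

lemma residue_smooth:
  assumes W: "openin (Top B) W" and \<omega>: "\<omega> \<in> one_forms B W"
    and a: "\<And>b. b \<in> W \<inter> \<phi> ` U \<Longrightarrow> residue b (\<omega> b) (a b) \<in> ker_pullback b" and i: "i < r"
  shows "smooth_fun B (W \<inter> \<phi> ` U) (\<lambda>b. a b i)"
proof (rule N.smooth_funI)
  fix b0 assume b0: "b0 \<in> W \<inter> \<phi> ` U"
  then obtain p0 where p0: "p0 \<in> U" "b0 = \<phi> p0" by blast
  have pt: "p0 \<in> topspace (Top M)" by (rule frame_topspace[OF frame p0(1)])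
  obtain c where c: "c \<in> charts_at M p0" using M.charts_at_nonempty[OF pt] by blast
  obtain d where d: "d \<in> charts_at B b0" using N.charts_at_nonempty[OF map_topspace[OF pt]] p0(2) by blast
  have A: "c \<in> Atlas M" "p0 \<in> fst c" "d \<in> Atlas B" "b0 \<in> fst d" using c d by (auto simp: M.charts_at_iff N.charts_at_iff)
  define W0 where "W0 = U \<inter> fst c \<inter> {p \<in> topspace (Top M). \<phi> p \<in> fst d} \<inter> {p \<in> topspace (Top M). \<phi> p \<in> W}"
  have oW0: "openin (Top M) W0" unfolding W0_def
    by (intro openin_Int frame_open[OF frame] M.chart_domain_open[OF A(1)] map_open_vimage[OF N.chart_domain_open[OF A(3)]] map_open_vimage[OF W])
  have pW0: "p0 \<in> W0" using p0 A pt b0 by (simp add: W0_def)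
  obtain V s where V: "openin (Top B) V" "\<phi> p0 \<in> V" "\<And>b. b \<in> V \<Longrightarrow> s b \<in> W0" "\<And>b. b \<in> V \<Longrightarrow> \<phi> (s b) = b"
    and sm: "\<And>f. smooth_fun M W0 f \<Longrightarrow> smooth_fun B V (f \<circ> s)"
    using local_section[OF oW0 pW0] by metis
  have sU: "s b \<in> U" "s b \<in> fst c" "b \<in> fst d" "b \<in> W" "b \<in> \<phi> ` U" if "b \<in> V" for b
    using V(3)[OF that] V(4)[OF that] imageI[of "s b" U \<phi>] by (auto simp: W0_def)
  have Vd: "V \<subseteq> fst d" using sU(3) by blast
  have VV: "fst d \<inter> V = V" using Vd by blast
  have oV: "open (snd d ` V)" using N.open_chart_image[OF A(3) V(1)] unfolding VV .
  have fW0: "smooth_fun M W0 (f j)" if "j < r" for j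
    by (rule M.smooth_fun_subset[OF frame_smooth[OF frame that] oW0]) (auto simp: W0_def)
  have uW0: "smooth_fun M W0 (M.coordinate c e)" for e
    by (rule M.smooth_fun_subset[OF M.smooth_coordinate[OF A(1)] oW0]) (auto simp: W0_def)
  have yW0: "smooth_fun M W0 (N.coordinate d k \<circ> \<phi>)" for k
    by (rule M.smooth_fun_subset[OF smooth_fun_pullback[OF N.smooth_coordinate[OF A(3)]] oW0]) (auto simp: W0_def)
  \<comment> \<open>For the image vector of the differential of coordinate \<open>e\<close> at
    \<open>s b\<close>, component \<open>k\<close> is \<open>- E k e b\<close>. Hence
    \<open>G e b\<close> is the value of \<omega> on that vector, while \<open>H e j b\<close> is
    component \<open>e\<close> of the Hamiltonian vector of \<open>f j\<close>.\<close>
  define E where "E k e b = poisson_bracket M P (N.coordinate d k \<circ> \<phi>) (M.coordinate c e) (s b)" for k e b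
  define w where "w k b = \<omega> b (coordinate_vector B d k b)" for k b
  define G where "G e b = (\<Sum>k\<in>Basis. (- 1) * (E k e b * w k b))" for e b
  define H where "H e j b = poisson_bracket M P (M.coordinate c e) (f j) (s b)" for e j b
  have sE: "smooth_fun B V (E k e)" for k e
    using sm[OF M.bracket_smooth[OF yW0 uW0]] by (simp add: E_def[abs_def] comp_def)
  have sw: "smooth_fun B V (w k)" for k
  proof -
    have "smooth_fun B (fst d \<inter> W) (w k)" using \<omega> A(3) unfolding one_forms_def w_def by blast
    then show ?thesis by (rule N.smooth_fun_subset[OF _ V(1)]) (use sU in auto)
  qed
  have sG: "smooth_fun B V (G e)" for e
    unfolding G_def by (intro N.smooth_fun_sum[OF V(1)] N.smooth_fun_mult[OF N.smooth_fun_const[OF V(1)]] N.smooth_fun_mult sE sw)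
  have sH: "smooth_fun B V (H e j)" if "j < r" for e j
    using sm[OF M.bracket_smooth[OF uW0 fW0[OF that]]] by (simp add: H_def[abs_def] comp_def)
  have H: "H e j b = hamiltonian_vector M P (f j) (s b) c \<bullet> e" if b: "b \<in> V" and j: "j < r" for b e j
  proof -
    have cs: "c \<in> charts_at M (s b)" using A(1) sU(2)[OF b] by (simp add: M.charts_at_iff)
    show ?thesis unfolding H_def M.bracket_hamiltonian[OF uW0 fW0[OF j] V(3)[OF b]]
      by (rule M.diff_coordinate[OF cs frame_tangent[OF frame j sU(1)[OF b]]])
  qed
  \<comment> \<open>Row \<open>e\<close> of the linear system: the residue vanishes on this image
    vector because it lies in the smaller kernel.\<close>
  have main: "G e b = (\<Sum>j<r. a b j * H e j b)" if b: "b \<in> V" for b e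
  proof -
    let ?p = "s b"
    let ?\<beta> = "diff_fun M (M.coordinate c e) ?p"
    let ?v = "image_vector ?p ?\<beta>"
    have pt: "?p \<in> topspace (Top M)" by (rule frame_topspace[OF frame sU(1)[OF b]])
    have db: "d \<in> charts_at B b" using A(3) sU(3)[OF b] by (simp add: N.charts_at_iff)
    have \<beta>: "?\<beta> \<in> cotangent_space M ?p" by (rule M.diff_fun_cotangent[OF uW0 V(3)[OF b]])
    have \<omega>b: "\<omega> b \<in> cotangent_space B b" using \<omega> sU(4)[OF b] unfolding one_forms_def by blast
    have v: "?v \<in> tangent_space B b" using image_vector_tangent[OF pt \<beta>] unfolding V(4)[OF b] .
    have comp: "?v d \<bullet> k = - E k e b" for k
    proof -
      have dk: "diff_fun B (N.coordinate d k) (\<phi> ?p) \<in> cotangent_space B (\<phi> ?p)"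
        unfolding V(4)[OF b] by (rule N.diff_fun_cotangent[OF N.smooth_coordinate[OF A(3)] sU(3)[OF b]])
      have "?v d \<bullet> k = diff_fun B (N.coordinate d k) b ?v" by (rule N.diff_coordinate[OF db v, symmetric])
      also have "\<dots> = - P ?p (pullback M B \<phi> ?p (diff_fun B (N.coordinate d k) (\<phi> ?p))) ?\<beta>"
        using bivector_pullback[OF pt dk \<beta>] V(4)[OF b] by simp
      also have "pullback M B \<phi> ?p (diff_fun B (N.coordinate d k) (\<phi> ?p)) = diff_fun M (N.coordinate d k \<circ> \<phi>) ?p"
        by (rule pullback_differential[OF N.smooth_coordinate[OF A(3)] pt]) (simp add: V(4)[OF b] sU(3)[OF b])
      finally show ?thesis by (simp add: E_def poisson_bracket_def)
    qed
    have "G e b = (\<Sum>k\<in>Basis. (?v d \<bullet> k) * \<omega> b (coordinate_vector B d k b))"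
      unfolding comp by (simp add: G_def w_def)
    also have "\<dots> = \<omega> b ?v" by (rule N.cotangent_expand[OF \<omega>b v db, symmetric])
    also have "\<dots> = (\<Sum>j<r. a b j * ?\<beta> (hamiltonian_vector M P (f j) ?p))"
    proof -
      have "b \<in> W \<inter> \<phi> ` U" using sU[OF b] by blast
      then have "residue b (\<omega> b) (a b) ?v = 0"
        using a[of b] pt V(4)[OF b] \<beta> unfolding ker_pullback_iff by blast
      then show ?thesis
        using v base_form_image_vector[OF _ sU(1)[OF b] \<beta>] unfolding V(4)[OF b] by (simp add: residue_def)
    qed
    also have "\<dots> = (\<Sum>j<r. a b j * H e j b)"
    proof (rule sum.cong[OF refl])
      fix j assume "j \<in> {..<r}"
      then have j: "j < r" by simp
      show "a b j * ?\<beta> (hamiltonian_vector M P (f j) ?p) = a b j * H e j b"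
        unfolding H_def M.bracket_hamiltonian[OF uW0 fW0[OF j] V(3)[OF b]] ..
    qed
    finally show ?thesis .
  qed
  let ?inv = "chart_inv d"
  have inv: "?inv x \<in> V" if "x \<in> snd d ` V" for x using that Vd by (auto simp: N.chart_inv_left[OF A(3)] subset_iff)
  have chart_smooth: "smooth_on (\<lambda>x. F (?inv x)) (snd d ` V)" if "smooth_fun B V F" for F
    using N.smooth_fun_chart[OF that A(3)] unfolding VV comp_def .
  \<comment> \<open>The rows are assembled into vectors of the model space of \<open>M\<close>, as
    functions of the chart coordinates on \<open>B\<close>.\<close>
  have "smooth_on ((\<lambda>j x. a (?inv x) j) i) (snd d ` V)"
  proof (rule smooth_on_frame_coefficients[where r=r and v="\<lambda>j x. \<Sum>e\<in>Basis. H e j (?inv x) *\<^sub>R e"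
        and y="\<lambda>x. \<Sum>e\<in>Basis. G e (?inv x) *\<^sub>R e", OF oV])
    show "smooth_on (\<lambda>x. \<Sum>e\<in>Basis. H e j (?inv x) *\<^sub>R e) (snd d ` V)" if "j < r" for j
      by (intro smooth_on_sum smooth_on_scaleR smooth_on_const oV chart_smooth[OF sH[OF that]])
    show "smooth_on (\<lambda>x. \<Sum>e\<in>Basis. G e (?inv x) *\<^sub>R e) (snd d ` V)"
      by (intro smooth_on_sum smooth_on_scaleR smooth_on_const oV chart_smooth[OF sG])
    show "\<forall>j<r. k j = 0" if x: "x \<in> snd d ` V" and 0: "(\<Sum>j<r. k j *\<^sub>R (\<Sum>e\<in>Basis. H e j (?inv x) *\<^sub>R e)) = 0" for x k
    proof -
      let ?b = "?inv x"
      have b: "?b \<in> V" by (rule inv[OF x])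
      have cs: "c \<in> charts_at M (s ?b)" using A(1) sU(2)[OF b] by (simp add: M.charts_at_iff)
      have "(\<Sum>j<r. k j *\<^sub>R hamiltonian_vector M P (f j) (s ?b) c) = (\<Sum>j<r. k j *\<^sub>R (\<Sum>e\<in>Basis. H e j ?b *\<^sub>R e))"
        by (rule sum.cong[OF refl]) (simp add: H[OF b] euclidean_representation)
      then show ?thesis using frame_independent[OF frame sU(1)[OF b] cs] 0 by auto
    qed
    show "(\<Sum>e\<in>Basis. G e (?inv x) *\<^sub>R e) = (\<Sum>j<r. a (?inv x) j *\<^sub>R (\<Sum>e\<in>Basis. H e j (?inv x) *\<^sub>R e))"
      if x: "x \<in> snd d ` V" for x
    proof -
      have "(\<Sum>e\<in>Basis. G e (?inv x) *\<^sub>R e) = (\<Sum>e\<in>Basis. \<Sum>j<r. a (?inv x) j *\<^sub>R (H e j (?inv x) *\<^sub>R e))"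
        unfolding main[OF inv[OF x]] scaleR_sum_left by simp
      also have "\<dots> = (\<Sum>j<r. \<Sum>e\<in>Basis. a (?inv x) j *\<^sub>R (H e j (?inv x) *\<^sub>R e))" by (rule sum.swap)
      finally show ?thesis unfolding scaleR_sum_right .
    qed
  qed (rule i)
  then have "smooth_on ((\<lambda>b. a b i) \<circ> ?inv) (snd d ` V)" by (simp add: comp_def)
  then show "\<exists>c\<in>charts_at B b0. \<exists>Wa. openin (Top B) Wa \<and> b0 \<in> Wa \<and> Wa \<subseteq> W \<inter> \<phi> ` U \<and> Wa \<subseteq> fst c \<and>
    smooth_on ((\<lambda>b. a b i) \<circ> chart_inv c) (snd c ` Wa)"
    using V(1,2) p0(2) sU by (intro bexI[OF _ d] exI[of _ V]) auto
qed

end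

lemma ker_base_nonempty:
  assumes b: "b \<in> topspace (Top B)" shows "ker_base b \<noteq> {}"
proof -
  have c: "diff_fun B (\<lambda>_. 0) b \<in> cotangent_space B b" (is "?d \<in> _")
    by (rule N.diff_fun_cotangent[OF N.smooth_fun_const[OF openin_topspace] b])
  have "(\<lambda>X\<in>tangent_space B b. 0 * ?d X + 0 * ?d X) \<in> ker_base b"
    unfolding ker_base_iff[OF b] using N.cotangent_lincomb[OF c c, of 0 0] N.bivector_linear1[OF b c c, of _ 0 0] by simp
  then show ?thesis by blast
qed

end

section \<open>Quotient sheaves with local frames\<close>

context smooth_mfd
begin

section \<open>Module operations on 1-forms\<close>

lemma one_forms_cotangent: "\<omega> \<in> one_forms M U \<Longrightarrow> p \<in> U \<Longrightarrow> \<omega> p \<in> cotangent_space M p"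
  unfolding one_forms_def by blast

lemma one_forms_smooth:
  "\<omega> \<in> one_forms M U \<Longrightarrow> c \<in> Atlas M \<Longrightarrow> smooth_fun M (fst c \<inter> U) (\<lambda>p. \<omega> p (coordinate_vector M c v p))"
  unfolding one_forms_def by blast

lemma one_forms_restrict:
  assumes "\<omega> \<in> one_forms M U" "openin (Top M) W" "W \<subseteq> U"
  shows "restrict \<omega> W \<in> one_forms M W"
  unfolding one_forms_def
proof (intro CollectI conjI ballI allI)
  show "restrict \<omega> W \<in> extensional W" by simp
  show "restrict \<omega> W p \<in> cotangent_space M p" if "p \<in> W" for p
    using that assms(3) one_forms_cotangent[OF assms(1)] by auto
  fix c :: "('p, 'v) chart" and v assume c: "c \<in> Atlas M"
  have "smooth_fun M (fst c \<inter> W) (\<lambda>p. \<omega> p (coordinate_vector M c v p))"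
    by (rule smooth_fun_subset[OF one_forms_smooth[OF assms(1) c] openin_Int[OF chart_domain_open[OF c] assms(2)]])
      (use assms(3) in blast)
  then show "smooth_fun M (fst c \<inter> W) (\<lambda>p. restrict \<omega> W p (coordinate_vector M c v p))"
    by (rule smooth_fun_cong) simp
qed

lemma one_forms_sum:
  assumes U: "openin (Top M) U" and \<theta>: "\<And>i. i < r \<Longrightarrow> \<theta> i \<in> one_forms M U" and a: "\<And>i. i < r \<Longrightarrow> smooth_fun M U (a i)"
  shows "(\<lambda>p\<in>U. \<lambda>X\<in>tangent_space M p. \<Sum>i<(r::nat). a i p * \<theta> i p X) \<in> one_forms M U"
  unfolding one_forms_def
proof (intro CollectI conjI ballI allI)
  let ?s = "\<lambda>p\<in>U. \<lambda>X\<in>tangent_space M p. \<Sum>i<r. a i p * \<theta> i p X"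
  show "?s \<in> extensional U" by simp
  show "?s p \<in> cotangent_space M p" if p: "p \<in> U" for p
  proof -
    have pt: "p \<in> topspace (Top M)" using openin_subset[OF U] p by blast
    have z: "diff_fun M (\<lambda>_. 0) p \<in> cotangent_space M p"
      by (rule diff_fun_cotangent[OF smooth_fun_const[OF U] p])
    have "(\<lambda>X\<in>tangent_space M p. \<Sum>i<r. a i p * \<theta> i p X) \<in> cotangent_space M p"
      by (rule lincomb_sum_closed[OF cotangent_lincomb z one_forms_cotangent[OF \<theta> p]])
    then show ?thesis unfolding restrict_apply'[OF p] .
  qed
  fix c :: "('p, 'v) chart" and v assume c: "c \<in> Atlas M"
  have o: "openin (Top M) (fst c \<inter> U)" by (rule openin_Int[OF chart_domain_open[OF c] U])
  have "smooth_fun M (fst c \<inter> U) (\<lambda>p. \<Sum>i<r. a i p * \<theta> i p (coordinate_vector M c v p))"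
    by (intro smooth_fun_sum[OF o] smooth_fun_mult one_forms_smooth[OF \<theta> c] smooth_fun_subset[OF a o]) auto
  then show "smooth_fun M (fst c \<inter> U) (\<lambda>p. ?s p (coordinate_vector M c v p))"
  proof (rule smooth_fun_cong)
    fix p assume p: "p \<in> fst c \<inter> U"
    then have "coordinate_vector M c v p \<in> tangent_space M p"
      using c by (intro coordinate_vector_tangent) (simp add: charts_at_iff)
    then show "(\<Sum>i<r. a i p * \<theta> i p (coordinate_vector M c v p)) = ?s p (coordinate_vector M c v p)"
      using p by simp
  qed
qed

lemma one_forms_lincomb:
  assumes U: "openin (Top M) U" and "\<omega> \<in> one_forms M U" "\<eta> \<in> one_forms M U" "smooth_fun M U f" "smooth_fun M U g"
  shows "(\<lambda>p\<in>U. \<lambda>X\<in>tangent_space M p. f p * \<omega> p X + g p * \<eta> p X) \<in> one_forms M U"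
proof -
  have "(\<lambda>p\<in>U. \<lambda>X\<in>tangent_space M p. \<Sum>i<(2::nat). (if i = 0 then f else g) p * (if i = 0 then \<omega> else \<eta>) p X) \<in> one_forms M U"
    by (rule one_forms_sum[OF U]) (use assms in auto)
  then show ?thesis by (simp add: numeral_2_eq_2)
qed

end

text \<open>The point \<open>b\<close> carries the frame \<open>\<theta> b\<close> of \<open>K/N\<close> over \<open>V b\<close>; the fibre of the bundle at \<open>b\<close> is
  identified with \<open>\<real>\<^sup>r\<close> by the frame belonging to \<open>b\<close> itself.\<close>

locale framed_quotient = smooth_mfd B for B :: "('b, 'y::euclidean_space) manifold" +
  fixes K N :: "'b \<Rightarrow> ('b, 'y) cotangent set" and r :: nat
    and V :: "'b \<Rightarrow> 'b set" and \<theta> :: "'b \<Rightarrow> nat \<Rightarrow> 'b \<Rightarrow> ('b, 'y) cotangent"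
  assumes K_nonempty: "\<And>b. b \<in> topspace (Top B) \<Longrightarrow> K b \<noteq> {}"
    and K_cotangent: "\<And>b. K b \<subseteq> cotangent_space B b"
    and K_lincomb: "\<And>b \<xi> \<eta> a a'. b \<in> topspace (Top B) \<Longrightarrow> \<xi> \<in> K b \<Longrightarrow> \<eta> \<in> K b \<Longrightarrow>
      (\<lambda>X\<in>tangent_space B b. a * \<xi> X + a' * \<eta> X) \<in> K b"
    and N_lincomb: "\<And>b \<xi> \<eta> a a'. b \<in> topspace (Top B) \<Longrightarrow> \<xi> \<in> N b \<Longrightarrow> \<eta> \<in> N b \<Longrightarrow>
      (\<lambda>X\<in>tangent_space B b. a * \<xi> X + a' * \<eta> X) \<in> N b"
    and V_open: "\<And>b. b \<in> topspace (Top B) \<Longrightarrow> openin (Top B) (V b)"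
    and V_mem: "\<And>b. b \<in> topspace (Top B) \<Longrightarrow> b \<in> V b"
    and \<theta>_form: "\<And>b i. b \<in> topspace (Top B) \<Longrightarrow> i < r \<Longrightarrow> \<theta> b i \<in> one_forms B (V b)"
    and \<theta>_K: "\<And>b i x. b \<in> topspace (Top B) \<Longrightarrow> i < r \<Longrightarrow> x \<in> V b \<Longrightarrow> \<theta> b i x \<in> K x"
    and coordinates_exist: "\<And>b x \<xi>. b \<in> topspace (Top B) \<Longrightarrow> x \<in> V b \<Longrightarrow> \<xi> \<in> K x \<Longrightarrow>
      \<exists>a. (\<lambda>X\<in>tangent_space B x. \<xi> X - (\<Sum>i<r. a i * \<theta> b i x X)) \<in> N x"
    and coordinates_unique: "\<And>b x \<xi> a a' i. b \<in> topspace (Top B) \<Longrightarrow> x \<in> V b \<Longrightarrow> \<xi> \<in> K x \<Longrightarrow>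
      (\<lambda>X\<in>tangent_space B x. \<xi> X - (\<Sum>i<r. a i * \<theta> b i x X)) \<in> N x \<Longrightarrow>
      (\<lambda>X\<in>tangent_space B x. \<xi> X - (\<Sum>i<r. a' i * \<theta> b i x X)) \<in> N x \<Longrightarrow> i < r \<Longrightarrow> a i = a' i"
    and coordinates_smooth: "\<And>b W \<omega> a i. b \<in> topspace (Top B) \<Longrightarrow> openin (Top B) W \<Longrightarrow> \<omega> \<in> one_forms B W \<Longrightarrow>
      (\<And>x. x \<in> W \<inter> V b \<Longrightarrow> (\<lambda>X\<in>tangent_space B x. \<omega> x X - (\<Sum>i<r. a x i * \<theta> b i x X)) \<in> N x) \<Longrightarrow>
      i < r \<Longrightarrow> smooth_fun B (W \<inter> V b) (\<lambda>x. a x i)"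
begin

section \<open>Coordinates modulo the smaller kernel\<close>

abbreviation lc :: "'b \<Rightarrow> real \<Rightarrow> ('b, 'y) cotangent \<Rightarrow> real \<Rightarrow> ('b, 'y) cotangent \<Rightarrow> ('b, 'y) cotangent" where
  "lc x a \<xi> a' \<eta> \<equiv> (\<lambda>X\<in>tangent_space B x. a * \<xi> X + a' * \<eta> X)"

definition remainder :: "'b \<Rightarrow> 'b \<Rightarrow> ('b, 'y) cotangent \<Rightarrow> (nat \<Rightarrow> real) \<Rightarrow> ('b, 'y) cotangent" where
  "remainder b x \<xi> a = (\<lambda>X\<in>tangent_space B x. \<xi> X - (\<Sum>i<r. a i * \<theta> b i x X))"

text \<open>Restricting to \<open>std_space r\<close> fixes the entries from \<open>r\<close> on, so
  that coordinates are unique as functions on \<open>nat\<close>.\<close>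

definition coord :: "'b \<Rightarrow> 'b \<Rightarrow> ('b, 'y) cotangent \<Rightarrow> nat \<Rightarrow> real" where
  "coord b x \<xi> = (SOME a. a \<in> std_space r \<and> remainder b x \<xi> a \<in> N x)"

definition comb :: "'b \<Rightarrow> 'b \<Rightarrow> (nat \<Rightarrow> real) \<Rightarrow> ('b, 'y) cotangent" where
  "comb b x a = (\<lambda>X\<in>tangent_space B x. \<Sum>i<r. a i * \<theta> b i x X)"

lemma V_topspace: "b \<in> topspace (Top B) \<Longrightarrow> x \<in> V b \<Longrightarrow> x \<in> topspace (Top B)"
  using openin_subset[OF V_open] by blast

lemma coord:
  assumes "b \<in> topspace (Top B)" "x \<in> V b" "\<xi> \<in> K x"
  shows "coord b x \<xi> \<in> std_space r" "remainder b x \<xi> (coord b x \<xi>) \<in> N x"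
proof -
  obtain a where a: "remainder b x \<xi> a \<in> N x"
    using coordinates_exist[OF assms] unfolding remainder_def by blast
  let ?a = "\<lambda>i. if i < r then a i else 0"
  have "remainder b x \<xi> ?a = remainder b x \<xi> a" unfolding remainder_def by (rule restrict_ext) simp
  then have "?a \<in> std_space r \<and> remainder b x \<xi> ?a \<in> N x" using a by (simp add: std_space_def)
  then have "coord b x \<xi> \<in> std_space r \<and> remainder b x \<xi> (coord b x \<xi>) \<in> N x"
    unfolding coord_def by (rule someI[of "\<lambda>a. a \<in> std_space r \<and> remainder b x \<xi> a \<in> N x"])
  then show "coord b x \<xi> \<in> std_space r" "remainder b x \<xi> (coord b x \<xi>) \<in> N x" by blast+
qed

lemma coord_eqI:
  assumes "b \<in> topspace (Top B)" "x \<in> V b" "\<xi> \<in> K x" "a \<in> std_space r" "remainder b x \<xi> a \<in> N x"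
  shows "coord b x \<xi> = a"
proof
  fix i
  show "coord b x \<xi> i = a i"
  proof (cases "i < r")
    case True
    show ?thesis
      by (rule coordinates_unique[OF assms(1-3) coord(2)[OF assms(1-3), unfolded remainder_def]
            assms(5)[unfolded remainder_def] True])
  next
    case False
    then show ?thesis using coord(1)[OF assms(1-3)] assms(4) by (simp add: std_space_def)
  qed
qed

lemma coord_lincomb:
  assumes b: "b \<in> topspace (Top B)" "x \<in> V b" and \<xi>: "\<xi> \<in> K x" and \<eta>: "\<eta> \<in> K x"
  shows "coord b x (lc x a \<xi> a' \<eta>) = (\<lambda>i. a * coord b x \<xi> i + a' * coord b x \<eta> i)"
proof (rule coord_eqI[OF b])
  have x: "x \<in> topspace (Top B)" by (rule V_topspace[OF b])
  show "lc x a \<xi> a' \<eta> \<in> K x" by (rule K_lincomb[OF x \<xi> \<eta>])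
  show "(\<lambda>i. a * coord b x \<xi> i + a' * coord b x \<eta> i) \<in> std_space r"
    using coord(1)[OF b \<xi>] coord(1)[OF b \<eta>] by (simp add: std_space_def)
  have "remainder b x (lc x a \<xi> a' \<eta>) (\<lambda>i. a * coord b x \<xi> i + a' * coord b x \<eta> i)
      = lc x a (remainder b x \<xi> (coord b x \<xi>)) a' (remainder b x \<eta> (coord b x \<eta>))"
    unfolding remainder_def
    by (rule restrict_ext) (simp add: sum.distrib sum_distrib_left algebra_simps)
  then show "remainder b x (lc x a \<xi> a' \<eta>) (\<lambda>i. a * coord b x \<xi> i + a' * coord b x \<eta> i) \<in> N x"
    using N_lincomb[OF x coord(2)[OF b \<xi>] coord(2)[OF b \<eta>]] by simp
qed

text \<open>Since the right-hand side does not mention \<open>b\<close>, equality of coordinates in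
  one frame carries over to every other frame around \<open>x\<close>. All later changes of frame
  rest on this.\<close>

lemma coord_eq_iff:
  assumes b: "b \<in> topspace (Top B)" "x \<in> V b" and \<xi>: "\<xi> \<in> K x" and \<eta>: "\<eta> \<in> K x"
  shows "coord b x \<xi> = coord b x \<eta> \<longleftrightarrow> lc x 1 \<xi> (-1) \<eta> \<in> N x"
proof
  have x: "x \<in> topspace (Top B)" by (rule V_topspace[OF b])
  {
    assume eq: "coord b x \<xi> = coord b x \<eta>"
    have e: "lc x 1 \<xi> (-1) \<eta> = lc x 1 (remainder b x \<xi> (coord b x \<xi>)) (-1) (remainder b x \<eta> (coord b x \<eta>))"
      unfolding eq remainder_def by (rule restrict_ext) simp
    show "lc x 1 \<xi> (-1) \<eta> \<in> N x"
      unfolding e by (rule N_lincomb[OF x coord(2)[OF b \<xi>] coord(2)[OF b \<eta>]])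
  }
  assume d: "lc x 1 \<xi> (-1) \<eta> \<in> N x"
  show "coord b x \<xi> = coord b x \<eta>"
  proof (rule coord_eqI[OF b \<xi> coord(1)[OF b \<eta>]])
    have e: "remainder b x \<xi> (coord b x \<eta>) = lc x 1 (lc x 1 \<xi> (-1) \<eta>) 1 (remainder b x \<eta> (coord b x \<eta>))"
      unfolding remainder_def by (rule restrict_ext) simp
    show "remainder b x \<xi> (coord b x \<eta>) \<in> N x"
      unfolding e by (rule N_lincomb[OF x d coord(2)[OF b \<eta>]])
  qed
qed

lemma comb_K:
  assumes b: "b \<in> topspace (Top B)" "x \<in> V b"
  shows "comb b x a \<in> K x"
proof -
  obtain \<xi> where ne: "\<xi> \<in> K x" using K_nonempty[OF V_topspace[OF b]] by blast
  show ?thesis unfolding comb_def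
    by (rule lincomb_sum_closed[where C="K x", OF K_lincomb[OF V_topspace[OF b]] ne \<theta>_K[OF b(1) _ b(2)]])
qed

lemma coord_comb:
  assumes b: "b \<in> topspace (Top B)" "x \<in> V b" and a: "a \<in> std_space r"
  shows "coord b x (comb b x a) = a"
proof (rule coord_eqI[OF b comb_K[OF b] a])
  obtain \<xi> where ne: "\<xi> \<in> K x" using K_nonempty[OF V_topspace[OF b]] by blast
  \<comment> \<open>Any element of \<open>N x\<close> would do; it serves to write the zero covector
    as a combination of elements of \<open>N x\<close>.\<close>
  let ?n = "remainder b x \<xi> (coord b x \<xi>)"
  have e: "remainder b x (comb b x a) a = lc x 0 ?n 0 ?n"
    unfolding remainder_def comb_def by (rule restrict_ext) simp
  show "remainder b x (comb b x a) a \<in> N x"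
    unfolding e by (rule N_lincomb[OF V_topspace[OF b] coord(2)[OF b ne] coord(2)[OF b ne]])
qed

text \<open>Change of frame from the one at \<open>x\<close> to the one at \<open>b\<close>.\<close>

definition trivialization :: "'b \<Rightarrow> 'b \<times> (nat \<Rightarrow> real) \<Rightarrow> nat \<Rightarrow> real" where
  "trivialization b e = coord b (fst e) (comb (fst e) (fst e) (snd e))"

text \<open>As a set the total space is a product; all twisting is carried by the trivializations,
  which compare the frame at \<open>b\<close> with the frame belonging to each point.\<close>

definition quotient_bundle :: "('b, 'b \<times> (nat \<Rightarrow> real)) vbundle" where
  "quotient_bundle = \<lparr>Total = topspace (Top B) \<times> std_space r, Proj = fst,
     VAdd = (\<lambda>e e'. (fst e, \<lambda>i. snd e i + snd e' i)), VScale = (\<lambda>a e. (fst e, \<lambda>i. a * snd e i)),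
     Triv = (\<lambda>b. (V b, trivialization b)) ` topspace (Top B)\<rparr>"

lemma fibre_bundle: "b \<in> topspace (Top B) \<Longrightarrow> fibre quotient_bundle b = {b} \<times> std_space r"
  by (auto simp: fibre_def quotient_bundle_def)

text \<open>The combination formed from the coordinates of \<xi> in the frame of \<open>x\<close>
  represents the same class as \<xi>, so it has the same coordinates in the frame of
  \<open>b\<close>.\<close>

lemma trivialization_coord:
  assumes b: "b \<in> topspace (Top B)" "x \<in> V b" and \<xi>: "\<xi> \<in> K x"
  shows "trivialization b (x, coord x x \<xi>) = coord b x \<xi>"
proof -
  have x: "x \<in> topspace (Top B)" "x \<in> V x" using V_topspace[OF b] V_mem by blast+
  let ?\<eta> = "comb x x (coord x x \<xi>)"
  have \<eta>: "?\<eta> \<in> K x" by (rule comb_K[OF x])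
  have "coord x x ?\<eta> = coord x x \<xi>" by (rule coord_comb[OF x coord(1)[OF x \<xi>]])
  then have "coord b x ?\<eta> = coord b x \<xi>"
    unfolding coord_eq_iff[OF x \<eta> \<xi>] coord_eq_iff[OF b \<eta> \<xi>] .
  then show ?thesis by (simp add: trivialization_def)
qed

lemma comb_lincomb:
  "comb b x (\<lambda>i. a * u i + a' * v i) = lc x a (comb b x u) a' (comb b x v)"
  unfolding comb_def by (rule restrict_ext) (simp add: sum.distrib sum_distrib_left algebra_simps)

lemma trivialization_lincomb:
  assumes b: "b \<in> topspace (Top B)" "x \<in> V b"
  shows "trivialization b (x, \<lambda>i. a * u i + a' * v i) = (\<lambda>i. a * trivialization b (x, u) i + a' * trivialization b (x, v) i)"
proof -
  have x: "x \<in> topspace (Top B)" "x \<in> V x" using V_topspace[OF b] V_mem by blast+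
  show ?thesis
    using coord_lincomb[OF b comb_K[OF x] comb_K[OF x]] by (simp add: trivialization_def comb_lincomb)
qed

lemma trivialization_bij:
  assumes b: "b \<in> topspace (Top B)" "x \<in> V b"
  shows "bij_betw (trivialization b) (fibre quotient_bundle x) (std_space r)"
proof -
  have x: "x \<in> topspace (Top B)" "x \<in> V x" using V_topspace[OF b] V_mem by blast+
  show ?thesis unfolding fibre_bundle[OF x(1)]
  proof (rule bij_betw_byWitness[where f'="\<lambda>a. (x, coord x x (comb b x a))"])
    show "\<forall>e\<in>{x} \<times> std_space r. (x, coord x x (comb b x (trivialization b e))) = e"
    proof
      fix e assume "e \<in> {x} \<times> std_space r"
      then obtain u where u: "e = (x, u)" "u \<in> std_space r" by blast
      let ?t = "trivialization b e"
      have \<xi>: "comb x x u \<in> K x" by (rule comb_K[OF x])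
      have t: "?t = coord b x (comb x x u)" by (simp add: u(1) trivialization_def)
      have "coord b x (comb b x ?t) = coord b x (comb x x u)"
        unfolding t by (rule coord_comb[OF b coord(1)[OF b \<xi>]])
      then have "coord x x (comb b x ?t) = coord x x (comb x x u)"
        unfolding coord_eq_iff[OF b comb_K[OF b] \<xi>] coord_eq_iff[OF x comb_K[OF b] \<xi>] .
      also have "\<dots> = u" by (rule coord_comb[OF x u(2)])
      finally show "(x, coord x x (comb b x ?t)) = e" using u(1) by simp
    qed
    show "\<forall>a\<in>std_space r. trivialization b (x, coord x x (comb b x a)) = a"
      using trivialization_coord[OF b comb_K[OF b]] coord_comb[OF b] by simp
    show "trivialization b ` ({x} \<times> std_space r) \<subseteq> std_space r"
      using coord(1)[OF b comb_K[OF x]] by (auto simp: trivialization_def)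
    show "(\<lambda>a. (x, coord x x (comb b x a))) ` std_space r \<subseteq> {x} \<times> std_space r"
      using coord(1)[OF x comb_K[OF b]] by auto
  qed
qed

lemma inv_trivialization:
  assumes b: "b \<in> topspace (Top B)" "x \<in> V b" and a: "a \<in> std_space r"
  shows "inv_into (fibre quotient_bundle x) (trivialization b) a = (x, coord x x (comb b x a))"
proof (rule inv_into_f_eq)
  have x: "x \<in> topspace (Top B)" "x \<in> V x" using V_topspace[OF b] V_mem by blast+
  show "inj_on (trivialization b) (fibre quotient_bundle x)" using trivialization_bij[OF b] bij_betw_def by blast
  show "(x, coord x x (comb b x a)) \<in> fibre quotient_bundle x"
    unfolding fibre_bundle[OF x(1)] using coord(1)[OF x comb_K[OF b]] by simp
  show "trivialization b (x, coord x x (comb b x a)) = a"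
    unfolding trivialization_coord[OF b comb_K[OF b]] by (rule coord_comb[OF b a])
qed

lemma coord_smooth:
  assumes b: "b \<in> topspace (Top B)" and W: "openin (Top B) W" and \<omega>: "\<omega> \<in> one_forms B W"
    and K: "\<And>x. x \<in> W \<Longrightarrow> \<omega> x \<in> K x" and i: "i < r"
  shows "smooth_fun B (W \<inter> V b) (\<lambda>x. coord b x (\<omega> x) i)"
proof (rule coordinates_smooth[OF b W \<omega> _ i])
  fix x assume "x \<in> W \<inter> V b"
  then show "(\<lambda>X\<in>tangent_space B x. \<omega> x X - (\<Sum>i<r. coord b x (\<omega> x) i * \<theta> b i x X)) \<in> N x"
    using coord(2)[OF b _ K, of x] unfolding remainder_def by blast
qed

lemma vector_bundle_bundle: "vector_bundle B r quotient_bundle"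
  unfolding vector_bundle_def
proof (intro conjI)
  let ?T = "topspace (Top B)"
  show "Proj quotient_bundle ` Total quotient_bundle \<subseteq> ?T" by (auto simp: quotient_bundle_def)
  show "\<forall>b\<in>?T. (\<forall>e\<in>fibre quotient_bundle b. \<forall>e'\<in>fibre quotient_bundle b. VAdd quotient_bundle e e' \<in> fibre quotient_bundle b) \<and>
        (\<forall>a. \<forall>e\<in>fibre quotient_bundle b. VScale quotient_bundle a e \<in> fibre quotient_bundle b)"
    by (auto simp: fibre_def quotient_bundle_def std_space_def)
  show "\<Union> (fst ` Triv quotient_bundle) = ?T"
    using V_topspace V_mem by (auto simp: quotient_bundle_def)
  have "openin (Top B) (V b) \<and> (\<forall>x\<in>V b. bij_betw (trivialization b) (fibre quotient_bundle x) (std_space r) \<and>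
           (\<forall>e\<in>fibre quotient_bundle x. \<forall>e'\<in>fibre quotient_bundle x. trivialization b (VAdd quotient_bundle e e') = (\<lambda>i. trivialization b e i + trivialization b e' i)) \<and>
           (\<forall>a. \<forall>e\<in>fibre quotient_bundle x. trivialization b (VScale quotient_bundle a e) = (\<lambda>i. a * trivialization b e i)))"
    if b: "b \<in> ?T" for b
  proof (intro conjI ballI allI)
    show "openin (Top B) (V b)" by (rule V_open[OF b])
    fix x assume x: "x \<in> V b"
    show "bij_betw (trivialization b) (fibre quotient_bundle x) (std_space r)" by (rule trivialization_bij[OF b x])
    note fib = fibre_bundle[OF V_topspace[OF b x]]
    show "trivialization b (VScale quotient_bundle a e) = (\<lambda>i. a * trivialization b e i)" if e: "e \<in> fibre quotient_bundle x" for a e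
    proof -
      obtain u where u: "e = (x, u)" using e unfolding fib by blast
      show ?thesis using trivialization_lincomb[OF b x, of a u 0 u] by (simp add: u quotient_bundle_def)
    qed
    show "trivialization b (VAdd quotient_bundle e e') = (\<lambda>i. trivialization b e i + trivialization b e' i)"
      if e: "e \<in> fibre quotient_bundle x" "e' \<in> fibre quotient_bundle x" for e e'
    proof -
      obtain u v where u: "e = (x, u)" "e' = (x, v)" using e unfolding fib by blast
      show ?thesis using trivialization_lincomb[OF b x, of 1 u 1 v] by (simp add: u quotient_bundle_def)
    qed
  qed
  then show "\<forall>(V, t)\<in>Triv quotient_bundle. openin (Top B) V \<and>
        (\<forall>b\<in>V. bij_betw t (fibre quotient_bundle b) (std_space r) \<and>
           (\<forall>e\<in>fibre quotient_bundle b. \<forall>e'\<in>fibre quotient_bundle b. t (VAdd quotient_bundle e e') = (\<lambda>i. t e i + t e' i)) \<and>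
           (\<forall>a. \<forall>e\<in>fibre quotient_bundle b. t (VScale quotient_bundle a e) = (\<lambda>i. a * t e i)))"
    by (simp add: quotient_bundle_def)
  \<comment> \<open>The unit vector \<open>j\<close> in the frame of \<open>b\<close> stands for the
    form \<open>\<theta> b j\<close>. A transition entry is thus a coordinate of that smooth form in
    the frame of \<open>c\<close>.\<close>
  have "smooth_fun B (V b \<inter> V c) (\<lambda>x. trivialization c (inv_into (fibre quotient_bundle x) (trivialization b) (\<lambda>k. if k = j then 1 else 0)) i)"
    if b: "b \<in> ?T" and c: "c \<in> ?T" and i: "i < r" and j: "j < r" for b c i j
  proof (rule smooth_fun_cong[OF coord_smooth[OF c V_open[OF b] \<theta>_form[OF b j] \<theta>_K[OF b j] i]])
    fix x assume "x \<in> V b \<inter> V c"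
    then have x: "x \<in> V b" "x \<in> V c" by blast+
    have \<theta>: "\<theta> b j x \<in> cotangent_space B x" using \<theta>_K[OF b j x(1)] K_cotangent by blast
    let ?e = "\<lambda>k. if k = j then 1 else (0::real)"
    have e: "?e \<in> std_space r" using j by (simp add: std_space_def)
    have cK: "comb b x ?e \<in> K x" by (rule comb_K[OF b x(1)])
    have "comb b x ?e = \<theta> b j x"
    proof (rule cotangent_eqI[OF subsetD[OF K_cotangent cK] \<theta>])
      fix X assume X: "X \<in> tangent_space B x"
      have "(\<Sum>i<r. ?e i * \<theta> b i x X) = (\<Sum>i<r. if i = j then \<theta> b i x X else 0)"
        by (rule sum.cong) auto
      then show "comb b x ?e X = \<theta> b j x X" using X j by (simp add: comb_def)
    qed
    then show "coord c x (\<theta> b j x) i = trivialization c (inv_into (fibre quotient_bundle x) (trivialization b) ?e) i"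
      unfolding inv_trivialization[OF b x(1) e] trivialization_coord[OF c x(2) cK] by simp
  qed
  then show "\<forall>(V, t)\<in>Triv quotient_bundle. \<forall>(W, u)\<in>Triv quotient_bundle. \<forall>i<r. \<forall>j<r.
        smooth_fun B (V \<inter> W) (\<lambda>b. u (inv_into (fibre quotient_bundle b) t (\<lambda>k. if k = j then 1 else 0)) i)"
    by (simp add: quotient_bundle_def)
qed

section \<open>Germs in the quotient sheaf\<close>

definition K_sheaf :: "('b, 'b \<Rightarrow> ('b, 'y) cotangent) module_sheaf" where
  "K_sheaf = one_form_sheaf B \<lparr>Sec := \<lambda>U. {\<omega> \<in> one_forms B U. \<forall>b\<in>U. \<omega> b \<in> K b}\<rparr>"

definition N_sheaf :: "('b, 'b \<Rightarrow> ('b, 'y) cotangent) module_sheaf" where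
  "N_sheaf = one_form_sheaf B \<lparr>Sec := \<lambda>U. {\<omega> \<in> one_forms B U. \<forall>b\<in>U. \<omega> b \<in> N b}\<rparr>"

abbreviation germ :: "'b set \<Rightarrow> ('b \<Rightarrow> ('b, 'y) cotangent) \<Rightarrow> 'b \<Rightarrow> ('b set \<times> ('b \<Rightarrow> ('b, 'y) cotangent)) set" where
  "germ \<equiv> quotient_germ (Top B) K_sheaf N_sheaf"

abbreviation own :: "'b \<Rightarrow> ('b, 'y) cotangent \<Rightarrow> nat \<Rightarrow> real" where
  "own x \<equiv> coord x x"

lemma K_sheaf_sec: "s \<in> Sec K_sheaf U \<longleftrightarrow> s \<in> one_forms B U \<and> (\<forall>x\<in>U. s x \<in> K x)"
  by (simp add: K_sheaf_def)

lemma K_sheaf_secD: "s \<in> Sec K_sheaf U \<Longrightarrow> x \<in> U \<Longrightarrow> s x \<in> K x"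
  by (simp add: K_sheaf_sec)

lemma N_sheaf_sec: "s \<in> Sec N_sheaf U \<longleftrightarrow> s \<in> one_forms B U \<and> (\<forall>x\<in>U. s x \<in> N x)"
  by (simp add: N_sheaf_def)

lemma K_sheaf_ops:
  "Add K_sheaf U s t = (\<lambda>p\<in>U. \<lambda>X\<in>tangent_space B p. s p X + t p X)"
  "Smul K_sheaf U f s = (\<lambda>p\<in>U. \<lambda>X\<in>tangent_space B p. f p * s p X)"
  "Res K_sheaf U W s = restrict s W"
  by (simp_all add: K_sheaf_def one_form_sheaf_def)

lemma K_sheaf_restrict:
  assumes "s \<in> Sec K_sheaf U" "openin (Top B) W" "W \<subseteq> U"
  shows "restrict s W \<in> Sec K_sheaf W"
  using assms one_forms_restrict unfolding K_sheaf_sec by auto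

text \<open>The only candidate for the correcting section \<open>u\<close> is the difference of
  \<open>s\<close> and \<open>t\<close>, and it lies in \<open>N x\<close> exactly when the
  coordinates at \<open>x\<close> agree. Equality of classes of sections thus becomes pointwise
  equality of coordinate tuples nearby.\<close>

lemma germ_iff:
  assumes s: "s \<in> Sec K_sheaf U" and b: "b \<in> U"
  shows "(W, t) \<in> germ U s b \<longleftrightarrow> openin (Top B) W \<and> b \<in> W \<and> t \<in> Sec K_sheaf W \<and>
    (\<exists>O'. openin (Top B) O' \<and> b \<in> O' \<and> O' \<subseteq> U \<inter> W \<and> (\<forall>x\<in>O'. own x (s x) = own x (t x)))"
proof -
  have key: "(\<exists>u. u \<in> Sec N_sheaf O' \<and> Res K_sheaf U O' s = Add K_sheaf O' (Res K_sheaf W O' t) u)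
      \<longleftrightarrow> (\<forall>x\<in>O'. own x (s x) = own x (t x))"
    if t: "t \<in> Sec K_sheaf W" and O': "openin (Top B) O'" "O' \<subseteq> U \<inter> W" for O'
  proof -
    have x: "x \<in> topspace (Top B)" "x \<in> V x" "s x \<in> K x" "t x \<in> K x" if "x \<in> O'" for x
      using openin_subset[OF O'(1)] that V_mem K_sheaf_secD[OF s] K_sheaf_secD[OF t] O'(2) by blast+
    have iff: "own x (s x) = own x (t x) \<longleftrightarrow> lc x 1 (s x) (-1) (t x) \<in> N x" if "x \<in> O'" for x
      using coord_eq_iff[OF x[OF that]] .
    show ?thesis
    proof (intro iffI ballI)
      assume "\<exists>u. u \<in> Sec N_sheaf O' \<and> Res K_sheaf U O' s = Add K_sheaf O' (Res K_sheaf W O' t) u"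
      then obtain u where u: "u \<in> one_forms B O'" "\<And>x. x \<in> O' \<Longrightarrow> u x \<in> N x"
        "restrict s O' = (\<lambda>p\<in>O'. \<lambda>X\<in>tangent_space B p. restrict t O' p X + u p X)"
        unfolding N_sheaf_sec K_sheaf_ops by blast
      fix x assume xO: "x \<in> O'"
      have sx: "s x = (\<lambda>X\<in>tangent_space B x. t x X + u x X)"
        using fun_cong[OF u(3), of x] xO by simp
      have sc: "s x \<in> cotangent_space B x" "t x \<in> cotangent_space B x" using x(3,4)[OF xO] K_cotangent by blast+
      have "lc x 1 (s x) (-1) (t x) = u x"
        by (rule cotangent_eqI[OF cotangent_lincomb[OF sc] one_forms_cotangent[OF u(1) xO]])
          (simp add: sx)
      then show "own x (s x) = own x (t x)" unfolding iff[OF xO] using u(2)[OF xO] by simp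
    next
      assume eq: "\<forall>x\<in>O'. own x (s x) = own x (t x)"
      let ?u = "\<lambda>p\<in>O'. \<lambda>X\<in>tangent_space B p. 1 * restrict s O' p X + (-1) * restrict t O' p X"
      have forms: "restrict s O' \<in> one_forms B O'" "restrict t O' \<in> one_forms B O'"
        using K_sheaf_restrict[OF s O'(1)] K_sheaf_restrict[OF t O'(1)] O'(2) unfolding K_sheaf_sec by blast+
      have "?u \<in> one_forms B O'"
        by (rule one_forms_lincomb[OF O'(1) forms smooth_fun_const[OF O'(1)] smooth_fun_const[OF O'(1)]])
      moreover have "?u x \<in> N x" if "x \<in> O'" for x using iff[OF that] eq that by simp
      ultimately have "?u \<in> Sec N_sheaf O'" unfolding N_sheaf_sec by blast
      moreover have "restrict s O' = (\<lambda>p\<in>O'. \<lambda>X\<in>tangent_space B p. restrict t O' p X + ?u p X)"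
      proof (rule extensionalityI[of _ O'])
        fix p assume p: "p \<in> O'"
        have ps: "s p \<in> extensional (tangent_space B p)"
          using x(3)[OF p] K_cotangent unfolding cotangent_space_def by blast
        show "restrict s O' p = (\<lambda>p\<in>O'. \<lambda>X\<in>tangent_space B p. restrict t O' p X + ?u p X) p"
          by (rule extensionalityI[of _ "tangent_space B p"]) (use p ps in simp_all)
      qed simp_all
      ultimately show "\<exists>u. u \<in> Sec N_sheaf O' \<and> Res K_sheaf U O' s = Add K_sheaf O' (Res K_sheaf W O' t) u"
        unfolding K_sheaf_ops by blast
    qed
  qed
  have "(\<exists>O' u. openin (Top B) O' \<and> b \<in> O' \<and> O' \<subseteq> U \<inter> W \<and> u \<in> Sec N_sheaf O' \<and>
       Res K_sheaf U O' s = Add K_sheaf O' (Res K_sheaf W O' t) u) \<longleftrightarrow>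
    (\<exists>O'. openin (Top B) O' \<and> b \<in> O' \<and> O' \<subseteq> U \<inter> W \<and> (\<forall>x\<in>O'. own x (s x) = own x (t x)))"
    (is "?L \<longleftrightarrow> ?R") if t: "t \<in> Sec K_sheaf W"
  proof -
    have "?L \<longleftrightarrow> (\<exists>O'. openin (Top B) O' \<and> b \<in> O' \<and> O' \<subseteq> U \<inter> W \<and>
        (\<exists>u. u \<in> Sec N_sheaf O' \<and> Res K_sheaf U O' s = Add K_sheaf O' (Res K_sheaf W O' t) u))"
      by (intro ex_cong1) blast
    also have "\<dots> \<longleftrightarrow> ?R"
      by (intro ex_cong1 conj_cong refl) (rule key[OF t])
    finally show ?thesis .
  qed
  then show ?thesis unfolding quotient_germ_def mem_Collect_eq case_prod_conv
    by (intro conj_cong refl)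
qed

lemma germ_self:
  assumes "s \<in> Sec K_sheaf U" "openin (Top B) U" "b \<in> U" shows "(U, s) \<in> germ U s b"
  unfolding germ_iff[OF assms(1,3)] using assms by blast

lemma germ_eqI:
  assumes s: "s \<in> Sec K_sheaf U" and t: "t \<in> Sec K_sheaf W" and O': "openin (Top B) O'" "b \<in> O'" "O' \<subseteq> U \<inter> W"
    and eq: "\<And>x. x \<in> O' \<Longrightarrow> own x (s x) = own x (t x)"
  shows "germ U s b = germ W t b"
proof -
  have sub: "germ U s b \<subseteq> germ W t b"
    if s: "s \<in> Sec K_sheaf U" and t: "t \<in> Sec K_sheaf W" and sub: "O' \<subseteq> U \<inter> W"
      and eq: "\<And>x. x \<in> O' \<Longrightarrow> own x (s x) = own x (t x)" for s t U W
  proof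
    fix z assume "z \<in> germ U s b"
    moreover obtain X v where z: "z = (X, v)" by fastforce
    moreover have bU: "b \<in> U" "b \<in> W" using O'(2) sub by blast+
    ultimately have *: "openin (Top B) X" "b \<in> X" "v \<in> Sec K_sheaf X"
      and "\<exists>O'. openin (Top B) O' \<and> b \<in> O' \<and> O' \<subseteq> U \<inter> X \<and> (\<forall>x\<in>O'. own x (s x) = own x (v x))"
      using germ_iff[OF s bU(1)] by blast+
    then obtain O2 where O2: "openin (Top B) O2" "b \<in> O2" "O2 \<subseteq> U \<inter> X" "\<And>x. x \<in> O2 \<Longrightarrow> own x (s x) = own x (v x)"
      by blast
    have "openin (Top B) (O' \<inter> O2) \<and> b \<in> O' \<inter> O2 \<and> O' \<inter> O2 \<subseteq> W \<inter> X \<and> (\<forall>x\<in>O' \<inter> O2. own x (t x) = own x (v x))"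
      using O2 O' sub eq by (auto intro: openin_Int simp flip: eq)
    then show "z \<in> germ W t b" unfolding z germ_iff[OF t bU(2)] using * by blast
  qed
  show ?thesis using sub[OF s t O'(3) eq] sub[OF t s _ eq[symmetric]] O'(3) by blast
qed

lemma germ_mem:
  assumes s: "s \<in> Sec K_sheaf U" and b: "b \<in> U" and m: "(W, t) \<in> germ U s b"
  shows "t \<in> Sec K_sheaf W" "openin (Top B) W" "b \<in> W" "own b (t b) = own b (s b)"
    "\<exists>O'. openin (Top B) O' \<and> b \<in> O' \<and> O' \<subseteq> U \<inter> W \<and> (\<forall>x\<in>O'. own x (s x) = own x (t x))"
  using m unfolding germ_iff[OF s b] by (blast, blast, blast, metis, blast)

section \<open>The isomorphism onto the sheaf of sections\<close>

definition E where "E = quotient_sheaf (Top B) K_sheaf N_sheaf"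

lemma E_sec:
  "\<sigma> \<in> Sec E U \<longleftrightarrow> \<sigma> \<in> extensional U \<and> (\<forall>b\<in>U. \<exists>O' s. openin (Top B) O' \<and> b \<in> O' \<and> O' \<subseteq> U \<and> s \<in> Sec K_sheaf O' \<and>
       (\<forall>x\<in>O'. \<sigma> x = germ O' s x))"
  by (simp add: E_def quotient_sheaf_def)

lemma E_secE:
  assumes "\<sigma> \<in> Sec E U" "b \<in> U"
  obtains O' s where "openin (Top B) O'" "b \<in> O'" "O' \<subseteq> U" "s \<in> Sec K_sheaf O'" "\<forall>x\<in>O'. \<sigma> x = germ O' s x"
proof -
  have "\<exists>O' s. openin (Top B) O' \<and> b \<in> O' \<and> O' \<subseteq> U \<and> s \<in> Sec K_sheaf O' \<and> (\<forall>x\<in>O'. \<sigma> x = germ O' s x)"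
    by (rule bspec[OF conjunct2[OF iffD1[OF E_sec assms(1)]] assms(2)])
  then show thesis by (elim exE conjE) (rule that)
qed

text \<open>All representatives in one germ have the same coordinates at the base point, so the
  choice does not affect the value for sections of \<open>E\<close>.\<close>

definition to_section :: "'b set \<Rightarrow> ('b \<Rightarrow> ('b set \<times> ('b \<Rightarrow> ('b, 'y) cotangent)) set) \<Rightarrow> 'b \<Rightarrow> 'b \<times> (nat \<Rightarrow> real)" where
  "to_section U \<sigma> = (\<lambda>b\<in>U. (b, own b (snd (SOME z. z \<in> \<sigma> b) b)))"

lemma to_section_apply:
  assumes "b \<in> U" "\<sigma> b = germ O' s b" "s \<in> Sec K_sheaf O'" "openin (Top B) O'" "b \<in> O'"
  shows "to_section U \<sigma> b = (b, own b (s b))"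
proof -
  obtain W t where z: "(SOME z. z \<in> \<sigma> b) = (W, t)" by fastforce
  have "(SOME z. z \<in> \<sigma> b) \<in> \<sigma> b"
    by (rule someI[of _ "(O', s)"]) (use assms germ_self in simp)
  then have "(W, t) \<in> \<sigma> b" unfolding z .
  then have "(W, t) \<in> germ O' s b" unfolding assms(2) .
  from germ_mem(4)[OF assms(3,5) this] show ?thesis using assms(1) by (simp add: to_section_def z)
qed

lemma section_sheaf_sec:
  "s \<in> Sec (section_sheaf B r quotient_bundle) U \<longleftrightarrow> s \<in> extensional U \<and> (\<forall>b\<in>U. s b \<in> fibre quotient_bundle b) \<and>
    (\<forall>b\<in>topspace (Top B). \<forall>i<r. smooth_fun B (U \<inter> V b) (\<lambda>x. trivialization b (s x) i))"
  by (simp add: section_sheaf_def quotient_bundle_def)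

lemma to_section_local:
  assumes "\<sigma> \<in> Sec E U" "b \<in> U"
  obtains O' s where "openin (Top B) O'" "b \<in> O'" "O' \<subseteq> U" "s \<in> Sec K_sheaf O'"
    "\<forall>x\<in>O'. to_section U \<sigma> x = (x, own x (s x))"
proof -
  obtain O' s where O': "openin (Top B) O'" "b \<in> O'" "O' \<subseteq> U" "s \<in> Sec K_sheaf O'" "\<forall>x\<in>O'. \<sigma> x = germ O' s x"
    by (rule E_secE[OF assms])
  have "to_section U \<sigma> x = (x, own x (s x))" if "x \<in> O'" for x
    by (rule to_section_apply[where \<sigma>=\<sigma>, OF subsetD[OF O'(3) that] bspec[OF O'(5) that] O'(4,1) that])
  then show thesis by (intro that[OF O'(1-4)] ballI)
qed

lemma to_section_sec:
  assumes U: "openin (Top B) U" and \<sigma>: "\<sigma> \<in> Sec E U"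
  shows "to_section U \<sigma> \<in> Sec (section_sheaf B r quotient_bundle) U"
  unfolding section_sheaf_sec
proof (intro conjI ballI allI impI)
  have top: "x \<in> topspace (Top B)" if "x \<in> U" for x using openin_subset[OF U] that by blast
  show "to_section U \<sigma> \<in> extensional U" by (simp add: to_section_def)
  show "to_section U \<sigma> b \<in> fibre quotient_bundle b" if b: "b \<in> U" for b
  proof -
    obtain O' s where O': "openin (Top B) O'" "b \<in> O'" "O' \<subseteq> U" "s \<in> Sec K_sheaf O'"
      "\<forall>x\<in>O'. to_section U \<sigma> x = (x, own x (s x))"
      by (rule to_section_local[OF \<sigma> b])
    show ?thesis unfolding fibre_bundle[OF top[OF b]] bspec[OF O'(5,2)]
      using coord(1)[OF top[OF b] V_mem[OF top[OF b]] K_sheaf_secD[OF O'(4,2)]] by simp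
  qed
  fix b i assume b: "b \<in> topspace (Top B)" and i: "i < r"
  show "smooth_fun B (U \<inter> V b) (\<lambda>x. trivialization b (to_section U \<sigma> x) i)"
  proof (rule smooth_fun_local)
    fix p assume "p \<in> U \<inter> V b"
    then have p: "p \<in> U" "p \<in> V b" by blast+
    obtain O' s where O': "openin (Top B) O'" "p \<in> O'" "O' \<subseteq> U" "s \<in> Sec K_sheaf O'" "\<forall>x\<in>O'. to_section U \<sigma> x = (x, own x (s x))"
      by (rule to_section_local[OF \<sigma> p(1)])
    have sf: "s \<in> one_forms B O'" using O'(4) by (simp add: K_sheaf_sec)
    have "smooth_fun B (O' \<inter> V b) (\<lambda>x. trivialization b (to_section U \<sigma> x) i)"
    proof (rule smooth_fun_cong[OF coord_smooth[OF b O'(1) sf K_sheaf_secD[OF O'(4)] i]])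
      fix x assume "x \<in> O' \<inter> V b"
      then have x: "x \<in> O'" "x \<in> V b" by blast+
      show "coord b x (s x) i = trivialization b (to_section U \<sigma> x) i"
        unfolding bspec[OF O'(5) x(1)] trivialization_coord[OF b x(2) K_sheaf_secD[OF O'(4) x(1)]] ..
    qed
    then show "\<exists>W. p \<in> W \<and> W \<subseteq> U \<inter> V b \<and> smooth_fun B W (\<lambda>x. trivialization b (to_section U \<sigma> x) i)"
      using O'(2,3) p(2) by (intro exI[of _ "O' \<inter> V b"]) blast
  qed
qed

text \<open>Equal images mean equal coordinates of local representatives on a common neighbourhood,
  which is equality of their germs.\<close>

lemma to_section_inj:
  assumes U: "openin (Top B) U" and \<sigma>: "\<sigma> \<in> Sec E U" and \<tau>: "\<tau> \<in> Sec E U" and eq: "to_section U \<sigma> = to_section U \<tau>"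
  shows "\<sigma> = \<tau>"
proof (rule extensionalityI[of _ U])
  show "\<sigma> \<in> extensional U" "\<tau> \<in> extensional U"
    by (rule conjunct1[OF iffD1[OF E_sec \<sigma>]], rule conjunct1[OF iffD1[OF E_sec \<tau>]])
  fix b assume b: "b \<in> U"
  obtain O1 s where O1: "openin (Top B) O1" "b \<in> O1" "O1 \<subseteq> U" "s \<in> Sec K_sheaf O1" "\<forall>x\<in>O1. \<sigma> x = germ O1 s x"
    by (rule E_secE[OF \<sigma> b])
  obtain O2 t where O2: "openin (Top B) O2" "b \<in> O2" "O2 \<subseteq> U" "t \<in> Sec K_sheaf O2" "\<forall>x\<in>O2. \<tau> x = germ O2 t x"
    by (rule E_secE[OF \<tau> b])
  have "germ O1 s b = germ O2 t b"
  proof (rule germ_eqI[OF O1(4) O2(4) openin_Int[OF O1(1) O2(1)] _ subset_refl])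
    show "b \<in> O1 \<inter> O2" using O1(2) O2(2) by blast
    fix x assume "x \<in> O1 \<inter> O2"
    then have x: "x \<in> O1" "x \<in> O2" "x \<in> U" using O1(3) by blast+
    show "own x (s x) = own x (t x)"
      using to_section_apply[where \<sigma>=\<sigma>, OF x(3) bspec[OF O1(5) x(1)] O1(4,1) x(1)]
        to_section_apply[where \<sigma>=\<tau>, OF x(3) bspec[OF O2(5) x(2)] O2(4,1) x(2)] eq by simp
  qed
  then show "\<sigma> b = \<tau> b" using O1(2,5) O2(2,5) by simp
qed

text \<open>Over each \<open>U \<inter> V b\<close> the trivialized section provides the
  coefficients of a form \<open>\<omega> b\<close>. Forms for different \<open>b\<close> may differ
  on overlaps, but only by elements of the smaller kernel, so their germs glue. This is where the
  quotient of sheaves, rather than of section spaces, enters.\<close>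

lemma to_section_surj:
  assumes U: "openin (Top B) U" and s: "s \<in> Sec (section_sheaf B r quotient_bundle) U"
  shows "\<exists>\<sigma>\<in>Sec E U. to_section U \<sigma> = s"
proof -
  have top: "x \<in> topspace (Top B)" "x \<in> V x" if "x \<in> U" for x using openin_subset[OF U] that V_mem by blast+
  have s_ext: "s \<in> extensional U" and s_fib: "\<And>x. x \<in> U \<Longrightarrow> s x \<in> fibre quotient_bundle x"
    and s_smooth: "\<And>b i. b \<in> topspace (Top B) \<Longrightarrow> i < r \<Longrightarrow> smooth_fun B (U \<inter> V b) (\<lambda>x. trivialization b (s x) i)"
    using s unfolding section_sheaf_sec by blast+
  have s_pair: "s x = (x, snd (s x))" "snd (s x) \<in> std_space r" if "x \<in> U" for x
    using s_fib[OF that] unfolding fibre_bundle[OF top(1)[OF that]] by auto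
  define \<omega> where "\<omega> b = (\<lambda>x\<in>U \<inter> V b. \<lambda>X\<in>tangent_space B x. \<Sum>i<r. trivialization b (s x) i * \<theta> b i x X)" for b
  have oUV: "openin (Top B) (U \<inter> V b)" if "b \<in> U" for b by (rule openin_Int[OF U V_open[OF top(1)[OF that]]])
  have \<omega>_apply: "\<omega> b x = comb b x (trivialization b (s x))" if "x \<in> U" "x \<in> V b" for b x
    using that by (simp add: \<omega>_def comb_def)
  have \<omega>_sec: "\<omega> b \<in> Sec K_sheaf (U \<inter> V b)" if b: "b \<in> U" for b
    unfolding K_sheaf_sec
  proof (intro conjI ballI)
    have forms: "restrict (\<theta> b i) (U \<inter> V b) \<in> one_forms B (U \<inter> V b)" if "i < r" for i
      by (rule one_forms_restrict[OF \<theta>_form[OF top(1)[OF b] that] oUV[OF b]]) blast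
    have "(\<lambda>x\<in>U \<inter> V b. \<lambda>X\<in>tangent_space B x. \<Sum>i<r. trivialization b (s x) i * restrict (\<theta> b i) (U \<inter> V b) x X) \<in> one_forms B (U \<inter> V b)"
      by (rule one_forms_sum[OF oUV[OF b] forms s_smooth[OF top(1)[OF b]]])
    also have "(\<lambda>x\<in>U \<inter> V b. \<lambda>X\<in>tangent_space B x. \<Sum>i<r. trivialization b (s x) i * restrict (\<theta> b i) (U \<inter> V b) x X) = \<omega> b"
      unfolding \<omega>_def by (intro restrict_ext) simp
    finally show "\<omega> b \<in> one_forms B (U \<inter> V b)" .
    fix x assume "x \<in> U \<inter> V b"
    then have x: "x \<in> U" "x \<in> V b" by blast+
    show "\<omega> b x \<in> K x" unfolding \<omega>_apply[OF x] by (rule comb_K[OF top(1)[OF b] x(2)])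
  qed
  \<comment> \<open>The coordinates are prescribed in the frame of \<open>b\<close>;
    \<open>coord_eq_iff\<close> transfers them to the frame of \<open>x\<close>, in which the fibre
    of the bundle is written.\<close>
  have own_\<omega>: "own x (\<omega> b x) = snd (s x)" if b: "b \<in> U" and x: "x \<in> U" "x \<in> V b" for b x
  proof -
    note b' = top(1)[OF b] x(2)
    note x' = top[OF x(1)]
    let ?\<eta> = "comb x x (snd (s x))"
    have t: "trivialization b (s x) = coord b x ?\<eta>"
      by (subst s_pair(1)[OF x(1)]) (simp add: trivialization_def)
    have "coord b x (\<omega> b x) = coord b x ?\<eta>"
      unfolding \<omega>_apply[OF x] t by (rule coord_comb[OF b' coord(1)[OF b' comb_K[OF x']]])
    then have "own x (\<omega> b x) = own x ?\<eta>"
      unfolding \<omega>_apply[OF x] coord_eq_iff[OF b' comb_K[OF b'] comb_K[OF x']] coord_eq_iff[OF x' comb_K[OF b'] comb_K[OF x']] .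
    also have "\<dots> = snd (s x)" by (rule coord_comb[OF x' s_pair(2)[OF x(1)]])
    finally show ?thesis .
  qed
  \<comment> \<open>The germ at \<open>x\<close> is taken from the form belonging to
    \<open>x\<close>. Compatibility on overlaps then shows that a single form
    \<open>\<omega> b\<close> induces \<sigma> on all of \<open>U \<inter> V b\<close>.\<close>
  define \<sigma> where "\<sigma> = (\<lambda>x\<in>U. germ (U \<inter> V x) (\<omega> x) x)"
  have \<sigma>_germ: "\<sigma> x = germ (U \<inter> V b) (\<omega> b) x" if b: "b \<in> U" and x: "x \<in> U \<inter> V b" for b x
  proof -
    have xU: "x \<in> U" using x by blast
    have "germ (U \<inter> V x) (\<omega> x) x = germ (U \<inter> V b) (\<omega> b) x"
    proof (rule germ_eqI[OF \<omega>_sec[OF xU] \<omega>_sec[OF b] openin_Int[OF oUV[OF xU] oUV[OF b]] _ subset_refl])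
      show "x \<in> U \<inter> V x \<inter> (U \<inter> V b)" using x top(2)[OF xU] by blast
      fix y assume "y \<in> U \<inter> V x \<inter> (U \<inter> V b)"
      then have y: "y \<in> U" "y \<in> V x" "y \<in> V b" by blast+
      show "own y (\<omega> x y) = own y (\<omega> b y)" unfolding own_\<omega>[OF xU y(1,2)] own_\<omega>[OF b y(1,3)] ..
    qed
    then show ?thesis using xU by (simp add: \<sigma>_def)
  qed
  have "\<sigma> \<in> Sec E U" unfolding E_sec
  proof (intro conjI ballI)
    show "\<sigma> \<in> extensional U" by (simp add: \<sigma>_def)
    fix b assume b: "b \<in> U"
    show "\<exists>O' s. openin (Top B) O' \<and> b \<in> O' \<and> O' \<subseteq> U \<and> s \<in> Sec K_sheaf O' \<and> (\<forall>x\<in>O'. \<sigma> x = germ O' s x)"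
      using oUV[OF b] b top(2)[OF b] \<omega>_sec[OF b] \<sigma>_germ[OF b]
      by (intro exI[of _ "U \<inter> V b"] exI[of _ "\<omega> b"]) blast
  qed
  moreover have "to_section U \<sigma> = s"
  proof (rule extensionalityI[of _ U])
    show "to_section U \<sigma> \<in> extensional U" by (simp add: to_section_def)
    fix b assume b: "b \<in> U"
    have bb: "b \<in> U \<inter> V b" using b top(2)[OF b] by blast
    have "to_section U \<sigma> b = (b, own b (\<omega> b b))"
      by (rule to_section_apply[where \<sigma>=\<sigma>, OF b \<sigma>_germ[OF b bb] \<omega>_sec[OF b] oUV[OF b] bb])
    then show "to_section U \<sigma> b = s b" using own_\<omega>[OF b b top(2)[OF b]] s_pair(1)[OF b] by simp
  qed (rule s_ext)
  ultimately show ?thesis by blast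
qed

lemma K_sheaf_add:
  assumes "s \<in> Sec K_sheaf U" "t \<in> Sec K_sheaf U" "openin (Top B) U"
  shows "Add K_sheaf U s t \<in> Sec K_sheaf U"
    and "x \<in> U \<Longrightarrow> own x (Add K_sheaf U s t x) = (\<lambda>i. own x (s x) i + own x (t x) i)"
proof -
  have eq: "Add K_sheaf U s t = (\<lambda>p\<in>U. lc p 1 (s p) 1 (t p))" by (simp add: K_sheaf_ops)
  have top: "x \<in> topspace (Top B)" if "x \<in> U" for x using openin_subset[OF assms(3)] that by blast
  have "(\<lambda>p\<in>U. lc p 1 (s p) 1 (t p)) \<in> one_forms B U"
    using assms unfolding K_sheaf_sec by (intro one_forms_lincomb smooth_fun_const) auto
  moreover have "(\<lambda>p\<in>U. lc p 1 (s p) 1 (t p)) x \<in> K x" if x: "x \<in> U" for x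
    unfolding restrict_apply'[OF x]
    by (rule K_lincomb[OF top[OF x] K_sheaf_secD[OF assms(1) x] K_sheaf_secD[OF assms(2) x]])
  ultimately show "Add K_sheaf U s t \<in> Sec K_sheaf U" unfolding eq K_sheaf_sec by blast
  show "own x (Add K_sheaf U s t x) = (\<lambda>i. own x (s x) i + own x (t x) i)" if x: "x \<in> U"
    using coord_lincomb[OF top[OF x] V_mem[OF top[OF x]] K_sheaf_secD[OF assms(1) x] K_sheaf_secD[OF assms(2) x], of 1 1] x
    by (simp add: eq)
qed

lemma K_sheaf_smul:
  assumes "s \<in> Sec K_sheaf U" "smooth_fun B U f"
  shows "Smul K_sheaf U f s \<in> Sec K_sheaf U"
    and "x \<in> U \<Longrightarrow> own x (Smul K_sheaf U f s x) = (\<lambda>i. f x * own x (s x) i)"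
proof -
  have U: "openin (Top B) U" by (rule smooth_fun_open[OF assms(2)])
  \<comment> \<open>The zero multiple of \<open>s\<close> itself casts scaling as a binary
    combination, so the lemmas on combinations apply.\<close>
  have eq: "Smul K_sheaf U f s = (\<lambda>p\<in>U. lc p (f p) (s p) 0 (s p))" by (simp add: K_sheaf_ops)
  have top: "x \<in> topspace (Top B)" if "x \<in> U" for x using openin_subset[OF U] that by blast
  have "(\<lambda>p\<in>U. lc p (f p) (s p) 0 (s p)) \<in> one_forms B U"
    using assms(1) unfolding K_sheaf_sec by (intro one_forms_lincomb smooth_fun_const U assms(2)) auto
  moreover have "(\<lambda>p\<in>U. lc p (f p) (s p) 0 (s p)) x \<in> K x" if x: "x \<in> U" for x
    unfolding restrict_apply'[OF x]
    by (rule K_lincomb[OF top[OF x] K_sheaf_secD[OF assms(1) x] K_sheaf_secD[OF assms(1) x]])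
  ultimately show "Smul K_sheaf U f s \<in> Sec K_sheaf U" unfolding eq K_sheaf_sec by blast
  show "own x (Smul K_sheaf U f s x) = (\<lambda>i. f x * own x (s x) i)" if x: "x \<in> U"
    using coord_lincomb[OF top[OF x] V_mem[OF top[OF x]] K_sheaf_secD[OF assms(1) x] K_sheaf_secD[OF assms(1) x], of "f x" 0] x
    by (simp add: eq)
qed

lemma germ_restrict:
  assumes s: "s \<in> Sec K_sheaf U" and W: "openin (Top B) W" "W \<subseteq> U" "b \<in> W"
  shows "germ W (restrict s W) b = germ U s b"
  by (rule germ_eqI[OF K_sheaf_restrict[OF s W(1,2)] s W(1,3)]) (use W(2) in auto)

lemma to_section_add:
  assumes U: "openin (Top B) U" and \<sigma>: "\<sigma> \<in> Sec E U" and \<tau>: "\<tau> \<in> Sec E U"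
  shows "to_section U (Add E U \<sigma> \<tau>) = Add (section_sheaf B r quotient_bundle) U (to_section U \<sigma>) (to_section U \<tau>)"
proof (rule extensionalityI[of _ U])
  show "to_section U (Add E U \<sigma> \<tau>) \<in> extensional U" by (simp add: to_section_def)
  show "Add (section_sheaf B r quotient_bundle) U (to_section U \<sigma>) (to_section U \<tau>) \<in> extensional U"
    by (simp add: section_sheaf_def)
  fix b assume b: "b \<in> U"
  obtain O1 s1 where O1: "openin (Top B) O1" "b \<in> O1" "O1 \<subseteq> U" "s1 \<in> Sec K_sheaf O1" "\<forall>x\<in>O1. \<sigma> x = germ O1 s1 x"
    by (rule E_secE[OF \<sigma> b])
  obtain O2 t1 where O2: "openin (Top B) O2" "b \<in> O2" "O2 \<subseteq> U" "t1 \<in> Sec K_sheaf O2" "\<forall>x\<in>O2. \<tau> x = germ O2 t1 x"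
    by (rule E_secE[OF \<tau> b])
  define O' where "O' = O1 \<inter> O2"
  have O': "openin (Top B) O'" "b \<in> O'" "O' \<subseteq> O1" "O' \<subseteq> O2" using O1 O2 by (auto simp: O'_def)
  define s where "s = restrict s1 O'"
  define t where "t = restrict t1 O'"
  have s: "s \<in> Sec K_sheaf O'" "\<sigma> b = germ O' s b"
    unfolding s_def bspec[OF O1(5,2)] germ_restrict[OF O1(4) O'(1,3,2)] by (rule K_sheaf_restrict[OF O1(4) O'(1,3)], rule refl)
  have t: "t \<in> Sec K_sheaf O'" "\<tau> b = germ O' t b"
    unfolding t_def bspec[OF O2(5,2)] germ_restrict[OF O2(4) O'(1,4,2)] by (rule K_sheaf_restrict[OF O2(4) O'(1,4)], rule refl)
  let ?A = "Add K_sheaf"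
  \<comment> \<open>Every admissible pair of representatives yields the same germ, as coordinates
    add and agree near \<open>b\<close>. The union in the definition of the sum therefore has a
    single distinct member.\<close>
  have all: "germ W (?A W s' t') b = germ O' (?A O' s t) b" if "(W, s') \<in> \<sigma> b" "(W, t') \<in> \<tau> b" for W s' t'
  proof -
    have m: "(W, s') \<in> germ O' s b" "(W, t') \<in> germ O' t b" using that s(2) t(2) by simp_all
    note ms = germ_mem[OF s(1) O'(2) m(1)] and mt = germ_mem[OF t(1) O'(2) m(2)]
    obtain N1 where N1: "openin (Top B) N1" "b \<in> N1" "N1 \<subseteq> O' \<inter> W" "\<And>x. x \<in> N1 \<Longrightarrow> own x (s x) = own x (s' x)"
      using ms(5) by blast
    obtain N2 where N2: "openin (Top B) N2" "b \<in> N2" "N2 \<subseteq> O' \<inter> W" "\<And>x. x \<in> N2 \<Longrightarrow> own x (t x) = own x (t' x)"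
      using mt(5) by blast
    show ?thesis
    proof (rule germ_eqI[OF K_sheaf_add(1)[OF ms(1) mt(1) ms(2)] K_sheaf_add(1)[OF s(1) t(1) O'(1)] openin_Int[OF N1(1) N2(1)]])
      show "b \<in> N1 \<inter> N2" "N1 \<inter> N2 \<subseteq> W \<inter> O'" using N1 N2 by blast+
      fix x assume "x \<in> N1 \<inter> N2"
      then have x: "x \<in> N1" "x \<in> N2" "x \<in> O'" "x \<in> W" using N1(3) by blast+
      show "own x (?A W s' t' x) = own x (?A O' s t x)"
        unfolding K_sheaf_add(2)[OF ms(1) mt(1) ms(2) x(4)] K_sheaf_add(2)[OF s(1) t(1) O'(1) x(3)]
          N1(4)[OF x(1)] N2(4)[OF x(2)] ..
    qed
  qed
  \<comment> \<open>Guarantees that the family of germs is nonempty, so its union is this germ and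
    not the empty set.\<close>
  have "(O', s) \<in> \<sigma> b" "(O', t) \<in> \<tau> b" unfolding s(2) t(2) using germ_self s(1) t(1) O'(1,2) by blast+
  then have "{germ W (?A W s' t') b | W s' t'. (W, s') \<in> \<sigma> b \<and> (W, t') \<in> \<tau> b} = {germ O' (?A O' s t) b}"
    using all by blast
  then have "Add E U \<sigma> \<tau> b = germ O' (?A O' s t) b" using b by (simp add: E_def quotient_sheaf_def)
  from to_section_apply[where \<sigma>="Add E U \<sigma> \<tau>", OF b this K_sheaf_add(1)[OF s(1) t(1) O'(1)] O'(1,2)]
  show "to_section U (Add E U \<sigma> \<tau>) b = Add (section_sheaf B r quotient_bundle) U (to_section U \<sigma>) (to_section U \<tau>) b"
    using to_section_apply[where \<sigma>=\<sigma>, OF b s(2,1) O'(1,2)] to_section_apply[where \<sigma>=\<tau>, OF b t(2,1) O'(1,2)] K_sheaf_add(2)[OF s(1) t(1) O'(1,2)] b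
    by (simp add: section_sheaf_def quotient_bundle_def)
qed

lemma to_section_smul:
  assumes f: "smooth_fun B U f" and \<sigma>: "\<sigma> \<in> Sec E U"
  shows "to_section U (Smul E U f \<sigma>) = Smul (section_sheaf B r quotient_bundle) U f (to_section U \<sigma>)"
proof (rule extensionalityI[of _ U])
  show "to_section U (Smul E U f \<sigma>) \<in> extensional U" by (simp add: to_section_def)
  show "Smul (section_sheaf B r quotient_bundle) U f (to_section U \<sigma>) \<in> extensional U" by (simp add: section_sheaf_def)
  fix b assume b: "b \<in> U"
  obtain O' s where O': "openin (Top B) O'" "b \<in> O'" "O' \<subseteq> U" and s1: "s \<in> Sec K_sheaf O'" "\<forall>x\<in>O'. \<sigma> x = germ O' s x"
    by (rule E_secE[OF \<sigma> b])
  have s: "s \<in> Sec K_sheaf O'" "\<sigma> b = germ O' s b" by (rule s1(1), rule bspec[OF s1(2) O'(2)])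
  let ?A = "\<lambda>W s. Smul K_sheaf W f s"
  have f': "smooth_fun B W f" if "openin (Top B) W" "W \<subseteq> U" for W by (rule smooth_fun_subset[OF f that])
  \<comment> \<open>Representatives over some \<open>W\<close> inside \<open>U\<close> are compared,
    so \<open>f\<close> is smooth on their domains and the products are sections.\<close>
  have all: "germ W (?A W s') b = germ O' (?A O' s) b" if WU: "W \<subseteq> U" and "(W, s') \<in> \<sigma> b" for W s'
  proof -
    have "(W, s') \<in> germ O' s b" using that s(2) by simp
    note ms = germ_mem[OF s(1) O'(2) this]
    obtain N1 where N1: "openin (Top B) N1" "b \<in> N1" "N1 \<subseteq> O' \<inter> W" "\<And>x. x \<in> N1 \<Longrightarrow> own x (s x) = own x (s' x)"
      using ms(5) by blast
    show ?thesis
    proof (rule germ_eqI[OF K_sheaf_smul(1)[OF ms(1) f'[OF ms(2) WU]] K_sheaf_smul(1)[OF s(1) f'[OF O'(1,3)]] N1(1,2)])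
      show "N1 \<subseteq> W \<inter> O'" using N1 by blast
      fix x assume x: "x \<in> N1"
      then have x': "x \<in> O'" "x \<in> W" using N1(3) by blast+
      show "own x (?A W s' x) = own x (?A O' s x)"
        unfolding K_sheaf_smul(2)[OF ms(1) f'[OF ms(2) WU] x'(2)] K_sheaf_smul(2)[OF s(1) f'[OF O'(1,3)] x'(1)]
          N1(4)[OF x] ..
    qed
  qed
  have "(O', s) \<in> \<sigma> b" unfolding s(2) using germ_self s(1) O'(1,2) by blast
  then have "{germ W (?A W s') b | W s'. W \<subseteq> U \<and> (W, s') \<in> \<sigma> b} = {germ O' (?A O' s) b}"
    using all O'(3) by blast
  then have "Smul E U f \<sigma> b = germ O' (?A O' s) b" using b by (simp add: E_def quotient_sheaf_def)
  from to_section_apply[where \<sigma>="Smul E U f \<sigma>", OF b this K_sheaf_smul(1)[OF s(1) f'[OF O'(1,3)]] O'(1,2)]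
  show "to_section U (Smul E U f \<sigma>) b = Smul (section_sheaf B r quotient_bundle) U f (to_section U \<sigma>) b"
    using to_section_apply[where \<sigma>=\<sigma>, OF b s(2,1) O'(1,2)] K_sheaf_smul(2)[OF s(1) f'[OF O'(1,3)] O'(2)] b
    by (simp add: section_sheaf_def quotient_bundle_def)
qed

lemma sheaf_isomorphic_bundle: "sheaf_isomorphic B E (section_sheaf B r quotient_bundle)"
  unfolding sheaf_isomorphic_def
proof (rule exI[of _ to_section], intro allI impI conjI ballI)
  fix U assume U: "openin (Top B) U"
  show "bij_betw (to_section U) (Sec E U) (Sec (section_sheaf B r quotient_bundle) U)"
    unfolding bij_betw_def
  proof
    show "inj_on (to_section U) (Sec E U)" by (rule inj_onI) (rule to_section_inj[OF U])
    show "to_section U ` Sec E U = Sec (section_sheaf B r quotient_bundle) U"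
      using to_section_sec[OF U] to_section_surj[OF U] by blast
  qed
  show "to_section U (Add E U \<sigma> \<tau>) = Add (section_sheaf B r quotient_bundle) U (to_section U \<sigma>) (to_section U \<tau>)"
    if "\<sigma> \<in> Sec E U" "\<tau> \<in> Sec E U" for \<sigma> \<tau> by (rule to_section_add[OF U that])
  show "to_section U (Smul E U f \<sigma>) = Smul (section_sheaf B r quotient_bundle) U f (to_section U \<sigma>)"
    if "smooth_fun B U f" "\<sigma> \<in> Sec E U" for f \<sigma> by (rule to_section_smul[OF that])
  show "to_section W (Res E U W \<sigma>) = Res (section_sheaf B r quotient_bundle) U W (to_section U \<sigma>)"
    if "openin (Top B) W \<and> W \<subseteq> U" "\<sigma> \<in> Sec E U" for W \<sigma>
    using that by (auto simp: E_def quotient_sheaf_def section_sheaf_def to_section_def fun_eq_iff)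
qed

end

section \<open>The frame construction applied to an integrable system\<close>

theorem proposition3p1:
  fixes M :: "('m, 'x::euclidean_space) manifold" and P :: "('m, 'x) bivector"
    and B :: "('b, 'y::euclidean_space) manifold" and Q :: "('b, 'y) bivector"
    and \<phi> :: "'m \<Rightarrow> 'b" and r :: nat
  assumes "nci_system M P B Q \<phi> r"
  shows "\<exists>E :: ('b, 'b \<times> (nat \<Rightarrow> real)) vbundle.
           vector_bundle B r E \<and> sheaf_isomorphic B (E_sheaf M P B Q \<phi>) (section_sheaf B r E)"
proof -
  obtain S D where *: "abstract_nci M P r S D" "poisson_manifold B Q" "DIM('x) = DIM('y) + r"
    "submersion M B \<phi>" "\<phi> ` topspace (Top M) = topspace (Top B)"
    "\<forall>p\<in>topspace (Top M). \<forall>q\<in>topspace (Top M). \<phi> p = \<phi> q \<longleftrightarrow> same_leaf S D p q"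
    "poisson_map M P B Q \<phi>"
    using assms unfolding nci_system_def by blast
  have M: "poisson_manifold M P" using *(1) unfolding abstract_nci_def by blast
  interpret nci M B \<phi> P Q r S D
  proof unfold_locales
    show "smooth_manifold M" "smooth_manifold B" using M *(2) unfolding poisson_manifold_def by blast+
    show "smooth_map M B \<phi>" using *(4) unfolding submersion_def by blast
  qed (use * M in blast)+
  have "\<exists>U f. frame_at U f \<and> b \<in> \<phi> ` U" if b: "b \<in> topspace (Top B)" for b
  proof -
    obtain m where m: "m \<in> topspace (Top M)" "b = \<phi> m" using b surjective by blast
    obtain U f where "frame_at U f" "m \<in> U" by (rule frame_at_exists[OF m(1)])
    then show ?thesis using m(2) by blast
  qed
  \<comment> \<open>One frame is fixed for every base point; its image in \<open>B\<close> is the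
    trivializing neighbourhood of that point.\<close>
  then obtain U f where frame: "frame_at (U b) (f b)" and mem: "b \<in> \<phi> ` U b" if "b \<in> topspace (Top B)" for b
    by metis
  let ?\<theta> = "\<lambda>b. base_form (U b) (f b)"
  interpret F: framed_quotient B ker_base ker_pullback r "\<lambda>b. \<phi> ` U b" ?\<theta>
  proof unfold_locales
    show "ker_base b \<noteq> {}" if "b \<in> topspace (Top B)" for b by (rule ker_base_nonempty[OF that])
    show "ker_base b \<subseteq> cotangent_space B b" for b unfolding ker_base_def by blast
    show "(\<lambda>X\<in>tangent_space B b. a * \<xi> X + a' * \<eta> X) \<in> ker_base b"
      if "b \<in> topspace (Top B)" "\<xi> \<in> ker_base b" "\<eta> \<in> ker_base b" for b \<xi> \<eta> a a' by (rule ker_base_lincomb[OF that])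
    show "(\<lambda>X\<in>tangent_space B b. a * \<xi> X + a' * \<eta> X) \<in> ker_pullback b"
      if "b \<in> topspace (Top B)" "\<xi> \<in> ker_pullback b" "\<eta> \<in> ker_pullback b" for b \<xi> \<eta> a a' by (rule ker_pullback_lincomb[OF that(2,3)])
    fix b assume b: "b \<in> topspace (Top B)"
    note fr = frame[OF b]
    show "openin (Top B) (\<phi> ` U b)" by (rule base_open[OF fr])
    show "b \<in> \<phi> ` U b" by (rule mem[OF b])
    show "?\<theta> b i \<in> one_forms B (\<phi> ` U b)" if "i < r" for i by (rule base_form_one_form[OF fr that])
    show "?\<theta> b i x \<in> ker_base x" if "i < r" "x \<in> \<phi> ` U b" for i x by (rule base_form_ker_base[OF fr that])
    show "\<exists>a. (\<lambda>X\<in>tangent_space B x. \<xi> X - (\<Sum>i<r. a i * ?\<theta> b i x X)) \<in> ker_pullback x"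
      if "x \<in> \<phi> ` U b" "\<xi> \<in> ker_base x" for x \<xi>
      using residue_exists[OF fr that] unfolding residue_def[OF fr] .
    show "a i = a' i" if x: "x \<in> \<phi> ` U b" and \<xi>: "\<xi> \<in> ker_base x"
      and 1: "(\<lambda>X\<in>tangent_space B x. \<xi> X - (\<Sum>i<r. a i * ?\<theta> b i x X)) \<in> ker_pullback x"
      and 2: "(\<lambda>X\<in>tangent_space B x. \<xi> X - (\<Sum>i<r. a' i * ?\<theta> b i x X)) \<in> ker_pullback x"
      and i: "i < r" for x \<xi> a a' i
    proof -
      have "\<xi> \<in> cotangent_space B x" using \<xi> unfolding ker_base_def by blast
      from residue_unique[OF fr x this _ _ i] show ?thesis unfolding residue_def[OF fr] using 1 2 by blast
    qed
    show "smooth_fun B (W \<inter> \<phi> ` U b) (\<lambda>x. a x i)"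
      if W: "openin (Top B) W" "\<omega> \<in> one_forms B W"
      and a: "\<And>x. x \<in> W \<inter> \<phi> ` U b \<Longrightarrow> (\<lambda>X\<in>tangent_space B x. \<omega> x X - (\<Sum>i<r. a x i * ?\<theta> b i x X)) \<in> ker_pullback x"
      and i: "i < r" for W \<omega> a i
      by (rule residue_smooth[OF fr W _ i]) (unfold residue_def[OF fr], rule a)
  qed
  \<comment> \<open>Both sheaves are cut out of the 1-forms by conditions at each point, so they
    agree with the fibrewise kernels.\<close>
  have "F.K_sheaf = ker_sharp_sheaf B Q"
  proof -
    have "{\<omega> \<in> one_forms B U. \<forall>b\<in>U. \<omega> b \<in> ker_base b} = {\<omega> \<in> one_forms B U. \<forall>b\<in>U. sharp B Q b (\<omega> b) = (\<lambda>_. 0)}" for U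
      using N.one_forms_cotangent unfolding ker_base_def by blast
    then show ?thesis unfolding F.K_sheaf_def ker_sharp_sheaf_def by simp
  qed
  \<comment> \<open>Here the points of \<open>M\<close> lying over \<open>U\<close> are grouped by
    their images in \<open>B\<close>.\<close>
  moreover have "F.N_sheaf = ker_sharp_pullback_sheaf M P B \<phi>"
  proof -
    have "{\<omega> \<in> one_forms B U. \<forall>b\<in>U. \<omega> b \<in> ker_pullback b} = {\<omega> \<in> one_forms B U. \<forall>p\<in>topspace (Top M). \<phi> p \<in> U \<longrightarrow>
        sharp M P p (pullback M B \<phi> p (\<omega> (\<phi> p))) = (\<lambda>_. 0)}" for U
      using N.one_forms_cotangent unfolding ker_pullback_def by blast
    then show ?thesis unfolding F.N_sheaf_def ker_sharp_pullback_sheaf_def by simp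
  qed
  ultimately have "F.E = E_sheaf M P B Q \<phi>" unfolding F.E_def E_sheaf_def by simp
  then show ?thesis using F.vector_bundle_bundle F.sheaf_isomorphic_bundle by auto
qed

end
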